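(* Let $\mathcal C$ be a family of projective lines in $\mathbb P^2_{\mathbb C}$ such that $\bigcup_{\ell\in\mathcal C}\ell$ is closed, and set $\Omega:=\mathbb P^2_{\mathbb C}\setminus\bigcup_{\ell\in\mathcal C}\ell$. Assume that $\mathcal C$ contains five lines in general position and that, for every $p\in\partial\Omega$, there exist five lines $\ell_0,\ell_1,\ell_2,\ell_3,\ell_4\in\mathcal C$ in general position with $p\in\ell_0$. Then every connected component $\Omega_0$ of $\Omega$ is complete Kobayashi hyperbolic and Kobayashi hyperbolically embedded in $\mathbb P^2_{\mathbb C}$.
   Context: Lines in the complex projective plane $\mathbb P^2_{\mathbb C}$ are in general position if they are distinct and no three are concurrent. A domain $\Omega_0\subset\mathbb P^2_{\mathbb C}$ with Kobayashi pseudodistance $k_{\Omega_0}$ is complete Kobayashi hyperbolic if $k_{\Omega_0}$ is a complete distance. It is Kobayashi hyperbolically embedded in $\mathbb P^2_{\mathbb C}$ if for all distinct $p,q\in\overline{\Omega_0}$ there are neighborhoods $U_p,U_q\subset\mathbb P^2_{\mathbb C}$ of $p,q$ and $\varepsilon>0$ with $k_{\Omega_0}(x,y)\ge\varepsilon$ for all $x\in U_p\cap\Omega_0$, $y\in U_q\cap\Omega_0$. *)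

theory Defs
  imports "HOL-Analysis.Analysis"
begin

section \<open>The complex projective plane\<close>

definition proj_rel :: "complex^3 \<Rightarrow> complex^3 \<Rightarrow> bool" where
  "proj_rel v w \<longleftrightarrow> v \<noteq> 0 \<and> w \<noteq> 0 \<and> (\<exists>c. c \<noteq> 0 \<and> w = c *s v)"

lemma part_equivp_proj_rel: "part_equivp proj_rel"
proof (rule part_equivpI)
  show "\<exists>v. proj_rel v v"
    by (rule exI[of _ "axis 1 1"])
      (auto simp: proj_rel_def axis_eq_0_iff intro!: exI[of _ 1])
  show "symp proj_rel"
  proof (rule sympI)
    fix v w assume "proj_rel v w"
    then obtain c where "v \<noteq> 0" "w \<noteq> 0" "c \<noteq> 0" "w = c *s v"
      by (auto simp: proj_rel_def)
    moreover from this have "v = inverse c *s w"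
      by (simp add: vector_smult_assoc)
    ultimately show "proj_rel w v"
      unfolding proj_rel_def by (metis inverse_nonzero_iff_nonzero)
  qed
  show "transp proj_rel"
  proof (rule transpI)
    fix u v w assume "proj_rel u v" "proj_rel v w"
    then obtain c d where "u \<noteq> 0" "w \<noteq> 0" "c \<noteq> 0" "d \<noteq> 0" "v = c *s u" "w = d *s v"
      by (auto simp: proj_rel_def)
    moreover from this have "w = (d * c) *s u"
      by (simp add: vector_smult_assoc)
    ultimately show "proj_rel u w"
      unfolding proj_rel_def by (metis mult_eq_0_iff)
  qed
qed

text \<open>\<open>abs_cp2 v\<close> is the point with homogeneous coordinates \<open>v\<close>; it is meaningful only
  for \<open>v \<noteq> 0\<close>.\<close>
quotient_type cp2 = "complex^3" / partial: proj_rel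
  by (rule part_equivp_proj_rel)

text \<open>The quotient topology from \<open>\<complex>\<^sup>3 - {0}\<close>. As \<open>\<complex>\<^sup>3 - {0}\<close> is open in \<open>\<complex>\<^sup>3\<close>, openness of the
  preimage may be tested in \<open>\<complex>\<^sup>3\<close>.\<close>
instantiation cp2 :: topological_space
begin

definition open_cp2 :: "cp2 set \<Rightarrow> bool" where
  "open_cp2 U \<longleftrightarrow> open {v. v \<noteq> 0 \<and> abs_cp2 v \<in> U}"

instance
proof
  have "{v :: complex^3. v \<noteq> 0 \<and> abs_cp2 v \<in> UNIV} = - {0}"
    by auto
  then show "open (UNIV :: cp2 set)"
    unfolding open_cp2_def by (simp add: open_Compl)
next
  fix S T :: "cp2 set" assume "open S" "open T"
  moreover have "{v. v \<noteq> 0 \<and> abs_cp2 v \<in> S \<inter> T} =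
      {v. v \<noteq> 0 \<and> abs_cp2 v \<in> S} \<inter> {v. v \<noteq> 0 \<and> abs_cp2 v \<in> T}"
    by auto
  ultimately show "open (S \<inter> T)"
    unfolding open_cp2_def by (simp add: open_Int)
next
  fix K :: "cp2 set set" assume "\<forall>S\<in>K. open S"
  moreover have "{v. v \<noteq> 0 \<and> abs_cp2 v \<in> \<Union>K} = (\<Union>S\<in>K. {v. v \<noteq> 0 \<and> abs_cp2 v \<in> S})"
    by auto
  ultimately show "open (\<Union>K)"
    unfolding open_cp2_def by (simp add: open_UN)
qed

end

definition projective_line :: "cp2 set \<Rightarrow> bool" where
  "projective_line L \<longleftrightarrow>
    (\<exists>a :: complex^3. a \<noteq> 0 \<and> L = {abs_cp2 v | v. v \<noteq> 0 \<and> (\<Sum>i\<in>UNIV. a $ i * v $ i) = 0})"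

definition concurrent :: "cp2 set \<Rightarrow> cp2 set \<Rightarrow> cp2 set \<Rightarrow> bool" where
  "concurrent L M N \<longleftrightarrow> (\<exists>p. p \<in> L \<and> p \<in> M \<and> p \<in> N)"

definition general_position :: "'i set \<Rightarrow> ('i \<Rightarrow> cp2 set) \<Rightarrow> bool" where
  "general_position I l \<longleftrightarrow>
    inj_on l I \<and>
    (\<forall>i\<in>I. \<forall>j\<in>I. \<forall>k\<in>I. i \<noteq> j \<and> j \<noteq> k \<and> i \<noteq> k \<longrightarrow> \<not> concurrent (l i) (l j) (l k))"

section \<open>Holomorphic discs\<close>

text \<open>The complex structure is given by the three standard affine charts: chart \<open>k\<close> has domain
  \<open>chart_domain k\<close>, the points with nonzero \<open>k\<close>-th homogeneous coordinate, and coordinate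
  functions \<open>affine_coord k j\<close> for \<open>j \<noteq> k\<close> (the function \<open>affine_coord k k\<close> is constantly \<open>1\<close>
  there).\<close>

lift_definition in_chart :: "3 \<Rightarrow> cp2 \<Rightarrow> bool" is "\<lambda>k v. v $ k \<noteq> 0"
  by (auto simp: proj_rel_def)

definition chart_domain :: "3 \<Rightarrow> cp2 set" where
  "chart_domain k = {p. in_chart k p}"

lift_definition affine_coord :: "3 \<Rightarrow> 3 \<Rightarrow> cp2 \<Rightarrow> complex" is "\<lambda>k j v. v $ j / v $ k"
  by (auto simp: proj_rel_def)

abbreviation unit_disc :: "complex set" where
  "unit_disc \<equiv> ball 0 1"

text \<open>By continuity the sets \<open>{z \<in> unit_disc. f z \<in> chart_domain k}\<close> are open, so
  \<open>holomorphic_on\<close> is ordinary holomorphy there.\<close>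
definition holomorphic_disc :: "cp2 set \<Rightarrow> (complex \<Rightarrow> cp2) \<Rightarrow> bool" where
  "holomorphic_disc X f \<longleftrightarrow>
    f ` unit_disc \<subseteq> X \<and> continuous_on unit_disc f \<and>
    (\<forall>k j. (\<lambda>z. affine_coord k j (f z)) holomorphic_on {z \<in> unit_disc. f z \<in> chart_domain k})"

section \<open>The Kobayashi pseudodistance\<close>

text \<open>The distance of the Poincare metric \<open>2 |dz| / (1 - |z|^2)\<close> of curvature \<open>-1\<close>.
  A different normalization multiplies the Kobayashi pseudodistance by a constant.\<close>
definition poincare_dist :: "complex \<Rightarrow> complex \<Rightarrow> real" where
  "poincare_dist a b = 2 * artanh (cmod ((a - b) / (1 - cnj a * b)))"

text \<open>Lengths of the chains \<open>p = x 0, \<dots>, x n = q\<close> whose consecutive points \<open>x i\<close> and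
  \<open>x (Suc i)\<close> are joined by a holomorphic disc \<open>f i\<close> in \<open>X\<close>.\<close>
definition kobayashi_chain_lengths :: "cp2 set \<Rightarrow> cp2 \<Rightarrow> cp2 \<Rightarrow> real set" where
  "kobayashi_chain_lengths X p q =
    {(\<Sum>i<n. poincare_dist (a i) (b i)) | (n :: nat) x f a b.
      0 < n \<and> x 0 = p \<and> x n = q \<and>
      (\<forall>i<n. holomorphic_disc X (f i) \<and> a i \<in> unit_disc \<and> b i \<in> unit_disc \<and>
        f i (a i) = x i \<and> f i (b i) = x (Suc i))}"

text \<open>For domains \<open>X\<close>: any two points of a connected open set are joined by a chain, so
  the infimum is over a nonempty set. Points outside \<open>X\<close> receive the dummy value \<open>0\<close> because
  the locale \<open>Metric_space\<close> requires nonnegativity for all arguments.\<close>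
definition kobayashi_dist :: "cp2 set \<Rightarrow> cp2 \<Rightarrow> cp2 \<Rightarrow> real" where
  "kobayashi_dist X p q =
    (if p \<in> X \<and> q \<in> X then Inf (kobayashi_chain_lengths X p q) else 0)"

definition complete_kobayashi_hyperbolic :: "cp2 set \<Rightarrow> bool" where
  "complete_kobayashi_hyperbolic X \<longleftrightarrow>
    Metric_space X (kobayashi_dist X) \<and> Metric_space.mcomplete X (kobayashi_dist X)"

definition kobayashi_hyperbolically_embedded :: "cp2 set \<Rightarrow> bool" where
  "kobayashi_hyperbolically_embedded X \<longleftrightarrow>
    (\<forall>p\<in>closure X. \<forall>q\<in>closure X. p \<noteq> q \<longrightarrow>
      (\<exists>U V \<epsilon>. open U \<and> p \<in> U \<and> open V \<and> q \<in> V \<and> 0 < \<epsilon> \<and>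
        (\<forall>x\<in>U \<inter> X. \<forall>y\<in>V \<inter> X. \<epsilon> \<le> kobayashi_dist X x y)))"

end

theory Submission
  imports Defs "HOL-Complex_Analysis.Riemann_Mapping"
begin

text \<open>The heart of the matter is M. Green's theorem for five lines in general position: lifts \<open>F\<close> of
  holomorphic discs avoiding them satisfy \<open>\<parallel>F\<parallel> \<le> C \<bar>g i\<bar>\<close> on a fixed smaller disc for one of the
  five zero-free functions \<open>g i = a i \<cdot> F\<close>. Instead of Brody's lemma and Nevanlinna theory, the
  logarithms \<open>ln \<bar>g i / g j\<bar>\<close> are rescaled by their maximal size. In the limit they become
  differences of harmonic functions \<open>U i\<close>, at least three of which attain the maximum of all five
  at each point; hence a single \<open>U i\<close> is the maximum, and Harnack's inequality forbids growth.
  When the logarithms are large at the centre, the disc stays close to one of the lines, on which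
  the others cut out four points, and Schottky's theorem applies.

  Consequently, bounded functions separating the points of the plane are Lipschitz for the Kobayashi
  pseudodistance, which gives hyperbolicity and the hyperbolic embedding. For a line through a
  boundary point, Harnack's inequality makes the double logarithm of the distance to the line
  locally Lipschitz as well, so no Cauchy sequence can approach the boundary.\<close>

section \<open>Harnack inequalities and the tropical limit\<close>

text \<open>The largest difference of the five logarithms is a maximum of harmonic functions, and no
  Harnack inequality bounds the growth of such a maximum in advance; the family rescaled at a fixed
  centre could fail to be normal. Hence there are two rescalings: one around picked points, where
  the growth is controlled by construction, which proves \<open>spread_growth\<close>; then one
  around \<open>0\<close>, where \<open>spread_growth\<close> supplies the bound that Montel's
  theorem needs. Five is the number that makes the maximum stay with one function. Every three forms
  control the vector, so a maximal modulus can be removed twice and three candidates still remain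
  for a third one. Three moduli that agree identically leave no point where a different one could
  take over, because every three indices include a maximal one. Four lines would guarantee only two
  maximal moduli. The constants depend on the five forms and not on the disc. In the completeness
  proof the forms may vary with the boundary point, since only one limit point has to be excluded at
  a time.\<close>

lemma Harnack_pos:
  assumes hol: "P holomorphic_on ball 0 R" and pos: "\<And>z. z \<in> ball 0 R \<Longrightarrow> 0 < Re (P z)"
    and z: "norm z < R"
  shows "(R - norm z) * Re (P z) \<le> (R + norm z) * Re (P 0)"
    and "(R - norm z) * Re (P 0) \<le> (R + norm z) * Re (P z)"
proof -
  have R: "R > 0" using z norm_ge_zero[of z] by linarith
  define p where "p = P 0"
  have p: "Re p > 0" using pos[of 0] R by (simp add: p_def)
  \<comment> \<open>The Cayley transform takes the right half-plane to the unit disc and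
    \<open>p\<close> to \<open>0\<close>. With the ball rescaled to radius \<open>1\<close>, the
    Schwarz lemma applies to \<open>S\<close>.\<close>
  define S where "S = (\<lambda>\<zeta>. (P (of_real R * \<zeta>) - p) / (P (of_real R * \<zeta>) + cnj p))"
  have in_ball: "of_real R * \<zeta> \<in> ball 0 R" if "norm \<zeta> < 1" for \<zeta> :: complex
    using that R by (simp add: norm_mult)
  have nz: "P (of_real R * \<zeta>) + cnj p \<noteq> 0" if "norm \<zeta> < 1" for \<zeta>
  proof -
    have "Re (P (of_real R * \<zeta>) + cnj p) > 0" using pos[OF in_ball[OF that]] p by simp
    then show ?thesis by force
  qed
  have holS: "S holomorphic_on ball 0 1"
    unfolding S_def
  proof (intro holomorphic_intros)
    show "(\<lambda>\<zeta>. P (of_real R * \<zeta>)) holomorphic_on ball 0 1"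
      using holomorphic_on_compose_gen[OF _ hol, of "\<lambda>\<zeta>. of_real R * \<zeta>" "ball 0 1"] in_ball
      by (force simp: o_def intro!: holomorphic_intros)
    then show "(\<lambda>\<zeta>. P (of_real R * \<zeta>)) holomorphic_on ball 0 1" .
  qed (use nz in auto)
  have less: "norm (w - p) < norm (w + cnj p)" if "Re w > 0" for w
  proof -
    have "(norm (w + cnj p))\<^sup>2 - (norm (w - p))\<^sup>2 = 4 * Re w * Re p"
      unfolding cmod_power2 by (simp add: power2_eq_square algebra_simps)
    then have "(norm (w - p))\<^sup>2 < (norm (w + cnj p))\<^sup>2" using that p by (simp add: field_simps)
    then show ?thesis by (rule power2_less_imp_less) simp
  qed
  have S1: "norm (S \<zeta>) < 1" if "norm \<zeta> < 1" for \<zeta>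
    using less[OF pos[OF in_ball[OF that]]] nz[OF that] by (simp add: S_def norm_divide divide_simps)
  define t where "t = norm z / R"
  have t: "0 \<le> t" "t < 1" using z R by (auto simp: t_def)
  have z': "norm (z / of_real R) < 1" using z R by (simp add: norm_divide)
  have "norm (S (z / of_real R)) \<le> norm (z / of_real R)"
    by (rule Schwarz_Lemma(1)[OF holS]) (use S1 z' in \<open>auto simp: S_def p_def\<close>)
  moreover have "norm (z / of_real R) = t" using R by (simp add: t_def norm_divide)
  ultimately have "norm (P z - p) \<le> t * norm (P z + cnj p)"
    using nz[OF z'] R by (simp add: S_def norm_divide divide_simps)
  then have "(norm (P z - p))\<^sup>2 \<le> (t * norm (P z + cnj p))\<^sup>2"
    by (intro power_mono) auto
  then have *: "(Re (P z) - Re p)\<^sup>2 + (Im (P z) - Im p)\<^sup>2 \<le> t\<^sup>2 * ((Re (P z) + Re p)\<^sup>2 + (Im (P z) - Im p)\<^sup>2)"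
    unfolding power_mult_distrib cmod_power2 by simp
  \<comment> \<open>The same imaginary part occurs on both sides. Since \<open>t < 1\<close> it
    cancels, which leaves an inequality between real parts.\<close>
  have "t\<^sup>2 * (Im (P z) - Im p)\<^sup>2 \<le> 1 * (Im (P z) - Im p)\<^sup>2"
    using t by (intro mult_right_mono) (auto simp: power_le_one)
  with * have "(Re (P z) - Re p)\<^sup>2 \<le> t\<^sup>2 * (Re (P z) + Re p)\<^sup>2"
    unfolding distrib_left by linarith
  then have "(Re (P z) - Re p)\<^sup>2 \<le> (t * (Re (P z) + Re p))\<^sup>2"
    by (simp only: power_mult_distrib)
  moreover have "0 \<le> t * (Re (P z) + Re p)" using t p pos[of z] z by simp
  ultimately have "\<bar>Re (P z) - Re p\<bar> \<le> t * (Re (P z) + Re p)"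
    by (simp add: abs_le_square_iff[symmetric])
  then have "R * \<bar>Re (P z) - Re p\<bar> \<le> norm z * (Re (P z) + Re p)"
    using R by (simp add: t_def field_simps)
  moreover have "R * (Re (P z) - Re p) \<le> R * \<bar>Re (P z) - Re p\<bar>"
    "R * (Re p - Re (P z)) \<le> R * \<bar>Re (P z) - Re p\<bar>"
    using R by (auto intro!: mult_left_mono)
  ultimately show "(R - norm z) * Re (P z) \<le> (R + norm z) * Re (P 0)"
    and "(R - norm z) * Re (P 0) \<le> (R + norm z) * Re (P z)"
    unfolding p_def[symmetric] by (auto simp: algebra_simps)
qed

lemma ln_norm_eq_Re: "exp w = q \<Longrightarrow> ln (norm q) = Re w"
  by (metis ln_exp norm_exp_eq_Re)

text \<open>On a disc \<open>Q\<close> has a logarithm \<open>g\<close>, and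
  \<open>- ln (norm (Q z))\<close> is the real part of \<open>- g\<close>. That is only nonnegative,
  so \<open>Harnack_pos\<close> is applied to \<epsilon> minus \<open>g\<close>, and then \<epsilon>
  tends to \<open>0\<close>.\<close>

lemma Harnack_ln:
  fixes Q :: "complex \<Rightarrow> complex"
  assumes hol: "Q holomorphic_on ball 0 R" and nz: "\<And>z. z \<in> ball 0 R \<Longrightarrow> Q z \<noteq> 0"
    and le: "\<And>z. z \<in> ball 0 R \<Longrightarrow> norm (Q z) \<le> 1" and z: "norm z < R"
  shows "(R - norm z) * - ln (norm (Q z)) \<le> (R + norm z) * - ln (norm (Q 0))"
    and "(R - norm z) * - ln (norm (Q 0)) \<le> (R + norm z) * - ln (norm (Q z))"
proof -
  have R: "R > 0" using z norm_ge_zero[of z] by linarith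
  obtain g where g: "g holomorphic_on ball 0 R" "\<And>x. x \<in> ball 0 R \<Longrightarrow> exp (g x) = Q x"
    using holomorphic_logarithm_exists[OF convex_ball open_ball hol nz, of 0] R
    by (metis centre_in_ball)
  have lnQ: "ln (norm (Q x)) = Re (g x)" if "x \<in> ball 0 R" for x
    by (rule ln_norm_eq_Re) (use g that in auto)
  have Re_le: "Re (g x) \<le> 0" if "x \<in> ball 0 R" for x
    using le[OF that] nz[OF that] lnQ[OF that] by (metis ln_le_zero_iff zero_less_norm_iff)
  have 1: "(R - norm z) * (\<epsilon> - Re (g z)) \<le> (R + norm z) * (\<epsilon> - Re (g 0))"
    and 2: "(R - norm z) * (\<epsilon> - Re (g 0)) \<le> (R + norm z) * (\<epsilon> - Re (g z))" if "\<epsilon> > 0" for \<epsilon>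
    using Harnack_pos[of "\<lambda>x. of_real \<epsilon> - g x" R z] g(1) Re_le that z
    by (force intro!: holomorphic_intros)+
  have lim: "((\<lambda>\<epsilon>. c * (\<epsilon> - x)) \<longlongrightarrow> c * (0 - x)) (at_right 0)" for c x :: real
    by (intro tendsto_intros)
  have z': "z \<in> ball 0 R" "0 \<in> ball (0::complex) R" using z R by auto
  have ev: "\<forall>\<^sub>F \<epsilon> in at_right (0::real). \<epsilon> > 0" by (simp add: eventually_at_right_less)
  have "(R - norm z) * (0 - Re (g z)) \<le> (R + norm z) * (0 - Re (g 0))"
    by (rule tendsto_le[OF _ lim lim]) (use ev in \<open>auto elim!: eventually_mono intro: 1\<close>)
  then show "(R - norm z) * - ln (norm (Q z)) \<le> (R + norm z) * - ln (norm (Q 0))"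
    using lnQ z' by simp
  have "(R - norm z) * (0 - Re (g 0)) \<le> (R + norm z) * (0 - Re (g z))"
    by (rule tendsto_le[OF _ lim lim]) (use ev in \<open>auto elim!: eventually_mono intro: 2\<close>)
  then show "(R - norm z) * - ln (norm (Q 0)) \<le> (R + norm z) * - ln (norm (Q z))"
    using lnQ z' by simp
qed

text \<open>Model: the values on a holomorphic lift of five linear forms in general position, where at
  every point any three of the forms control the norm of the vector.\<close>

definition five_units :: "real \<Rightarrow> complex set \<Rightarrow> (nat \<Rightarrow> complex \<Rightarrow> complex) \<Rightarrow> bool" where
  "five_units \<kappa> S g \<longleftrightarrow>
    (\<forall>i\<le>4. g i holomorphic_on S \<and> (\<forall>z\<in>S. g i z \<noteq> 0)) \<and>
    (\<forall>z\<in>S. \<forall>T\<subseteq>{..4}. card T = 3 \<longrightarrow> (\<exists>i\<in>T. \<forall>l\<le>4. norm (g l z) \<le> \<kappa> * norm (g i z)))"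

lemma five_units_attain:
  assumes "five_units \<kappa> S g" "z \<in> S" "T \<subseteq> {..4}" "3 \<le> card T"
  obtains i where "i \<in> T" "\<And>l. l \<le> 4 \<Longrightarrow> norm (g l z) \<le> \<kappa> * norm (g i z)"
proof -
  obtain T' where "T' \<subseteq> T" "card T' = 3"
    using obtain_subset_with_card_n[OF assms(4)] by metis
  with assms that show thesis
    unfolding five_units_def by (meson subset_iff subset_trans)
qed

lemma interior_UN_closed_empty:
  fixes Z :: "'i \<Rightarrow> 'a::topological_space set"
  assumes "finite I" "\<And>i. i \<in> I \<Longrightarrow> closed (Z i)" "\<And>i. i \<in> I \<Longrightarrow> interior (Z i) = {}"
  shows "interior (\<Union>i\<in>I. Z i) = {}"
  using assms
  by (induction I rule: finite_induct) (auto simp: interior_closed_Un_empty_interior)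

text \<open>On \<open>U\<close> the quotient of the functions takes values in the unit circle, which
  has empty interior; by the open mapping theorem the quotient is constant.\<close>

lemma norm_eq_on_ball_if_interior:
  fixes f g :: "complex \<Rightarrow> complex"
  assumes hol: "f holomorphic_on ball 0 R" "g holomorphic_on ball 0 R"
    and nz: "\<And>z. z \<in> ball 0 R \<Longrightarrow> g z \<noteq> 0"
    and U: "open U" "U \<noteq> {}" "U \<subseteq> ball 0 R" and eq: "\<And>z. z \<in> U \<Longrightarrow> norm (f z) = norm (g z)"
    and z: "z \<in> ball 0 R"
  shows "norm (f z) = norm (g z)"
proof -
  define q where "q = (\<lambda>z. f z / g z)"
  have holq: "q holomorphic_on ball 0 R"
    unfolding q_def using hol nz by (intro holomorphic_intros) auto
  have q1: "norm (q z) = 1" if "z \<in> U" for z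
    using eq[OF that] nz[of z] U that by (auto simp: q_def norm_divide)
  have "q constant_on ball 0 R"
  proof (rule ccontr)
    assume "\<not> ?thesis"
    from open_mapping_thm[OF holq _ _ U(1,3) this] have "open (q ` U)" by auto
    moreover obtain u where "u \<in> U" using U(2) by auto
    ultimately obtain e where e: "e > 0" "ball (q u) e \<subseteq> q ` U"
      by (metis imageI open_contains_ball)
    \<comment> \<open>A small radial move from \<open>q u\<close> stays in the ball but leaves the
      unit circle.\<close>
    have "q u + of_real (e/2) * q u \<in> ball (q u) e"
      using e q1[OF \<open>u \<in> U\<close>] by (simp add: dist_norm norm_mult)
    then have "norm (q u + of_real (e/2) * q u) = 1" using e q1 by auto
    moreover have "q u + of_real (e/2) * q u = of_real (1 + e/2) * q u" by (simp add: algebra_simps)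
    ultimately have "\<bar>1 + e/2\<bar> = 1" using q1[OF \<open>u \<in> U\<close>] by (metis norm_mult norm_of_real mult.right_neutral)
    then show False using e by simp
  qed
  then obtain c where c: "\<And>z. z \<in> ball 0 R \<Longrightarrow> q z = c" by (auto simp: constant_on_def)
  moreover obtain u where "u \<in> U" using U by auto
  ultimately have "norm (q z) = 1" using q1[of u] U z by (metis subsetD)
  then show ?thesis using nz[OF z] by (simp add: q_def norm_divide)
qed

text \<open>For \<open>\<kappa> = 1\<close> at least three of the five moduli are maximal at every point. At a point outside
  the nowhere dense coincidence sets of the pairs with different moduli, the three maximal moduli
  agree identically, and then they dominate everywhere, since any three of the five include a
  maximal one.\<close>

lemma five_units_rigid:
  assumes E: "five_units 1 (ball 0 R) E" and R: "R > 0"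
  obtains m where "m \<le> 4" "\<And>j z. j \<le> 4 \<Longrightarrow> z \<in> ball 0 R \<Longrightarrow> norm (E j z) \<le> norm (E m z)"
proof -
  have hol: "E i holomorphic_on ball 0 R" and nz: "\<And>z. z \<in> ball 0 R \<Longrightarrow> E i z \<noteq> 0" if "i \<le> 4" for i
    using E that by (auto simp: five_units_def)
  \<comment> \<open>Restricting to a smaller closed ball makes the coincidence sets closed in the
    whole plane, as \<open>interior_UN_closed_empty\<close> requires.\<close>
  define Z where "Z = (\<lambda>(i,j). {z \<in> cball 0 (R/2). norm (E i z) - norm (E j z) = 0})"
  have sub: "cball (0::complex) (R/2) \<subseteq> ball 0 R" using R by auto
  have clZ: "closed (Z (i,j))" if "i \<le> 4" "j \<le> 4" for i j
  proof -
    have "continuous_on (cball 0 (R/2)) (\<lambda>z. norm (E i z) - norm (E j z))"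
      by (intro continuous_intros holomorphic_on_imp_continuous_on holomorphic_on_subset[OF hol sub] that)
    from continuous_closed_preimage_constant[OF this closed_cball, of 0] show ?thesis
      by (simp only: Z_def prod.case)
  qed
  have eqE: "norm (E i z) = norm (E j z)"
    if ij: "i \<le> 4" "j \<le> 4" "interior (Z (i,j)) \<noteq> {}" and z: "z \<in> ball 0 R" for i j z
  proof (rule norm_eq_on_ball_if_interior[OF hol hol nz, where U = "interior (Z (i,j))"])
    show "interior (Z (i,j)) \<subseteq> ball 0 R"
      by (rule subset_trans[OF interior_subset]) (use sub in \<open>unfold Z_def, blast\<close>)
    show "norm (E i z) = norm (E j z)" if "z \<in> interior (Z (i,j))" for z
      using that interior_subset[of "Z (i,j)"] by (auto simp: Z_def)
  qed (use ij z in auto)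
  define I where "I = {p \<in> {..4} \<times> {..4}. interior (Z p) = {}}"
  have "interior (\<Union>p\<in>I. Z p) = {}"
    by (rule interior_UN_closed_empty) (auto simp: I_def clZ)
  then have "\<not> cball 0 (R/2) \<subseteq> (\<Union>p\<in>I. Z p)"
    using R interior_mono[of "cball (0::complex) (R/2)" "\<Union>p\<in>I. Z p"] by auto
  then obtain z0 where z0: "z0 \<in> cball 0 (R/2)" "\<And>p. p \<in> I \<Longrightarrow> z0 \<notin> Z p" by blast
  have z0b: "z0 \<in> ball 0 R" using z0 sub by auto
  have same: "norm (E i z) = norm (E j z)"
    if "i \<le> 4" "j \<le> 4" "norm (E i z0) = norm (E j z0)" "z \<in> ball 0 R" for i j z
  proof -
    have "z0 \<in> Z (i,j)" using z0 that by (auto simp: Z_def)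
    then have "(i,j) \<notin> I" using z0(2) by blast
    then show ?thesis using eqE that by (auto simp: I_def)
  qed
  obtain a where a: "a \<in> {..4}" "\<And>l. l \<le> 4 \<Longrightarrow> norm (E l z0) \<le> 1 * norm (E a z0)"
    by (rule five_units_attain[OF E z0b, of "{..4}"]) auto
  obtain b where b: "b \<in> {..4} - {a}" "\<And>l. l \<le> 4 \<Longrightarrow> norm (E l z0) \<le> 1 * norm (E b z0)"
    by (rule five_units_attain[OF E z0b, of "{..4} - {a}"]) (use a in auto)
  obtain c where c: "c \<in> {..4} - {a,b}" "\<And>l. l \<le> 4 \<Longrightarrow> norm (E l z0) \<le> 1 * norm (E c z0)"
    by (rule five_units_attain[OF E z0b, of "{..4} - {a,b}"]) (use a b in \<open>auto simp: card_Diff_subset\<close>)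
  have le4: "a \<le> 4" "b \<le> 4" "c \<le> 4" using a b c by auto
  have "norm (E j z) \<le> norm (E a z)" if j: "j \<le> 4" and z: "z \<in> ball 0 R" for j z
  proof -
    obtain d where d: "d \<in> {a,b,c}" "\<And>l. l \<le> 4 \<Longrightarrow> norm (E l z) \<le> 1 * norm (E d z)"
      by (rule five_units_attain[OF E z, of "{a,b,c}"]) (use a b c in auto)
    have "norm (E b z0) = norm (E a z0)" "norm (E c z0) = norm (E a z0)"
      using a(2)[OF le4(2)] a(2)[OF le4(3)] b(2)[OF le4(1)] c(2)[OF le4(1)] by linarith+
    then have "norm (E d z) = norm (E a z)"
      using d(1) same[OF le4(2,1) _ z] same[OF le4(3,1) _ z] by blast
    then show ?thesis using d(2)[OF j] by simp
  qed
  with le4 that show thesis by blast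
qed

section \<open>The oscillation of the five logarithms\<close>

lemma tendsto_Max_image:
  fixes f :: "'i \<Rightarrow> 'a \<Rightarrow> real"
  assumes "finite I" "I \<noteq> {}" "\<And>i. i \<in> I \<Longrightarrow> (f i \<longlongrightarrow> L i) F"
  shows "((\<lambda>x. Max ((\<lambda>i. f i x) ` I)) \<longlongrightarrow> Max (L ` I)) F"
  using assms
proof (induction I rule: finite_ne_induct)
  case (insert i I)
  then have "((\<lambda>x. max (f i x) (Max ((\<lambda>i. f i x) ` I))) \<longlongrightarrow> max (L i) (Max (L ` I))) F"
    by (intro tendsto_max) auto
  with insert show ?case by simp
qed simp

text \<open>The largest minus the smallest of the five logarithms. It does not change when all
  \<open>g i\<close> are multiplied by a common zero-free function, so it depends on the disc and
  not on its lift. As a maximum over ordered pairs it is a maximum of harmonic functions.\<close>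

definition spread :: "(nat \<Rightarrow> complex \<Rightarrow> complex) \<Rightarrow> complex \<Rightarrow> real" where
  "spread g z = Max ((\<lambda>(i,j). ln (norm (g i z)) - ln (norm (g j z))) ` ({..4} \<times> {..4}))"

lemma spread_ge: "i \<le> 4 \<Longrightarrow> j \<le> 4 \<Longrightarrow> ln (norm (g i z)) - ln (norm (g j z)) \<le> spread g z"
  unfolding spread_def by (rule Max_ge) auto

lemma spread_attained:
  obtains i j where "i \<le> 4" "j \<le> 4" "spread g z = ln (norm (g i z)) - ln (norm (g j z))"
proof -
  have "spread g z \<in> (\<lambda>(i,j). ln (norm (g i z)) - ln (norm (g j z))) ` ({..4} \<times> {..4})"
    unfolding spread_def by (rule Max_in) auto
  with that show thesis by auto
qed

lemma spread_nonneg: "0 \<le> spread g z"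
  using spread_ge[of 0 0 g z] by simp

lemma continuous_on_spread:
  assumes "five_units \<kappa> S g"
  shows "continuous_on S (spread g)"
proof -
  have "continuous_on S (\<lambda>z. ln (norm (g i z)))" if "i \<le> 4" for i
    using assms that by (auto simp: five_units_def intro!: continuous_intros holomorphic_on_imp_continuous_on)
  then have *: "((\<lambda>z. ln (norm (g i z)) - ln (norm (g j z))) \<longlongrightarrow> ln (norm (g i x)) - ln (norm (g j x))) (at x within S)"
    if "i \<le> 4" "j \<le> 4" "x \<in> S" for i j x
    using that by (intro tendsto_diff) (auto simp: continuous_on_def)
  have "((\<lambda>z. Max ((\<lambda>p. ln (norm (g (fst p) z)) - ln (norm (g (snd p) z))) ` ({..4} \<times> {..4})))
      \<longlongrightarrow> Max ((\<lambda>p. ln (norm (g (fst p) x)) - ln (norm (g (snd p) x))) ` ({..4} \<times> {..4}))) (at x within S)"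
    if x: "x \<in> S" for x
    by (rule tendsto_Max_image) (use * x in auto)
  then show ?thesis
    unfolding continuous_on_def spread_def case_prod_beta by blast
qed

lemma abs_ln_diff_le:
  fixes x y c :: real
  assumes "c > 0" "c \<le> x" "c \<le> y"
  shows "\<bar>ln x - ln y\<bar> \<le> \<bar>x - y\<bar> / c"
proof -
  have *: "ln x - ln y \<le> \<bar>x - y\<bar> / c" if "c \<le> x" "c \<le> y" for x y
  proof -
    have "ln x - ln y = ln (x / y)" using that assms(1) by (simp add: ln_div)
    also have "\<dots> \<le> x / y - 1" using that assms(1) by (intro ln_le_minus_one) auto
    also have "\<dots> = (x - y) / y" using that assms(1) by (simp add: diff_divide_distrib)
    also have "\<dots> \<le> \<bar>x - y\<bar> / y" using that assms(1) by (intro divide_right_mono) auto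
    also have "\<dots> \<le> \<bar>x - y\<bar> / c" using that assms(1) by (intro divide_left_mono) auto
    finally show ?thesis .
  qed
  show ?thesis using *[of x y] *[of y x] assms by (simp add: abs_minus_commute abs_le_iff)
qed

section \<open>Normal families and limits of rescaled logarithms\<close>

lemma Montel_finite:
  fixes G :: "nat \<Rightarrow> nat \<Rightarrow> complex \<Rightarrow> complex"
  assumes S: "open S" and hol: "\<And>n i. i < m \<Longrightarrow> G n i holomorphic_on S"
    and bd: "\<And>n i z. i < m \<Longrightarrow> z \<in> S \<Longrightarrow> norm (G n i z) \<le> B"
  shows "\<exists>s E. strict_mono (s :: nat \<Rightarrow> nat) \<and> (\<forall>i<m. E i holomorphic_on S \<and>
      (\<forall>K. compact K \<longrightarrow> K \<subseteq> S \<longrightarrow> uniform_limit K (\<lambda>n. G (s n) i) (E i) sequentially))"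
  using hol bd
proof (induction m)
  case 0
  show ?case by (rule exI[of _ id]) (auto simp: strict_mono_def)
next
  case (Suc m)
  have "\<exists>s E. strict_mono (s :: nat \<Rightarrow> nat) \<and> (\<forall>i<m. E i holomorphic_on S \<and>
      (\<forall>K. compact K \<longrightarrow> K \<subseteq> S \<longrightarrow> uniform_limit K (\<lambda>n. G (s n) i) (E i) sequentially))"
    by (rule Suc.IH) (use Suc.prems less_SucI in blast)+
  then obtain s E where s: "strict_mono (s :: nat \<Rightarrow> nat)"
    and E: "\<And>i. i < m \<Longrightarrow> E i holomorphic_on S"
    "\<And>i K. i < m \<Longrightarrow> compact K \<Longrightarrow> K \<subseteq> S \<Longrightarrow> uniform_limit K (\<lambda>n. G (s n) i) (E i) sequentially"
    by blast
  define H where "H = {h. h holomorphic_on S \<and> (\<forall>z\<in>S. norm (h z) \<le> B)}"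
  obtain g r where g: "g holomorphic_on S" and r: "strict_mono (r :: nat \<Rightarrow> nat)"
    and ul: "\<And>K. compact K \<Longrightarrow> K \<subseteq> S \<Longrightarrow> uniform_limit K ((\<lambda>n. G (s n) m) \<circ> r) g sequentially"
  proof (rule Montel[OF S, of H "\<lambda>n. G (s n) m"])
    show "range (\<lambda>n. G (s n) m) \<subseteq> H" using Suc.prems by (auto simp: H_def)
    show "h holomorphic_on S" if "h \<in> H" for h using that by (simp add: H_def)
    show "\<exists>B. \<forall>h\<in>H. \<forall>z\<in>K. norm (h z) \<le> B" if "K \<subseteq> S" for K
      using that by (intro exI[of _ B]) (auto simp: H_def)
  qed blast
  show ?case
  proof (intro exI[of _ "s \<circ> r"] exI[of _ "E(m := g)"] conjI allI impI)
    show "strict_mono (s \<circ> r)" using s r by (rule strict_mono_o)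
    show "(E(m := g)) i holomorphic_on S" if "i < Suc m" for i
      using that g E(1) by (auto simp: less_Suc_eq)
    show "uniform_limit K (\<lambda>n. G ((s \<circ> r) n) i) ((E(m := g)) i) sequentially"
      if "i < Suc m" "compact K" "K \<subseteq> S" for i K
    proof (cases "i = m")
      case True
      then show ?thesis using ul[OF that(2,3)] by (simp add: o_def)
    next
      case False
      then have "uniform_limit K (\<lambda>n. G (s n) i) (E i) sequentially" using E(2) that by auto
      from filterlim_compose[OF this filterlim_subseq[OF r]] False show ?thesis by (simp add: o_def)
    qed
  qed
qed

text \<open>The tropical limit: \<open>E i\<close> is the limit of branches of the power of
  \<open>g n i / g n 0\<close> with exponent \<open>1 / N n\<close>, so its logarithmic modulus is
  the limit of the rescaled logarithms. Taking this power turns \<kappa> into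
  \<open>exp (ln \<kappa> / N n)\<close>, which tends to \<open>1\<close>; hence the limit satisfies
  \<open>five_units\<close> with the sharp constant.\<close>

lemma five_units_limit:
  fixes g :: "nat \<Rightarrow> nat \<Rightarrow> complex \<Rightarrow> complex" and N :: "nat \<Rightarrow> real"
  assumes R: "R > 0" and \<kappa>: "\<kappa> > 0" and g: "\<And>n. five_units \<kappa> (ball 0 R) (g n)"
    and Npos: "\<And>n. N n > 0" and N: "filterlim N at_top sequentially"
    and A: "\<And>n z. z \<in> ball 0 R \<Longrightarrow> spread (g n) z \<le> A * N n"
  obtains s E where "strict_mono (s :: nat \<Rightarrow> nat)" "five_units 1 (ball 0 R) E"
    "\<And>i K e. i \<le> 4 \<Longrightarrow> compact K \<Longrightarrow> K \<subseteq> ball 0 R \<Longrightarrow> e > 0 \<Longrightarrow>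
      \<forall>\<^sub>F n in sequentially. \<forall>z\<in>K.
        \<bar>(ln (norm (g (s n) i z)) - ln (norm (g (s n) 0 z))) / N (s n) - ln (norm (E i z))\<bar> < e"
    "\<And>z. z \<in> ball 0 R \<Longrightarrow> (\<lambda>n. spread (g (s n)) z / N (s n)) \<longlonglongrightarrow> spread E z"
proof -
  have hol: "g n i holomorphic_on ball 0 R" and nz: "\<And>z. z \<in> ball 0 R \<Longrightarrow> g n i z \<noteq> 0"
    if "i \<le> 4" for n i
    using g[of n] that by (auto simp: five_units_def)
  have ex: "\<exists>h. i \<le> 4 \<longrightarrow> h holomorphic_on ball 0 R \<and> (\<forall>z\<in>ball 0 R. exp (h z) = g n i z / g n 0 z)" for n i
  proof (cases "i \<le> 4")
    case True
    have "(\<lambda>z. g n i z / g n 0 z) holomorphic_on ball 0 R"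
      by (intro holomorphic_intros hol True nz) auto
    then obtain h where "h holomorphic_on ball 0 R" "\<And>x. x \<in> ball 0 R \<Longrightarrow> exp (h x) = g n i x / g n 0 x"
      by (rule holomorphic_logarithm_exists[of "ball 0 R" _ 0, OF convex_ball open_ball]) (use R nz True in auto)
    then show ?thesis by blast
  qed auto
  define h where "h n i = (SOME h. i \<le> 4 \<longrightarrow> h holomorphic_on ball 0 R \<and> (\<forall>z\<in>ball 0 R. exp (h z) = g n i z / g n 0 z))" for n i
  have h: "h n i holomorphic_on ball 0 R" "\<And>z. z \<in> ball 0 R \<Longrightarrow> exp (h n i z) = g n i z / g n 0 z"
    if "i \<le> 4" for n i
    using someI_ex[OF ex[of i n]] that unfolding h_def by blast+
  define G where "G = (\<lambda>n i z. exp (h n i z / of_real (N n)))"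
  have normG: "norm (G n i z) = exp ((ln (norm (g n i z)) - ln (norm (g n 0 z))) / N n)"
    if "i \<le> 4" "z \<in> ball 0 R" for n i z
  proof -
    have "Re (h n i z) = ln (norm (g n i z / g n 0 z))"
      using ln_norm_eq_Re[OF h(2)[OF that]] by simp
    also have "\<dots> = ln (norm (g n i z)) - ln (norm (g n 0 z))"
      using nz[of i z] nz[of 0 z] that by (simp add: norm_divide ln_div)
    finally show ?thesis unfolding G_def by simp
  qed
  \<comment> \<open>The upper bound feeds Montel's theorem. The lower one keeps the limits zero-free
    and makes the logarithms converge uniformly as well.\<close>
  have bounds: "exp (-A) \<le> norm (G n i z)" "norm (G n i z) \<le> exp A" if "i \<le> 4" "z \<in> ball 0 R" for n i z
  proof -
    define x where "x = ln (norm (g n i z)) - ln (norm (g n 0 z))"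
    have "x \<le> A * N n" "- x \<le> A * N n"
      using spread_ge[of i 0 "g n" z] spread_ge[of 0 i "g n" z] A[OF that(2), of n] that
      unfolding x_def by linarith+
    then have "x / N n \<le> A" "- A \<le> x / N n" using Npos[of n] by (auto simp: field_simps)
    then show "exp (-A) \<le> norm (G n i z)" "norm (G n i z) \<le> exp A"
      using normG[OF that] by (auto simp: x_def)
  qed
  have "\<exists>s E. strict_mono (s :: nat \<Rightarrow> nat) \<and> (\<forall>i<5. E i holomorphic_on ball 0 R \<and>
      (\<forall>K. compact K \<longrightarrow> K \<subseteq> ball 0 R \<longrightarrow> uniform_limit K (\<lambda>n. G (s n) i) (E i) sequentially))"
  proof (rule Montel_finite)
    show "G n i holomorphic_on ball 0 R" if "i < 5" for n i
      unfolding G_def using that Npos[of n] by (intro holomorphic_intros h) auto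
    show "norm (G n i z) \<le> exp A" if "i < 5" "z \<in> ball 0 R" for n i z
      using that by (intro bounds(2)) auto
  qed simp
  then obtain s E where s: "strict_mono (s :: nat \<Rightarrow> nat)"
    and "\<forall>i<5. E i holomorphic_on ball 0 R \<and>
      (\<forall>K. compact K \<longrightarrow> K \<subseteq> ball 0 R \<longrightarrow> uniform_limit K (\<lambda>n. G (s n) i) (E i) sequentially)"
    by blast
  then have E: "\<And>i. i \<le> 4 \<Longrightarrow> E i holomorphic_on ball 0 R"
    and ul: "\<And>i K. i \<le> 4 \<Longrightarrow> compact K \<Longrightarrow> K \<subseteq> ball 0 R \<Longrightarrow> uniform_limit K (\<lambda>n. G (s n) i) (E i) sequentially"
    by auto
  have lim: "(\<lambda>n. G (s n) i z) \<longlonglongrightarrow> E i z" if "i \<le> 4" "z \<in> ball 0 R" for i z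
    using tendsto_uniform_limitI[OF ul[OF that(1), of "{z}"], of z] that by auto
  have limn: "(\<lambda>n. norm (G (s n) i z)) \<longlonglongrightarrow> norm (E i z)" if "i \<le> 4" "z \<in> ball 0 R" for i z
    using lim[OF that] by (rule tendsto_norm)
  have Ege: "exp (-A) \<le> norm (E i z)" if "i \<le> 4" "z \<in> ball 0 R" for i z
    using limn[OF that] by (rule Lim_bounded2) (use bounds that in auto)
  have conv: "\<forall>\<^sub>F n in sequentially. \<forall>z\<in>K.
        \<bar>(ln (norm (g (s n) i z)) - ln (norm (g (s n) 0 z))) / N (s n) - ln (norm (E i z))\<bar> < e"
    if i: "i \<le> 4" and K: "compact K" "K \<subseteq> ball 0 R" and e: "e > 0" for i K e
  proof -
    have "\<forall>\<^sub>F n in sequentially. \<forall>z\<in>K. dist (G (s n) i z) (E i z) < e * exp (-A)"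
      using ul[OF i K] e by (intro uniform_limitD) auto
    then show ?thesis
    proof (eventually_elim, intro ballI)
      fix n z assume *: "\<forall>z\<in>K. dist (G (s n) i z) (E i z) < e * exp (-A)" and z: "z \<in> K"
      have zb: "z \<in> ball 0 R" using z K by auto
      have "\<bar>ln (norm (G (s n) i z)) - ln (norm (E i z))\<bar> \<le> \<bar>norm (G (s n) i z) - norm (E i z)\<bar> / exp (-A)"
        using bounds(1)[OF i zb] Ege[OF i zb] by (intro abs_ln_diff_le) auto
      also have "\<dots> \<le> dist (G (s n) i z) (E i z) / exp (-A)"
        unfolding dist_norm by (intro divide_right_mono norm_triangle_ineq3) auto
      also have "\<dots> < e" using * z by (simp add: divide_less_eq)
      finally show "\<bar>(ln (norm (g (s n) i z)) - ln (norm (g (s n) 0 z))) / N (s n) - ln (norm (E i z))\<bar> < e"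
        using normG[OF i zb] by simp
    qed
  qed
  have limln: "(\<lambda>n. (ln (norm (g (s n) i z)) - ln (norm (g (s n) 0 z))) / N (s n)) \<longlonglongrightarrow> ln (norm (E i z))"
    if "i \<le> 4" "z \<in> ball 0 R" for i z
  proof (rule tendstoI)
    fix e :: real assume "e > 0"
    from conv[OF that(1) _ _ this, of "{z}"] that(2)
    show "\<forall>\<^sub>F n in sequentially. dist ((ln (norm (g (s n) i z)) - ln (norm (g (s n) 0 z))) / N (s n)) (ln (norm (E i z))) < e"
      by (simp add: dist_real_def)
  qed
  have spread_lim: "(\<lambda>n. spread (g (s n)) z / N (s n)) \<longlonglongrightarrow> spread E z" if z: "z \<in> ball 0 R" for z
  proof -
    have "(\<lambda>n. Max ((\<lambda>p. (ln (norm (g (s n) (fst p) z)) - ln (norm (g (s n) (snd p) z))) / N (s n)) ` ({..4} \<times> {..4})))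
      \<longlonglongrightarrow> Max ((\<lambda>p. ln (norm (E (fst p) z)) - ln (norm (E (snd p) z))) ` ({..4} \<times> {..4}))"
    proof (rule tendsto_Max_image)
      fix p :: "nat \<times> nat" assume "p \<in> {..4} \<times> {..4}"
      then have p: "fst p \<le> 4" "snd p \<le> 4" by auto
      from tendsto_diff[OF limln[OF p(1) z] limln[OF p(2) z]]
      show "(\<lambda>n. (ln (norm (g (s n) (fst p) z)) - ln (norm (g (s n) (snd p) z))) / N (s n))
          \<longlonglongrightarrow> ln (norm (E (fst p) z)) - ln (norm (E (snd p) z))"
        by (simp add: diff_divide_distrib[symmetric])
    qed auto
    moreover have "Max ((\<lambda>p. (ln (norm (g (s n) (fst p) z)) - ln (norm (g (s n) (snd p) z))) / N (s n)) ` ({..4} \<times> {..4}))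
       = spread (g (s n)) z / N (s n)" for n
    proof -
      have "mono (\<lambda>x. x / N (s n))" using Npos[of "s n"] by (intro monoI divide_right_mono) auto
      from mono_Max_commute[OF this, of "(\<lambda>(i,j). ln (norm (g (s n) i z)) - ln (norm (g (s n) j z))) ` ({..4} \<times> {..4})"]
      show ?thesis unfolding spread_def by (simp add: image_image case_prod_beta)
    qed
    ultimately show ?thesis by (simp add: spread_def case_prod_beta)
  qed
  have "five_units 1 (ball 0 R) E"
    unfolding five_units_def
  proof (intro conjI allI impI ballI)
    show "E i holomorphic_on ball 0 R" if "i \<le> 4" for i using E that by blast
    show "E i z \<noteq> 0" if "i \<le> 4" "z \<in> ball 0 R" for i z
      using Ege[OF that] by (metis exp_gt_zero norm_zero not_le)
    fix z :: complex and T :: "nat set" assume z: "z \<in> ball 0 R" and T: "T \<subseteq> {..4}" "card T = 3"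
    have fin: "finite T" "T \<noteq> {}" using T by (auto intro: finite_subset)
    show "\<exists>i\<in>T. \<forall>l\<le>4. norm (E l z) \<le> 1 * norm (E i z)"
    proof -
      have le: "norm (E l z) \<le> Max ((\<lambda>i. norm (E i z)) ` T)" if l: "l \<le> 4" for l
      proof -
        have "(\<lambda>n. ln \<kappa> / N n) \<longlonglongrightarrow> 0"
          by (rule real_tendsto_divide_at_top[OF tendsto_const N])
        then have "(\<lambda>n. ln \<kappa> / N (s n)) \<longlonglongrightarrow> 0"
          using filterlim_compose[OF _ filterlim_subseq[OF s]] by blast
        then have k1: "(\<lambda>n. exp (ln \<kappa> / N (s n))) \<longlonglongrightarrow> exp 0" by (rule tendsto_exp)
        have m1: "(\<lambda>n. Max ((\<lambda>i. norm (G (s n) i z)) ` T)) \<longlonglongrightarrow> Max ((\<lambda>i. norm (E i z)) ` T)"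
          using T z by (intro tendsto_Max_image fin limn) auto
        have "norm (E l z) \<le> exp 0 * Max ((\<lambda>i. norm (E i z)) ` T)"
        proof (rule LIMSEQ_le[OF limn[OF l z] tendsto_mult[OF k1 m1]], intro exI allI impI)
          fix n
          obtain i where i: "i \<in> T" "\<And>l. l \<le> 4 \<Longrightarrow> norm (g (s n) l z) \<le> \<kappa> * norm (g (s n) i z)"
            using five_units_attain[OF g z T(1)] T(2) by (metis order_refl)
          have i4: "i \<le> 4" using i T by auto
          have "ln (norm (g (s n) l z)) \<le> ln (\<kappa> * norm (g (s n) i z))"
            using i(2)[OF l] nz[OF l z, of "s n"] nz[OF i4 z, of "s n"] \<kappa> by (subst ln_le_cancel_iff) auto
          also have "\<dots> = ln \<kappa> + ln (norm (g (s n) i z))"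
            using nz[OF i4 z, of "s n"] \<kappa> by (simp add: ln_mult)
          finally have "(ln (norm (g (s n) l z)) - ln (norm (g (s n) 0 z))) / N (s n)
              \<le> (ln \<kappa> + (ln (norm (g (s n) i z)) - ln (norm (g (s n) 0 z)))) / N (s n)"
            using Npos[of "s n"] by (intro divide_right_mono) auto
          then have "norm (G (s n) l z) \<le> exp (ln \<kappa> / N (s n)) * norm (G (s n) i z)"
            unfolding normG[OF l z] normG[OF i4 z] by (simp add: exp_add[symmetric] add_divide_distrib)
          also have "\<dots> \<le> exp (ln \<kappa> / N (s n)) * Max ((\<lambda>i. norm (G (s n) i z)) ` T)"
            using i fin by (intro mult_left_mono Max_ge) auto
          finally show "norm (G (s n) l z) \<le> exp (ln \<kappa> / N (s n)) * Max ((\<lambda>i. norm (G (s n) i z)) ` T)" .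
        qed
        then show ?thesis by simp
      qed
      have "Max ((\<lambda>i. norm (E i z)) ` T) \<in> (\<lambda>i. norm (E i z)) ` T"
        using fin by (intro Max_in) auto
      then obtain i where "i \<in> T" "Max ((\<lambda>i. norm (E i z)) ` T) = norm (E i z)" by blast
      then show ?thesis using le by (intro bexI[of _ i]) auto
    qed
  qed
  then show thesis by (intro that[of s E] s conv spread_lim)
qed

section \<open>Choosing the points for the rescaling\<close>

lemma exists_last_doubling:
  fixes b :: "nat \<Rightarrow> real"
  assumes pos: "\<And>n. b n > 0" and bd: "\<And>n. b n \<le> B"
    and j0: "2 * b j0 \<le> b (Suc j0)"
  obtains j where "j0 \<le> j" "2 * b j \<le> b (Suc j)" "\<And>i. b (Suc j + i) \<le> 2 ^ i * b (Suc j)"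
    "b (Suc j0) \<le> b (Suc j)"
proof -
  have mono_or: "\<exists>j\<ge>j0. 2 * b j \<le> b (Suc j) \<and> b (Suc j0) \<le> b (Suc j) \<and> (\<forall>i. b (Suc j + i) \<le> 2 ^ i * b (Suc j))"
  proof (rule ccontr)
    assume neg: "\<not> ?thesis"
    \<comment> \<open>After a doubling step, take the first index that violates the growth bound.
      The bound still holds just before it, so the step into it is again a doubling step, with a
      value at least twice as large. Repeating this exceeds \<open>B\<close>.\<close>
    have step: "\<exists>j'\<ge>j0. 2 * b j' \<le> b (Suc j') \<and> 2 * b (Suc j) \<le> b (Suc j')"
      if j: "j \<ge> j0" "2 * b j \<le> b (Suc j)" "b (Suc j0) \<le> b (Suc j)" for j
    proof -
      obtain i where i: "b (Suc j + i) > 2 ^ i * b (Suc j)"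
        using neg j by (meson not_le)
      define P where "P = (\<lambda>i. b (Suc j + i) > 2 ^ i * b (Suc j))"
      define i0 where "i0 = (LEAST i. P i)"
      have Pi0: "P i0" unfolding i0_def by (rule LeastI[of P i]) (use i in \<open>simp add: P_def\<close>)
      have nP: "\<not> P k" if "k < i0" for k using not_less_Least[of k P] that by (simp add: i0_def)
      have "i0 \<noteq> 0" using Pi0 by (cases i0) (auto simp: P_def)
      then obtain k where k: "i0 = Suc k" by (cases i0) auto
      have 1: "b (Suc j + k) \<le> 2 ^ k * b (Suc j)" using nP[of k] k by (simp add: P_def)
      have 2: "b (Suc (Suc j + k)) > 2 * 2 ^ k * b (Suc j)" using Pi0 k by (simp add: P_def)
      have 3: "2 * b (Suc j) \<le> 2 * 2 ^ k * b (Suc j)"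
      proof -
        have "1 * b (Suc j) \<le> 2 ^ k * b (Suc j)" using pos[of "Suc j"] by (intro mult_right_mono) auto
        then show ?thesis by simp
      qed
      show ?thesis
        by (rule exI[of _ "Suc j + k"]) (use 1 2 3 j in auto)
    qed
    have "\<exists>j\<ge>j0. 2 * b j \<le> b (Suc j) \<and> 2 ^ m * b (Suc j0) \<le> b (Suc j)" for m
    proof (induction m)
      case 0
      show ?case using j0 by auto
    next
      case (Suc m)
      then obtain j where j: "j \<ge> j0" "2 * b j \<le> b (Suc j)" "2 ^ m * b (Suc j0) \<le> b (Suc j)" by blast
      have "1 * b (Suc j0) \<le> 2 ^ m * b (Suc j0)" using pos[of "Suc j0"] by (intro mult_right_mono) auto
      with j have "b (Suc j0) \<le> b (Suc j)" by simp
      from step[OF j(1,2) this] obtain j' where "j' \<ge> j0" "2 * b j' \<le> b (Suc j')" "2 * b (Suc j) \<le> b (Suc j')"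
        by blast
      with j show ?case by (intro exI[of _ j']) auto
    qed
    then have le: "2 ^ m * b (Suc j0) \<le> B" for m using bd by (meson order_trans)
    obtain m where "B / b (Suc j0) < 2 ^ m" using real_arch_pow[of 2] by auto
    then have "B < 2 ^ m * b (Suc j0)" using pos[of "Suc j0"] by (simp add: divide_less_eq)
    with le[of m] show False by simp
  qed
  then obtain j where "j0 \<le> j" "2 * b j \<le> b (Suc j)" "b (Suc j0) \<le> b (Suc j)"
    "\<forall>i. b (Suc j + i) \<le> 2 ^ i * b (Suc j)"
    by blast
  then show thesis by (intro that) auto
qed

lemma exists_large_step:
  fixes b :: "nat \<Rightarrow> real"
  assumes "\<Lambda> ^ k * b 0 < b k" "0 < \<Lambda>"
  shows "\<exists>j<k. \<Lambda> * b j < b (Suc j)"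
proof (rule ccontr)
  assume "\<not> ?thesis"
  then have step: "b (Suc j) \<le> \<Lambda> * b j" if j: "j < k" for j using j by (meson not_le)
  have "b j \<le> \<Lambda> ^ j * b 0" if "j \<le> k" for j
    using that
  proof (induction j)
    case (Suc j)
    have "b (Suc j) \<le> \<Lambda> * b j" using step Suc by simp
    also have "\<dots> \<le> \<Lambda> * (\<Lambda> ^ j * b 0)" using Suc assms(2) by (intro mult_left_mono) auto
    finally show ?case by (simp add: mult.assoc)
  qed simp
  with assms(1) show False by (meson not_le order_refl)
qed

text \<open>The radii \<open>r j\<close> increase geometrically to \<open>1/2\<close>. After the last index at which the maximum of
  \<open>s\<close> over \<open>cball 0 (r j)\<close> doubles, it grows at most by the factor \<open>2\<close> per step, and six steps
  cover four times the preceding step: \<open>(9/10)^7 < 1/2\<close>.\<close>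

lemma point_picking:
  fixes s :: "complex \<Rightarrow> real"
  assumes cont: "continuous_on (ball 0 1) s" and s1: "\<And>z. z \<in> ball 0 1 \<Longrightarrow> 1 \<le> s z"
    and \<Lambda>: "2 \<le> \<Lambda>" and z: "z \<in> cball 0 (1/4)" and big: "\<Lambda> ^ 7 * s 0 < s z"
  obtains a d where "\<Lambda> \<le> s a"
    "\<And>\<zeta>. \<zeta> \<in> ball 0 4 \<Longrightarrow> a + d * \<zeta> \<in> ball 0 1 \<and> s (a + d * \<zeta>) \<le> 64 * s a"
    "s (a + d) \<le> s a / 2"
proof -
  define r :: "nat \<Rightarrow> real" where "r j = (1 - (9/10) ^ j) / 2" for j
  have r: "0 \<le> r j" "r j < 1/2" for j by (auto simp: r_def power_le_one)
  have rmono: "r i \<le> r j" if "i \<le> j" for i j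
    using that by (auto simp: r_def intro!: power_decreasing)
  have sub: "cball 0 (r j) \<subseteq> ball (0::complex) 1" for j using r[of j] by auto
  have "\<exists>m. m \<in> cball 0 (r j) \<and> (\<forall>w\<in>cball 0 (r j). s w \<le> s m)" for j
    using continuous_attains_sup[OF compact_cball _ continuous_on_subset[OF cont sub]] r[of j]
    by (metis cball_eq_empty not_le)
  then obtain m where m: "\<And>j. m j \<in> cball 0 (r j)" "\<And>j w. w \<in> cball 0 (r j) \<Longrightarrow> s w \<le> s (m j)"
    by metis
  have m1: "m j \<in> ball 0 1" for j using m(1) sub by blast
  have pos: "0 < s (m j)" for j using s1[OF m1[of j]] by simp
  have bd: "\<exists>B. \<forall>j. s (m j) \<le> B"
  proof -
    have "cball 0 (1/2) \<subseteq> ball (0::complex) 1" by auto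
    from continuous_attains_sup[OF compact_cball _ continuous_on_subset[OF cont this]]
    obtain w where "\<forall>y\<in>cball 0 (1/2). s y \<le> s w" by auto
    moreover have "m j \<in> cball 0 (1/2)" for j using m(1)[of j] r[of j] by auto
    ultimately show ?thesis by blast
  qed
  then obtain B where B: "\<And>j. s (m j) \<le> B" by blast
  have m0: "s (m 0) = s 0" using m(1)[of 0] by (simp add: r_def)
  \<comment> \<open>Seven radii lead from \<open>0\<close> past \<open>1/4\<close>. A gain of more
    than \<open>\<Lambda> ^ 7\<close> along them forces a gain of more than \<Lambda> in a single
    step, and this is what makes \<open>s a\<close> at least \<Lambda>.\<close>
  have "z \<in> cball 0 (r 7)" using z by (auto simp: r_def power_divide)
  then have "\<Lambda> ^ 7 * s (m 0) < s (m 7)" using m(2) big m0 by fastforce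
  then obtain j0 where j0: "\<Lambda> * s (m j0) < s (m (Suc j0))"
    using exists_large_step[of \<Lambda> 7 "\<lambda>j. s (m j)"] \<Lambda> by auto
  have "2 * s (m j0) \<le> \<Lambda> * s (m j0)" using \<Lambda> pos[of j0] by (intro mult_right_mono) auto
  with j0 have "2 * s (m j0) \<le> s (m (Suc j0))" by simp
  from exists_last_doubling[of "\<lambda>j. s (m j)", OF pos B this] obtain j where
    j: "2 * s (m j) \<le> s (m (Suc j))" "\<And>i. s (m (Suc j + i)) \<le> 2 ^ i * s (m (Suc j))"
       "s (m (Suc j0)) \<le> s (m (Suc j))" by metis
  define a where "a = m (Suc j)"
  have sa: "\<Lambda> \<le> s a"
  proof -
    have "\<Lambda> * 1 \<le> \<Lambda> * s (m j0)" using s1[OF m1] \<Lambda> by (intro mult_left_mono) auto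
    then show ?thesis using j0 j(3) by (simp add: a_def)
  qed
  have a_le: "norm a \<le> r (Suc j)" using m(1)[of "Suc j"] by (simp add: a_def)
  have a_gt: "r j < norm a"
  proof (rule ccontr)
    assume "\<not> ?thesis"
    then have "s a \<le> s (m j)" by (intro m(2)) auto
    then show False using j(1) pos[of j] by (simp add: a_def)
  qed
  then have a0: "norm a > 0" using r(1)[of j] by linarith
  \<comment> \<open>\<open>a + d\<close> is the radial projection of \<open>a\<close> to the sphere
    of radius \<open>r j\<close>. There \<open>s\<close> is at most \<open>s (m j)\<close>, hence at
    most half of \<open>s a\<close>.\<close>
  define d where "d = of_real (r j / norm a - 1) * a"
  have ad: "a + d = of_real (r j / norm a) * a" by (simp add: d_def algebra_simps)
  have "norm (a + d) = r j" using a0 r(1)[of j] unfolding ad norm_mult norm_of_real by simp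
  then have "s (a + d) \<le> s (m j)" by (intro m(2)) auto
  then have half: "s (a + d) \<le> s a / 2" using j(1) by (simp add: a_def)
  have "norm d = \<bar>r j / norm a - 1\<bar> * norm a" unfolding d_def norm_mult norm_of_real by simp
  also have "\<dots> = norm a - r j" using a0 a_gt by (simp add: abs_if field_simps)
  finally have nd: "norm d \<le> r (Suc j) - r j" using a_le by simp
  have "a + d * \<zeta> \<in> cball 0 (r (Suc j + 6))" if "\<zeta> \<in> ball 0 4" for \<zeta>
  proof -
    have "norm (a + d * \<zeta>) \<le> norm a + norm d * norm \<zeta>" by (metis norm_mult norm_triangle_ineq)
    also have "\<dots> \<le> r (Suc j) + (r (Suc j) - r j) * 4"
      using that a_le nd rmono[of j "Suc j"] by (intro add_mono mult_mono) auto
    \<comment> \<open>Up to the common factor \<open>(9/10) ^ j / 2\<close> this is the inequality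
      \<open>4/10 \<le> 9/10 - (9/10) ^ 7\<close>. The six steps are the origin of
      \<open>64 = 2 ^ 6\<close>.\<close>
    also have "\<dots> \<le> r (Suc j + 6)" by (simp add: r_def power_add power_divide field_simps)
    finally show ?thesis by simp
  qed
  then have "a + d * \<zeta> \<in> ball 0 1 \<and> s (a + d * \<zeta>) \<le> 64 * s a" if "\<zeta> \<in> ball 0 4" for \<zeta>
    using that m(2)[of "a + d * \<zeta>" "Suc j + 6"] j(2)[of 6] sub by (fastforce simp: a_def)
  then show thesis by (intro that[of a d] sa half)
qed

section \<open>Growth of discs avoiding five lines\<close>

lemma five_units_subset:
  assumes "five_units \<kappa> S g" "T \<subseteq> S"
  shows "five_units \<kappa> T g"
  using assms unfolding five_units_def by (meson holomorphic_on_subset subset_iff)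

lemma five_units_compose_affine:
  assumes g: "five_units \<kappa> S g" and sub: "\<And>\<zeta>. \<zeta> \<in> T \<Longrightarrow> a + d * \<zeta> \<in> S"
  shows "five_units \<kappa> T (\<lambda>i \<zeta>. g i (a + d * \<zeta>))"
proof -
  have "(\<lambda>\<zeta>. g i (a + d * \<zeta>)) holomorphic_on T" if "i \<le> 4" for i
  proof -
    have "(g i \<circ> (\<lambda>\<zeta>. a + d * \<zeta>)) holomorphic_on T"
      using g that sub
      by (intro holomorphic_on_compose_gen[where t = S]) (auto simp: five_units_def intro!: holomorphic_intros)
    then show ?thesis by (simp add: o_def)
  qed
  with g sub show ?thesis unfolding five_units_def by blast
qed

text \<open>The quotient \<open>E j / E i\<close> is zero-free and bounded by \<open>1\<close>, so
  the difference of logarithms is a nonnegative harmonic function.\<close>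

lemma dominated_ratio_Harnack:
  assumes E: "five_units \<kappa> (ball 0 R) E" and ij: "i \<le> 4" "j \<le> 4"
    and dom: "\<And>z. z \<in> ball 0 R \<Longrightarrow> norm (E j z) \<le> norm (E i z)" and z: "norm z < R"
  shows "(R - norm z) * (ln (norm (E i z)) - ln (norm (E j z))) \<le> (R + norm z) * (ln (norm (E i 0)) - ln (norm (E j 0)))"
    and "(R - norm z) * (ln (norm (E i 0)) - ln (norm (E j 0))) \<le> (R + norm z) * (ln (norm (E i z)) - ln (norm (E j z)))"
proof -
  have R: "R > 0" using z norm_ge_zero[of z] by linarith
  have hol: "E i holomorphic_on ball 0 R" "E j holomorphic_on ball 0 R"
    and nz: "\<And>z. z \<in> ball 0 R \<Longrightarrow> E i z \<noteq> 0" "\<And>z. z \<in> ball 0 R \<Longrightarrow> E j z \<noteq> 0"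
    using E ij unfolding five_units_def by blast+
  define Q where "Q = (\<lambda>z. E j z / E i z)"
  have Q: "Q holomorphic_on ball 0 R" unfolding Q_def by (intro holomorphic_intros hol nz)
  have Q0: "Q z \<noteq> 0" if "z \<in> ball 0 R" for z using nz that by (simp add: Q_def)
  have Q1: "norm (Q z) \<le> 1" if "z \<in> ball 0 R" for z
    using nz(1)[OF that] dom[OF that] by (simp add: Q_def norm_divide)
  have lnQ: "- ln (norm (Q z)) = ln (norm (E i z)) - ln (norm (E j z))" if "z \<in> ball 0 R" for z
    using nz(1)[OF that] nz(2)[OF that] by (simp add: Q_def norm_divide ln_div)
  show "(R - norm z) * (ln (norm (E i z)) - ln (norm (E j z))) \<le> (R + norm z) * (ln (norm (E i 0)) - ln (norm (E j 0)))"
    using Harnack_ln(1)[OF Q Q0 Q1 z] lnQ[of z] lnQ[of 0] z R by simp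
  show "(R - norm z) * (ln (norm (E i 0)) - ln (norm (E j 0))) \<le> (R + norm z) * (ln (norm (E i z)) - ln (norm (E j z)))"
    using Harnack_ln(2)[OF Q Q0 Q1 z] lnQ[of z] lnQ[of 0] z R by simp
qed

text \<open>With one dominating index \<open>m\<close>, the spread at \<open>0\<close> is attained
  by a difference to \<open>m\<close>, and Harnack's inequality on the disc of radius
  \<open>4\<close> preserves the fraction \<open>(4 - 1) / (4 + 1) = 3/5\<close> of it at distance
  \<open>1\<close>. The radius \<open>4\<close> in \<open>point_picking\<close> is chosen to exceed
  \<open>1/2\<close> here; radius \<open>3\<close> would give exactly \<open>1/2\<close>.\<close>

lemma five_units_no_halving:
  assumes E: "five_units 1 (ball 0 4) E" and E0: "spread E 0 = 1"
  shows "spread E 1 > 1/2"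
proof -
  obtain m where m: "m \<le> 4" "\<And>j z. j \<le> 4 \<Longrightarrow> z \<in> ball 0 4 \<Longrightarrow> norm (E j z) \<le> norm (E m z)"
    using five_units_rigid[OF E] by auto
  obtain i j where ij: "i \<le> 4" "j \<le> 4" "spread E 0 = ln (norm (E i 0)) - ln (norm (E j 0))"
    by (rule spread_attained)
  have "E i 0 \<noteq> 0" using E ij(1) by (auto simp: five_units_def)
  then have "ln (norm (E i 0)) \<le> ln (norm (E m 0))"
    using m(2)[OF ij(1), of 0] by (intro ln_mono) auto
  then have *: "1 \<le> ln (norm (E m 0)) - ln (norm (E j 0))" using ij E0 by simp
  have "(4 - norm (1::complex)) * (ln (norm (E m 0)) - ln (norm (E j 0)))
      \<le> (4 + norm (1::complex)) * (ln (norm (E m 1)) - ln (norm (E j 1)))"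
    by (rule dominated_ratio_Harnack(2)[OF E m(1) ij(2)]) (use m ij in auto)
  then have "3 / 5 \<le> ln (norm (E m 1)) - ln (norm (E j 1))" using * by simp
  also have "\<dots> \<le> spread E 1" by (rule spread_ge[OF m(1) ij(2)])
  finally show ?thesis by simp
qed

text \<open>A sequence violating the bound, rescaled at the points from \<open>point_picking\<close>, has a tropical
  limit with spread \<open>1\<close> at \<open>0\<close> and at most \<open>1/2\<close> at \<open>1\<close>, against Harnack's inequality.\<close>

lemma spread_growth:
  assumes \<kappa>: "\<kappa> > 0"
  shows "\<exists>C>0. \<forall>g z. five_units \<kappa> (ball 0 1) g \<longrightarrow> z \<in> cball 0 (1/4) \<longrightarrow>
    1 + spread g z \<le> C * (1 + spread g 0)"
proof (rule ccontr)
  assume neg: "\<not> ?thesis"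
  have "\<exists>g a d. five_units \<kappa> (ball 0 1) g \<and> real n + 2 \<le> 1 + spread g a \<and>
      (\<forall>\<zeta>\<in>ball 0 4. a + d * \<zeta> \<in> ball 0 1 \<and> 1 + spread g (a + d * \<zeta>) \<le> 64 * (1 + spread g a)) \<and>
      1 + spread g (a + d) \<le> (1 + spread g a) / 2" for n :: nat
  proof -
    \<comment> \<open>The negated claim is used with the constant \<open>(n + 2) ^ 7\<close>, the
      threshold of \<open>point_picking\<close> for \<Lambda> equal to \<open>n + 2\<close>. Adding
      \<open>1\<close> to the spread provides the lower bound \<open>1\<close> required
      there.\<close>
    have "(real n + 2) ^ 7 > 0" by simp
    with neg obtain g z where g: "five_units \<kappa> (ball 0 1) g" and z: "z \<in> cball 0 (1/4)"
      and big: "(real n + 2) ^ 7 * (1 + spread g 0) < 1 + spread g z"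
      by (meson not_le)
    have cont: "continuous_on (ball 0 1) (\<lambda>z. 1 + spread g z)"
      by (intro continuous_intros continuous_on_spread[OF g])
    have s1: "1 \<le> 1 + spread g z" for z by (simp add: spread_nonneg)
    obtain a d where "real n + 2 \<le> 1 + spread g a"
      "\<And>\<zeta>. \<zeta> \<in> ball 0 4 \<Longrightarrow> a + d * \<zeta> \<in> ball 0 1 \<and> 1 + spread g (a + d * \<zeta>) \<le> 64 * (1 + spread g a)"
      "1 + spread g (a + d) \<le> (1 + spread g a) / 2"
      by (rule point_picking[OF cont s1 _ z big]) auto
    with g show ?thesis by blast
  qed
  then obtain g a d where g: "\<And>n. five_units \<kappa> (ball 0 1) (g n)"
    and big: "\<And>n. real n + 2 \<le> 1 + spread (g n) (a n)"
    and ad: "\<And>n \<zeta>. \<zeta> \<in> ball 0 4 \<Longrightarrow> a n + d n * \<zeta> \<in> ball 0 1"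
      "\<And>n \<zeta>. \<zeta> \<in> ball 0 4 \<Longrightarrow> 1 + spread (g n) (a n + d n * \<zeta>) \<le> 64 * (1 + spread (g n) (a n))"
    and half: "\<And>n. 1 + spread (g n) (a n + d n) \<le> (1 + spread (g n) (a n)) / 2"
    by metis
  define G where "G n = (\<lambda>i \<zeta>. g n i (a n + d n * \<zeta>))" for n
  define N where "N n = 1 + spread (g n) (a n)" for n
  have spG: "spread (G n) \<zeta> = spread (g n) (a n + d n * \<zeta>)" for n \<zeta>
    by (simp add: spread_def G_def)
  have Npos: "N n > 0" for n using spread_nonneg[of "g n" "a n"] by (simp add: N_def)
  have N: "filterlim N at_top sequentially"
    by (rule filterlim_at_top_mono[OF filterlim_real_sequentially])
       (use big in \<open>auto simp: N_def intro!: always_eventually order_trans[OF _ big]\<close>)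
  obtain s E where s: "strict_mono (s :: nat \<Rightarrow> nat)" and E: "five_units 1 (ball 0 4) E"
    and lim: "\<And>z. z \<in> ball 0 4 \<Longrightarrow> (\<lambda>n. spread (G (s n)) z / N (s n)) \<longlonglongrightarrow> spread E z"
  proof (rule five_units_limit[OF _ \<kappa> _ Npos N, of 4 G 64])
    show "five_units \<kappa> (ball 0 4) (G n)" for n
      unfolding G_def by (rule five_units_compose_affine[OF g ad(1)])
    show "spread (G n) z \<le> 64 * N n" if "z \<in> ball 0 4" for n z
      using ad(2)[OF that, of n] by (simp add: spG N_def)
  qed auto
  \<comment> \<open>The rescaled spread at the centre is \<open>1 - 1 / N n\<close>, so the added
    \<open>1\<close> disappears in the limit.\<close>
  have "(\<lambda>n. 1 / N n) \<longlonglongrightarrow> 0" by (rule real_tendsto_divide_at_top[OF tendsto_const N])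
  then have "(\<lambda>n. 1 / N (s n)) \<longlonglongrightarrow> 0"
    using filterlim_compose[OF _ filterlim_subseq[OF s]] by blast
  then have "(\<lambda>n. 1 - 1 / N (s n)) \<longlonglongrightarrow> 1 - 0" by (intro tendsto_intros)
  moreover have "spread (G n) 0 / N n = 1 - 1 / N n" for n
    using Npos[of n] by (simp add: spG N_def field_simps)
  ultimately have "spread E 0 = 1"
    using LIMSEQ_unique[OF lim[of 0]] by auto
  moreover have "spread E 1 \<le> 1/2"
  proof (rule Lim_bounded[OF lim[of 1]])
    show "\<forall>n\<ge>0. spread (G (s n)) 1 / N (s n) \<le> 1/2"
    proof (intro allI impI)
      fix n
      show "spread (G (s n)) 1 / N (s n) \<le> 1/2"
        using half[of "s n"] Npos[of "s n"] by (simp add: spG N_def divide_simps)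
    qed
  qed auto
  ultimately show False using five_units_no_halving[OF E] by simp
qed

text \<open>A sequence of counterexamples has a tropical limit with spread \<open>1\<close> at
  \<open>0\<close>. There \<open>i\<close> dominates everything, and the index \<open>j\<close> that
  is smallest at \<open>0\<close> stays below it by a definite amount on a smaller disc; undoing the
  rescaling multiplies this amount by \<open>N n\<close>, which beats every \<eta>. Fixing
  \<open>i\<close> in advance gives the whole sequence the same largest index at
  \<open>0\<close>.\<close>

lemma spread_large:
  assumes \<kappa>: "\<kappa> > 0" and \<eta>: "\<eta> > 0" and i: "i \<le> 4"
  shows "\<exists>N0. \<forall>g. five_units \<kappa> (ball 0 1) g \<longrightarrow> (\<forall>l\<le>4. norm (g l 0) \<le> norm (g i 0)) \<longrightarrow>
    N0 \<le> spread g 0 \<longrightarrow> (\<exists>j\<le>4. \<forall>z\<in>cball 0 (1/8). norm (g j z) \<le> \<eta> * norm (g i z))"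
proof (rule ccontr)
  assume neg: "\<not> ?thesis"
  then have "\<forall>n. \<exists>g. five_units \<kappa> (ball 0 1) g \<and> (\<forall>l\<le>4. norm (g l 0) \<le> norm (g i 0)) \<and>
    real n \<le> spread g 0 \<and> \<not> (\<exists>j\<le>4. \<forall>z\<in>cball 0 (1/8). norm (g j z) \<le> \<eta> * norm (g i z))"
    by blast
  then obtain g where "\<forall>n. five_units \<kappa> (ball 0 1) (g n) \<and> (\<forall>l\<le>4. norm (g n l 0) \<le> norm (g n i 0)) \<and>
    real n \<le> spread (g n) 0 \<and> \<not> (\<exists>j\<le>4. \<forall>z\<in>cball 0 (1/8). norm (g n j z) \<le> \<eta> * norm (g n i z))"
    by (rule choice[THEN exE])
  then have g: "\<And>n. five_units \<kappa> (ball 0 1) (g n)"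
    and gi: "\<And>n l. l \<le> 4 \<Longrightarrow> norm (g n l 0) \<le> norm (g n i 0)"
    and big: "\<And>n. real n \<le> spread (g n) 0"
    and contra: "\<And>n j. j \<le> 4 \<Longrightarrow> \<not> (\<forall>z\<in>cball 0 (1/8). norm (g n j z) \<le> \<eta> * norm (g n i z))"
    by auto
  obtain C where C: "\<And>g z. five_units \<kappa> (ball 0 1) g \<Longrightarrow> z \<in> cball 0 (1/4) \<Longrightarrow>
    1 + spread g z \<le> C * (1 + spread g 0)"
    using spread_growth[OF \<kappa>] by blast
  define N where "N n = 1 + spread (g n) 0" for n
  have Npos: "N n > 0" for n using spread_nonneg[of "g n" 0] by (simp add: N_def)
  have N: "filterlim N at_top sequentially"
    by (rule filterlim_at_top_mono[OF filterlim_real_sequentially])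
       (use big in \<open>auto simp: N_def intro!: always_eventually order_trans[OF big]\<close>)
  have nz: "g n l z \<noteq> 0" if "l \<le> 4" "z \<in> ball 0 1" for n l z
    using g[of n] that by (auto simp: five_units_def)
  obtain s E where s: "strict_mono (s :: nat \<Rightarrow> nat)" and E: "five_units 1 (ball 0 (1/4)) E"
    and conv: "\<And>i K e. i \<le> 4 \<Longrightarrow> compact K \<Longrightarrow> K \<subseteq> ball 0 (1/4) \<Longrightarrow> e > 0 \<Longrightarrow>
      \<forall>\<^sub>F n in sequentially. \<forall>z\<in>K.
        \<bar>(ln (norm (g (s n) i z)) - ln (norm (g (s n) 0 z))) / N (s n) - ln (norm (E i z))\<bar> < e"
    and lim: "\<And>z. z \<in> ball 0 (1/4) \<Longrightarrow> (\<lambda>n. spread (g (s n)) z / N (s n)) \<longlonglongrightarrow> spread E z"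
  proof (rule five_units_limit[OF _ \<kappa> _ Npos N, of "1/4" g C])
    show "five_units \<kappa> (ball 0 (1/4)) (g n)" for n
      by (rule five_units_subset[OF g]) auto
    show "spread (g n) z \<le> C * N n" if "z \<in> ball 0 (1/4)" for n z
      using C[OF g, of z n] that by (simp add: N_def)
  qed auto
  have Enz: "E l z \<noteq> 0" if "l \<le> 4" "z \<in> ball 0 (1/4)" for l z
    using E that by (auto simp: five_units_def)
  have limN: "(\<lambda>n. c / N (s n)) \<longlonglongrightarrow> 0" for c
    using filterlim_compose[OF real_tendsto_divide_at_top[OF tendsto_const N] filterlim_subseq[OF s]] .
  have "(\<lambda>n. 1 - 1 / N (s n)) \<longlonglongrightarrow> 1 - 0" by (intro tendsto_intros limN)
  moreover have "spread (g n) 0 / N n = 1 - 1 / N n" for n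
    using Npos[of n] by (simp add: N_def field_simps)
  ultimately have E0: "spread E 0 = 1"
    using LIMSEQ_unique[OF lim[of 0]] by auto
  have lim0: "(\<lambda>n. (ln (norm (g (s n) l 0)) - ln (norm (g (s n) 0 0))) / N (s n)) \<longlonglongrightarrow> ln (norm (E l 0))"
    if "l \<le> 4" for l
  proof (rule tendstoI)
    fix e :: real assume "e > 0"
    from conv[OF that _ _ this, of "{0}"]
    show "\<forall>\<^sub>F n in sequentially. dist ((ln (norm (g (s n) l 0)) - ln (norm (g (s n) 0 0))) / N (s n)) (ln (norm (E l 0))) < e"
      by (simp add: dist_real_def)
  qed
  have Ei0: "ln (norm (E l 0)) \<le> ln (norm (E i 0))" if l: "l \<le> 4" for l
  proof (rule LIMSEQ_le[OF lim0[OF l] lim0[OF i]], intro exI allI impI)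
    fix n
    have "ln (norm (g (s n) l 0)) \<le> ln (norm (g (s n) i 0))"
      using gi[OF l] nz[OF l, of 0] by (intro ln_mono) auto
    then show "(ln (norm (g (s n) l 0)) - ln (norm (g (s n) 0 0))) / N (s n)
        \<le> (ln (norm (g (s n) i 0)) - ln (norm (g (s n) 0 0))) / N (s n)"
      using Npos[of "s n"] by (intro divide_right_mono) auto
  qed
  obtain m where m: "m \<le> 4" "\<And>j z. j \<le> 4 \<Longrightarrow> z \<in> ball 0 (1/4) \<Longrightarrow> norm (E j z) \<le> norm (E m z)"
    using five_units_rigid[OF E] by auto
  \<comment> \<open>The index \<open>i\<close> is maximal at \<open>0\<close>. The harmonic function
    comparing the dominating \<open>m\<close> with \<open>i\<close> is nonnegative and at most
    \<open>0\<close> at the centre, so by Harnack's inequality it is nowhere positive.\<close>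
  have Eim: "norm (E m z) \<le> norm (E i z)" if z: "z \<in> ball 0 (1/4)" for z
  proof -
    have "(1/4 - norm z) * (ln (norm (E m z)) - ln (norm (E i z)))
       \<le> (1/4 + norm z) * (ln (norm (E m 0)) - ln (norm (E i 0)))"
      by (rule dominated_ratio_Harnack(1)[OF E m(1) i]) (use m i z in auto)
    also have "\<dots> \<le> (1/4 + norm z) * 0" using Ei0[OF m(1)] by (intro mult_left_mono) auto
    finally have "ln (norm (E m z)) \<le> ln (norm (E i z))"
      using z by (simp add: mult_le_0_iff)
    then show ?thesis using Enz[OF m(1) z] Enz[OF i z] by (simp add: ln_le_cancel_iff)
  qed
  have dom: "norm (E l z) \<le> norm (E i z)" if "l \<le> 4" "z \<in> ball 0 (1/4)" for l z
    using m(2)[OF that] Eim[OF that(2)] by linarith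
  obtain i' j where ij: "i' \<le> 4" "j \<le> 4" "spread E 0 = ln (norm (E i' 0)) - ln (norm (E j 0))"
    by (rule spread_attained)
  then have ge1: "1 \<le> ln (norm (E i 0)) - ln (norm (E j 0))" using E0 Ei0[of i'] by simp
  \<comment> \<open>Harnack's inequality with radius \<open>1/4\<close> at distance at most
    \<open>1/8\<close> gives the fraction \<open>(1/8) / (3/8)\<close>.\<close>
  have third: "1/3 \<le> ln (norm (E i z)) - ln (norm (E j z))" if z: "z \<in> cball 0 (1/8)" for z
  proof -
    define x where "x = ln (norm (E i z)) - ln (norm (E j z))"
    have "(1/4 - norm z) * 1 \<le> (1/4 - norm z) * (ln (norm (E i 0)) - ln (norm (E j 0)))"
      using ge1 z by (intro mult_left_mono) auto
    also have "\<dots> \<le> (1/4 + norm z) * x"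
      unfolding x_def by (rule dominated_ratio_Harnack(2)[OF E i ij(2)]) (use dom ij z in auto)
    finally have *: "1/8 \<le> (1/4 + norm z) * x" using z by auto
    have "x > 0"
    proof (rule ccontr)
      assume "\<not> x > 0"
      then have "(1/4 + norm z) * x \<le> 0" by (intro mult_nonneg_nonpos) auto
      with * show False by linarith
    qed
    then have "(1/4 + norm z) * x \<le> (3/8) * x" using z by (intro mult_right_mono) auto
    with * show ?thesis by (simp add: x_def)
  qed
  have sub: "cball 0 (1/8) \<subseteq> ball (0::complex) (1/4)" by auto
  \<comment> \<open>Two approximation errors of \<open>1/12\<close> reduce the gap
    \<open>1/3\<close> to \<open>1/6\<close>, and the rescaled \<open>- ln \<eta>\<close> eventually
    drops below that.\<close>
  have "\<forall>\<^sub>F n in sequentially. - ln \<eta> / N (s n) < 1/6"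
    by (rule order_tendstoD(2)[OF limN]) simp
  moreover have "\<forall>\<^sub>F n in sequentially. \<forall>z\<in>cball 0 (1/8).
        \<bar>(ln (norm (g (s n) i z)) - ln (norm (g (s n) 0 z))) / N (s n) - ln (norm (E i z))\<bar> < 1/12"
    by (rule conv[OF i compact_cball sub]) simp
  moreover have "\<forall>\<^sub>F n in sequentially. \<forall>z\<in>cball 0 (1/8).
        \<bar>(ln (norm (g (s n) j z)) - ln (norm (g (s n) 0 z))) / N (s n) - ln (norm (E j z))\<bar> < 1/12"
    by (rule conv[OF ij(2) compact_cball sub]) simp
  ultimately have "\<forall>\<^sub>F n in sequentially. False"
  proof eventually_elim
    case (elim n)
    have "norm (g (s n) j z) \<le> \<eta> * norm (g (s n) i z)" if z: "z \<in> cball 0 (1/8)" for z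
    proof -
      have z1: "z \<in> ball 0 1" using z by auto
      define a b c where "a = ln (norm (g (s n) j z))" and "b = ln (norm (g (s n) i z))"
        and "c = ln (norm (g (s n) 0 z))"
      have "\<bar>(b - c) / N (s n) - ln (norm (E i z))\<bar> < 1/12" "\<bar>(a - c) / N (s n) - ln (norm (E j z))\<bar> < 1/12"
        using elim(2,3) z unfolding a_def b_def c_def by blast+
      moreover have "(b - a) / N (s n) = (b - c) / N (s n) - (a - c) / N (s n)"
        by (simp add: diff_divide_distrib)
      ultimately have "1/6 < (b - a) / N (s n)" using third[OF z] by linarith
      then have "- ln \<eta> / N (s n) < (b - a) / N (s n)" using elim(1) by linarith
      then have "- ln \<eta> < b - a" using Npos[of "s n"] unfolding divide_less_cancel by blast
      then have "a < ln \<eta> + b" by simp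
      also have "\<dots> = ln (\<eta> * norm (g (s n) i z))"
        using nz[OF i z1, of "s n"] \<eta> by (simp add: b_def ln_mult)
      finally show ?thesis
        using nz[OF i z1, of "s n"] nz[OF ij(2) z1, of "s n"] \<eta> by (simp add: a_def ln_less_cancel_iff)
    qed
    with contra[OF ij(2)] show False by blast
  qed
  then show False by simp
qed

section \<open>Linear forms in general position\<close>

definition lin :: "complex^3 \<Rightarrow> complex^3 \<Rightarrow> complex" where
  "lin a v = (\<Sum>i\<in>UNIV. a $ i * v $ i)"

lemma lin_add: "lin a (v + w) = lin a v + lin a w"
  by (simp add: lin_def algebra_simps sum.distrib)

lemma lin_scale: "lin a (c *s v) = c * lin a v"
  by (simp add: lin_def sum_distrib_left mult.left_commute)

lemma continuous_on_lin [continuous_intros]: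
  "continuous_on S f \<Longrightarrow> continuous_on S (\<lambda>x. lin a (f x))"
  unfolding lin_def by (intro continuous_intros)

lemma norm_cscale: "norm (c *s v) = norm c * norm v" for v :: "complex^3"
proof -
  have "(\<Sum>i\<in>UNIV. (norm (c * v $ i))\<^sup>2) = (norm c)\<^sup>2 * (\<Sum>i\<in>UNIV. (norm (v $ i))\<^sup>2)"
    by (simp add: norm_mult power_mult_distrib sum_distrib_left)
  then show ?thesis
    by (simp add: norm_vec_def L2_set_def real_sqrt_mult)
qed

definition general_forms :: "(nat \<Rightarrow> complex^3) \<Rightarrow> bool" where
  "general_forms a \<longleftrightarrow>
    (\<forall>T\<subseteq>{..4}. card T = 3 \<longrightarrow> (\<forall>v. (\<forall>i\<in>T. lin (a i) v = 0) \<longrightarrow> v = 0))"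

lemma finite_common_bound:
  fixes P :: "'i \<Rightarrow> real \<Rightarrow> bool"
  assumes "finite I" "\<And>i. i \<in> I \<Longrightarrow> \<exists>C. P i C" "\<And>i C D. i \<in> I \<Longrightarrow> P i C \<Longrightarrow> C \<le> D \<Longrightarrow> P i D"
  shows "\<exists>C\<ge>1. \<forall>i\<in>I. P i C"
  using assms
proof (induction I rule: finite_induct)
  case empty
  show ?case by auto
next
  case (insert x I)
  have "\<exists>C\<ge>1. \<forall>i\<in>I. P i C" by (rule insert.IH) (use insert.prems in blast)+
  then obtain C where C: "C \<ge> 1" "\<forall>i\<in>I. P i C" by blast
  obtain D where D: "P x D" using insert.prems(1) by blast
  show ?case
  proof (intro exI[of _ "max C D"] conjI ballI)
    show "1 \<le> max C D" using C by simp
    fix i assume "i \<in> insert x I"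
    then show "P i (max C D)"
    proof
      assume "i = x"
      then show ?thesis using insert.prems(2)[of x D "max C D"] D by simp
    next
      assume "i \<in> I"
      then show ?thesis using insert.prems(2)[of i C "max C D"] C by simp
    qed
  qed
qed

text \<open>The sum is continuous and has no zero on the compact unit sphere, so it has a positive
  minimum there; homogeneity extends the bound to all vectors.\<close>

lemma sum_lin_coercive:
  assumes ker: "\<And>v. (\<forall>i\<in>T. lin (a i) v = 0) \<Longrightarrow> v = 0" and T: "finite T"
  shows "\<exists>C>0. \<forall>v. norm v \<le> C * (\<Sum>i\<in>T. norm (lin (a i) v))"
proof -
  define \<phi> where "\<phi> v = (\<Sum>i\<in>T. norm (lin (a i) v))" for v
  have cont: "continuous_on (sphere 0 1) \<phi>"
    unfolding \<phi>_def by (intro continuous_intros)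
  have ne: "sphere (0::complex^3) 1 \<noteq> {}"
    using vector_choose_size[of 1] by (metis (mono_tags) empty_iff mem_sphere_0 zero_le_one)
  obtain u where u: "u \<in> sphere 0 1" "\<And>v. v \<in> sphere 0 1 \<Longrightarrow> \<phi> u \<le> \<phi> v"
    using continuous_attains_inf[OF compact_sphere ne cont] by blast
  have "\<phi> u \<noteq> 0"
  proof
    assume "\<phi> u = 0"
    then have "u = 0" by (intro ker) (use T in \<open>auto simp: \<phi>_def sum_nonneg_eq_0_iff\<close>)
    then show False using u by simp
  qed
  moreover have "0 \<le> \<phi> u" by (simp add: \<phi>_def sum_nonneg)
  ultimately have pos: "0 < \<phi> u" by simp
  have "norm v \<le> (1 / \<phi> u) * \<phi> v" for v
  proof (cases "v = 0")
    case False
    define w where "w = of_real (inverse (norm v)) *s v"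
    have "norm w = 1" using False by (simp add: w_def norm_cscale norm_inverse)
    then have "\<phi> u \<le> \<phi> w" by (intro u(2)) simp
    also have "\<phi> w = inverse (norm v) * \<phi> v"
      by (simp add: \<phi>_def w_def lin_scale norm_mult sum_distrib_left norm_inverse)
    finally show ?thesis using pos False by (simp add: field_simps)
  qed (simp add: \<phi>_def sum_nonneg pos less_imp_le)
  with pos show ?thesis unfolding \<phi>_def by (intro exI[of _ "1 / \<phi> u"]) (simp add: \<phi>_def)
qed

lemma norm_lin_le: "norm (lin a v) \<le> (\<Sum>i\<in>UNIV. norm (a $ i)) * norm v"
proof -
  have "norm (lin a v) \<le> (\<Sum>i\<in>UNIV. norm (a $ i) * norm (v $ i))"
    unfolding lin_def by (rule order_trans[OF norm_sum]) (simp add: norm_mult)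
  also have "\<dots> \<le> (\<Sum>i\<in>UNIV. norm (a $ i) * norm v)"
    by (intro sum_mono mult_left_mono Finite_Cartesian_Product.norm_nth_le) auto
  finally show ?thesis by (simp add: sum_distrib_right)
qed

lemma general_forms_coercive:
  assumes "general_forms a"
  obtains \<kappa> where "\<kappa> \<ge> 1" "\<And>i v. i \<le> 4 \<Longrightarrow> norm (lin (a i) v) \<le> \<kappa> * norm v"
    "\<And>T v. T \<subseteq> {..4} \<Longrightarrow> card T = 3 \<Longrightarrow> \<exists>i\<in>T. norm v \<le> \<kappa> * norm (lin (a i) v)"
proof -
  have "\<exists>C\<ge>1. \<forall>i\<in>{..4}. \<forall>v. norm (lin (a i) v) \<le> C * norm v"
  proof (rule finite_common_bound)
    show "\<exists>C. \<forall>v. norm (lin (a i) v) \<le> C * norm v" for i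
      using norm_lin_le by blast
    show "\<forall>v. norm (lin (a i) v) \<le> D * norm v"
      if "\<forall>v. norm (lin (a i) v) \<le> C * norm v" "C \<le> D" for i C D
      using that by (meson mult_right_mono norm_ge_zero order_trans)
  qed simp
  then obtain C1 where C1: "C1 \<ge> 1" "\<And>i v. i \<le> 4 \<Longrightarrow> norm (lin (a i) v) \<le> C1 * norm v" by auto
  have "\<exists>C\<ge>1. \<forall>T\<in>{T. T \<subseteq> {..4} \<and> card T = 3}. \<forall>v. norm v \<le> C * (\<Sum>i\<in>T. norm (lin (a i) v))"
  proof (rule finite_common_bound)
    show "\<exists>C. \<forall>v. norm v \<le> C * (\<Sum>i\<in>T. norm (lin (a i) v))" if "T \<in> {T. T \<subseteq> {..4} \<and> card T = 3}" for T
    proof -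
      have "\<exists>C>0. \<forall>v. norm v \<le> C * (\<Sum>i\<in>T. norm (lin (a i) v))"
      proof (rule sum_lin_coercive)
        show "finite T" using that by (auto intro: finite_subset)
        show "v = 0" if "\<forall>i\<in>T. lin (a i) v = 0" for v
          using assms \<open>T \<in> _\<close> that unfolding general_forms_def by blast
      qed
      then show ?thesis by blast
    qed
    show "\<forall>v. norm v \<le> D * (\<Sum>i\<in>T. norm (lin (a i) v))"
      if "\<forall>v. norm v \<le> C * (\<Sum>i\<in>T. norm (lin (a i) v))" "C \<le> D" for T C D
      using that by (meson mult_right_mono sum_nonneg norm_ge_zero order_trans)
  qed simp
  then obtain C2 where C2: "C2 \<ge> 1"
    "\<And>T v. T \<subseteq> {..4} \<Longrightarrow> card T = 3 \<Longrightarrow> norm v \<le> C2 * (\<Sum>i\<in>T. norm (lin (a i) v))" by auto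
  show thesis
  \<comment> \<open>A sum of three terms is at most three times the largest term, hence the factor
    \<open>3\<close>.\<close>
  proof (rule that[of "max C1 (3 * C2)"])
    show "norm (lin (a i) v) \<le> max C1 (3 * C2) * norm v" if "i \<le> 4" for i v
      using C1(2)[OF that, of v] by (meson max.cobounded1 mult_right_mono norm_ge_zero order_trans)
    show "\<exists>i\<in>T. norm v \<le> max C1 (3 * C2) * norm (lin (a i) v)" if T: "T \<subseteq> {..4}" "card T = 3" for T v
    proof (rule ccontr)
      assume neg: "\<not> ?thesis"
      have fin: "finite T" "T \<noteq> {}" using T by (auto intro: finite_subset)
      have "norm v * 3 \<le> 3 * C2 * (\<Sum>i\<in>T. norm (lin (a i) v))" using C2(2)[OF T, of v] by simp
      also have "\<dots> = (\<Sum>i\<in>T. 3 * C2 * norm (lin (a i) v))" by (simp add: sum_distrib_left)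
      also have "\<dots> < (\<Sum>i\<in>T. norm v)"
      proof (rule sum_strict_mono[OF fin])
        fix i assume "i \<in> T"
        then have "max C1 (3 * C2) * norm (lin (a i) v) < norm v" using neg by auto
        moreover have "3 * C2 * norm (lin (a i) v) \<le> max C1 (3 * C2) * norm (lin (a i) v)"
          by (intro mult_right_mono) auto
        ultimately show "3 * C2 * norm (lin (a i) v) < norm v" by linarith
      qed
      also have "\<dots> = norm v * 3" using T by simp
      finally show False by simp
    qed
  qed (use C1 in auto)
qed

text \<open>The first three forms are a basis of the dual space, and the coefficients of
  \<open>d\<close> are its values on the dual basis \<open>u\<close>. If \<open>lin d (u 1)\<close>
  vanished, then \<open>b\<close>, \<open>c\<close> and \<open>d\<close> would have the common zero
  \<open>u 1\<close>; likewise for \<open>u 3\<close>.\<close>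

lemma lin_relation:
  assumes ker: "\<And>v. lin a v = 0 \<Longrightarrow> lin b v = 0 \<Longrightarrow> lin c v = 0 \<Longrightarrow> v = 0"
    and ker1: "\<And>v. lin b v = 0 \<Longrightarrow> lin c v = 0 \<Longrightarrow> lin d v = 0 \<Longrightarrow> v = 0"
    and ker3: "\<And>v. lin a v = 0 \<Longrightarrow> lin b v = 0 \<Longrightarrow> lin d v = 0 \<Longrightarrow> v = 0"
  obtains \<alpha> \<beta> \<gamma> where "\<alpha> \<noteq> 0" "\<gamma> \<noteq> 0" "\<And>v. lin d v = \<alpha> * lin a v + \<beta> * lin b v + \<gamma> * lin c v"
proof -
  define A where "A = (vector [a, b, c] :: complex^3^3)"
  have Av: "(A *v v) $ 1 = lin a v" "(A *v v) $ 2 = lin b v" "(A *v v) $ 3 = lin c v" for v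
    by (simp_all add: A_def matrix_vector_mult_def lin_def)
  have "v = 0" if "A *v v = 0" for v
    using Av[of v] that by (intro ker) simp_all
  then obtain B where BA: "B ** A = mat 1"
    using matrix_left_invertible_ker[of A] by blast
  then have AB: "A ** B = mat 1" using matrix_left_right_inverse by blast
  define u where "u k = B *v axis k 1" for k :: 3
  have Au: "A *v u k = axis k 1" for k
    using AB by (simp add: u_def matrix_vector_mul_assoc)
  have u0: "u k \<noteq> 0" for k
    using Au[of k] by (auto simp: axis_eq_0_iff)
  have rel: "lin d v = lin d (u 1) * lin a v + lin d (u 2) * lin b v + lin d (u 3) * lin c v" for v
  proof -
    define s where "s = lin a v *s u 1 + lin b v *s u 2 + lin c v *s u 3"
    define w where "w = v - s"
    have lu: "lin a (u k) = axis k 1 $ 1" "lin b (u k) = axis k 1 $ 2" "lin c (u k) = axis k 1 $ 3" for k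
      using Av[of "u k"] Au[of k] by simp_all
    have "lin a s = lin a v" "lin b s = lin b v" "lin c s = lin c v"
      by (simp_all add: s_def lin_add lin_scale lu axis_def)
    moreover have "lin x v = lin x w + lin x s" for x
      using lin_add[of x w s] by (simp add: w_def)
    ultimately have "lin a w = 0" "lin b w = 0" "lin c w = 0"
      by (metis add_cancel_left_left)+
    then have "w = 0" by (rule ker)
    then have "v = lin a v *s u 1 + lin b v *s u 2 + lin c v *s u 3" by (simp add: w_def s_def)
    then have "lin d v = lin d (lin a v *s u 1 + lin b v *s u 2 + lin c v *s u 3)" by simp
    then show ?thesis by (simp add: lin_add lin_scale mult.commute)
  qed
  have "lin d (u 1) \<noteq> 0"
    using ker1[of "u 1"] u0[of 1] Av[of "u 1"] Au[of 1] by (auto simp: axis_def)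
  moreover have "lin d (u 3) \<noteq> 0"
    using ker3[of "u 3"] u0[of 3] Av[of "u 3"] Au[of 3] by (auto simp: axis_def)
  ultimately show thesis by (rule that[of "lin d (u 1)" "lin d (u 3)" "lin d (u 2)", OF _ _ rel])
qed

lemma general_formsD:
  assumes "general_forms a" "i \<le> 4" "j \<le> 4" "k \<le> 4" "i \<noteq> j" "j \<noteq> k" "i \<noteq> k"
    "lin (a i) v = 0" "lin (a j) v = 0" "lin (a k) v = 0"
  shows "v = 0"
proof -
  have "{i,j,k} \<subseteq> {..4}" "card {i,j,k} = 3" "\<forall>x\<in>{i,j,k}. lin (a x) v = 0" using assms by auto
  then show ?thesis using assms(1) unfolding general_forms_def by blast
qed

lemma two_further_indices:
  fixes i j :: nat
  obtains k l where "k \<le> 4" "l \<le> 4" "k \<noteq> l" "k \<notin> {i,j}" "l \<notin> {i,j}"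
proof -
  have "card {i,j} \<le> 2" by (simp add: card_insert_if)
  moreover have "card {..4::nat} - card {i,j} \<le> card ({..4} - {i,j})"
    by (rule diff_card_le_card_Diff) simp
  ultimately have "2 \<le> card ({..4} - {i,j})" by simp
  then obtain K where "K \<subseteq> {..4} - {i,j}" "card K = 2" using obtain_subset_with_card_n by metis
  then obtain k l where "K = {k,l}" "k \<noteq> l" by (auto simp: card_2_iff)
  with \<open>K \<subseteq> _\<close> show thesis by (intro that[of k l]) auto
qed

section \<open>Schottky's theorem and Green's bound for lifts\<close>

lemma Schottky_ball:
  assumes hol: "G holomorphic_on cball 0 \<rho>" and \<rho>: "\<rho> > 0" and G0: "norm (G 0) \<le> r"
    and omit: "\<And>z. z \<in> cball 0 \<rho> \<Longrightarrow> G z \<noteq> 0" "\<And>z. z \<in> cball 0 \<rho> \<Longrightarrow> G z \<noteq> 1"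
    and z: "norm z \<le> \<rho> / 2"
  shows "norm (G z) \<le> exp (pi * exp (pi * (14 + 2 * r)))"
proof -
  define f where "f = (\<lambda>\<zeta>. G (of_real \<rho> * \<zeta>))"
  have inb: "of_real \<rho> * \<zeta> \<in> cball 0 \<rho>" if "\<zeta> \<in> cball 0 1" for \<zeta> :: complex
    using that \<rho> by (simp add: norm_mult mult_left_le)
  have "(G \<circ> (\<lambda>\<zeta>. of_real \<rho> * \<zeta>)) holomorphic_on cball 0 1"
    by (rule holomorphic_on_compose_gen[OF _ hol]) (use inb in \<open>auto intro!: holomorphic_intros\<close>)
  then have holf: "f holomorphic_on cball 0 1" by (simp add: f_def o_def)
  \<comment> \<open>At radius \<open>1/2\<close> the last term of Schottky's exponent equals
    \<open>12\<close>, which yields \<open>14 + 2 * r\<close>.\<close>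
  have "norm (f (z / of_real \<rho>)) \<le> exp (pi * exp (pi * (2 + 2 * r + 12 * (1/2) / (1 - 1/2))))"
  proof (rule Schottky[OF holf])
    show "norm (f 0) \<le> r" using G0 by (simp add: f_def)
    show "\<not> (f z = 0 \<or> f z = 1)" if "z \<in> cball 0 1" for z
      using omit inb[OF that] by (simp add: f_def)
    show "norm (z / of_real \<rho>) \<le> 1/2" using z \<rho> by (simp add: norm_divide field_simps)
  qed auto
  then show ?thesis using \<rho> by (simp add: f_def algebra_simps)
qed

lemma holomorphic_on_lin:
  assumes "\<And>k. (\<lambda>z. F z $ k) holomorphic_on S"
  shows "(\<lambda>z. lin a (F z)) holomorphic_on S"
  unfolding lin_def by (intro holomorphic_intros assms)

lemma five_units_lin:
  assumes \<kappa>: "\<kappa> \<ge> 1" "\<And>i v. i \<le> 4 \<Longrightarrow> norm (lin (a i) v) \<le> \<kappa> * norm v"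
    "\<And>T v. T \<subseteq> {..4} \<Longrightarrow> card T = 3 \<Longrightarrow> \<exists>i\<in>T. norm v \<le> \<kappa> * norm (lin (a i) v)"
    and F: "\<And>k. (\<lambda>z. F z $ k) holomorphic_on S"
    and nz: "\<And>z i. z \<in> S \<Longrightarrow> i \<le> 4 \<Longrightarrow> lin (a i) (F z) \<noteq> 0"
  shows "five_units (\<kappa> * \<kappa>) S (\<lambda>i z. lin (a i) (F z))"
  unfolding five_units_def
proof (intro conjI allI impI ballI)
  show "(\<lambda>z. lin (a i) (F z)) holomorphic_on S" for i by (rule holomorphic_on_lin[OF F])
  show "lin (a i) (F z) \<noteq> 0" if "i \<le> 4" "z \<in> S" for i z using nz that by blast
  fix z and T :: "nat set" assume "T \<subseteq> {..4}" "card T = 3"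
  then obtain i where i: "i \<in> T" "norm (F z) \<le> \<kappa> * norm (lin (a i) (F z))" using \<kappa>(3) by blast
  show "\<exists>i\<in>T. \<forall>l\<le>4. norm (lin (a l) (F z)) \<le> \<kappa> * \<kappa> * norm (lin (a i) (F z))"
  proof (intro bexI[OF _ i(1)] allI impI)
    fix l :: nat assume "l \<le> 4"
    then have "norm (lin (a l) (F z)) \<le> \<kappa> * norm (F z)" by (rule \<kappa>(2))
    also have "\<dots> \<le> \<kappa> * (\<kappa> * norm (lin (a i) (F z)))" using i \<kappa>(1) by (intro mult_left_mono) auto
    finally show "norm (lin (a l) (F z)) \<le> \<kappa> * \<kappa> * norm (lin (a i) (F z))" by simp
  qed
qed

text \<open>These constants serve \<open>Green_normality\<close>. The lower bound on \<alpha> lets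
  \<open>\<alpha> * g i\<close> dominate \<open>\<beta> * g j\<close>, and the lower bound on
  \<gamma> turns an estimate of \<open>\<gamma> * g k\<close> into one of
  \<open>g k\<close>.\<close>

lemma general_forms_relations:
  assumes a: "general_forms a"
  obtains M where "M \<ge> 1" "\<And>i j. i \<le> 4 \<Longrightarrow> j \<le> 4 \<Longrightarrow> i \<noteq> j \<Longrightarrow>
    \<exists>k l \<alpha> \<beta> \<gamma>. k \<le> 4 \<and> l \<le> 4 \<and> k \<noteq> i \<and> k \<noteq> j \<and>
      (\<forall>v. lin (a l) v = \<alpha> * lin (a i) v + \<beta> * lin (a j) v + \<gamma> * lin (a k) v) \<and>
      1 \<le> M * norm \<alpha> \<and> norm \<beta> \<le> M \<and> norm \<gamma> \<le> M \<and> norm \<alpha> \<le> M \<and> 1 \<le> M * norm \<gamma>"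
proof -
  define P where "P = (\<lambda>(i,j) M. \<exists>k l \<alpha> \<beta> \<gamma>. k \<le> 4 \<and> l \<le> 4 \<and> k \<noteq> i \<and> k \<noteq> j \<and>
      (\<forall>v. lin (a l) v = \<alpha> * lin (a i) v + \<beta> * lin (a j) v + \<gamma> * lin (a k) v) \<and>
      1 \<le> M * norm \<alpha> \<and> norm \<beta> \<le> M \<and> norm \<gamma> \<le> M \<and> norm \<alpha> \<le> M \<and> 1 \<le> M * norm \<gamma>)"
  have "\<exists>M\<ge>1. \<forall>p\<in>{(i,j). i \<le> 4 \<and> j \<le> 4 \<and> i \<noteq> j}. P p M"
  proof (rule finite_common_bound)
    have "{(i,j). i \<le> 4 \<and> j \<le> 4 \<and> i \<noteq> j} \<subseteq> {..4::nat} \<times> {..4::nat}" by auto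
    then show "finite {(i,j). i \<le> (4::nat) \<and> j \<le> (4::nat) \<and> i \<noteq> j}" by (rule finite_subset) simp
    fix p assume "p \<in> {(i,j). i \<le> (4::nat) \<and> j \<le> (4::nat) \<and> i \<noteq> j}"
    then obtain i j where p: "p = (i,j)" and ij: "i \<le> 4" "j \<le> 4" "i \<noteq> j" by auto
    obtain k l where kl: "k \<le> 4" "l \<le> 4" "k \<noteq> l" "k \<notin> {i,j}" "l \<notin> {i,j}"
      by (rule two_further_indices)
    obtain \<alpha> \<beta> \<gamma> where c: "\<alpha> \<noteq> 0" "\<gamma> \<noteq> 0"
      and rel: "\<And>v. lin (a l) v = \<alpha> * lin (a i) v + \<beta> * lin (a j) v + \<gamma> * lin (a k) v"
    proof (rule lin_relation[of "a i" "a j" "a k" "a l"])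
      show "v = 0" if "lin (a i) v = 0" "lin (a j) v = 0" "lin (a k) v = 0" for v
        using general_formsD[OF a ij(1,2) kl(1) _ _ _ that] ij kl by auto
      show "v = 0" if "lin (a j) v = 0" "lin (a k) v = 0" "lin (a l) v = 0" for v
        using general_formsD[OF a ij(2) kl(1,2) _ _ _ that] ij kl by auto
      show "v = 0" if "lin (a i) v = 0" "lin (a j) v = 0" "lin (a l) v = 0" for v
        using general_formsD[OF a ij(1,2) kl(2) _ _ _ that] ij kl by auto
    qed blast
    define M where "M = max (max (1 / norm \<alpha>) (1 / norm \<gamma>)) (max (norm \<alpha>) (max (norm \<beta>) (norm \<gamma>)))"
    have M: "1 / norm \<alpha> \<le> M" "1 / norm \<gamma> \<le> M" "norm \<alpha> \<le> M" "norm \<beta> \<le> M" "norm \<gamma> \<le> M"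
      by (auto simp: M_def)
    then have "1 \<le> M * norm \<alpha>" "1 \<le> M * norm \<gamma>" using c by (auto simp: divide_le_eq)
    with M rel kl have "k \<le> 4 \<and> l \<le> 4 \<and> k \<noteq> i \<and> k \<noteq> j \<and>
      (\<forall>v. lin (a l) v = \<alpha> * lin (a i) v + \<beta> * lin (a j) v + \<gamma> * lin (a k) v) \<and>
      1 \<le> M * norm \<alpha> \<and> norm \<beta> \<le> M \<and> norm \<gamma> \<le> M \<and> norm \<alpha> \<le> M \<and> 1 \<le> M * norm \<gamma>"
      by blast
    then have "P (i,j) M" unfolding P_def prod.case by blast
    then show "\<exists>M. P p M" using p by blast
  next
    fix p :: "nat \<times> nat" and C D :: real assume "P p C" "C \<le> D"
    obtain i j where p: "p = (i,j)" by fastforce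
    from \<open>P p C\<close> obtain k l \<alpha> \<beta> \<gamma> where *: "k \<le> 4 \<and> l \<le> 4 \<and> k \<noteq> i \<and> k \<noteq> j \<and>
      (\<forall>v. lin (a l) v = \<alpha> * lin (a i) v + \<beta> * lin (a j) v + \<gamma> * lin (a k) v) \<and>
      1 \<le> C * norm \<alpha> \<and> norm \<beta> \<le> C \<and> norm \<gamma> \<le> C \<and> norm \<alpha> \<le> C \<and> 1 \<le> C * norm \<gamma>"
      unfolding P_def p prod.case by blast
    have "C * norm \<alpha> \<le> D * norm \<alpha>" "C * norm \<gamma> \<le> D * norm \<gamma>"
      using \<open>C \<le> D\<close> by (auto intro: mult_right_mono)
    with * \<open>C \<le> D\<close> have "1 \<le> D * norm \<alpha>" "norm \<beta> \<le> D" "norm \<gamma> \<le> D" "norm \<alpha> \<le> D" "1 \<le> D * norm \<gamma>"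
      by linarith+
    with * have "k \<le> 4 \<and> l \<le> 4 \<and> k \<noteq> i \<and> k \<noteq> j \<and>
      (\<forall>v. lin (a l) v = \<alpha> * lin (a i) v + \<beta> * lin (a j) v + \<gamma> * lin (a k) v) \<and>
      1 \<le> D * norm \<alpha> \<and> norm \<beta> \<le> D \<and> norm \<gamma> \<le> D \<and> norm \<alpha> \<le> D \<and> 1 \<le> D * norm \<gamma>"
      by blast
    then show "P p D" unfolding P_def p prod.case by blast
  qed
  then obtain M where "M \<ge> 1" and M: "\<forall>p\<in>{(i,j). i \<le> 4 \<and> j \<le> 4 \<and> i \<noteq> j}. P p M" by blast
  show thesis
  proof (rule that[OF \<open>M \<ge> 1\<close>])
    fix i j :: nat assume "i \<le> 4" "j \<le> 4" "i \<noteq> j"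
    then have "P (i,j) M" using M by blast
    then show "\<exists>k l \<alpha> \<beta> \<gamma>. k \<le> 4 \<and> l \<le> 4 \<and> k \<noteq> i \<and> k \<noteq> j \<and>
      (\<forall>v. lin (a l) v = \<alpha> * lin (a i) v + \<beta> * lin (a j) v + \<gamma> * lin (a k) v) \<and>
      1 \<le> M * norm \<alpha> \<and> norm \<beta> \<le> M \<and> norm \<gamma> \<le> M \<and> norm \<alpha> \<le> M \<and> 1 \<le> M * norm \<gamma>"
      by (simp add: P_def)
  qed
qed

text \<open>If the spread at \<open>0\<close> is large, one form \<open>g j\<close> is negligible against the dominating \<open>g i\<close>, and by
  the relation between four forms \<open>- \<gamma> g k / (\<alpha> g i + \<beta> g j)\<close> omits \<open>0\<close> and \<open>1\<close>.\<close>

lemma Green_normality: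
  assumes a: "general_forms a"
  obtains C where "C > 0"
    "\<And>F. (\<And>k. (\<lambda>z. F z $ k) holomorphic_on ball 0 1) \<Longrightarrow>
      (\<And>z i. z \<in> ball 0 1 \<Longrightarrow> i \<le> 4 \<Longrightarrow> lin (a i) (F z) \<noteq> 0) \<Longrightarrow>
      \<exists>i\<le>4. \<forall>z\<in>ball 0 (1/16). norm (F z) \<le> C * norm (lin (a i) (F z))"
proof -
  obtain \<kappa> where \<kappa>: "\<kappa> \<ge> 1" "\<And>i v. i \<le> 4 \<Longrightarrow> norm (lin (a i) v) \<le> \<kappa> * norm v"
    "\<And>T v. T \<subseteq> {..4} \<Longrightarrow> card T = 3 \<Longrightarrow> \<exists>i\<in>T. norm v \<le> \<kappa> * norm (lin (a i) v)"
    using general_forms_coercive[OF a] by blast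
  have \<kappa>2: "\<kappa> * \<kappa> > 0" using \<kappa>(1) by simp
  obtain M where M: "M \<ge> 1" and rel: "\<And>i j. i \<le> 4 \<Longrightarrow> j \<le> 4 \<Longrightarrow> i \<noteq> j \<Longrightarrow>
    \<exists>k l \<alpha> \<beta> \<gamma>. k \<le> 4 \<and> l \<le> 4 \<and> k \<noteq> i \<and> k \<noteq> j \<and>
      (\<forall>v. lin (a l) v = \<alpha> * lin (a i) v + \<beta> * lin (a j) v + \<gamma> * lin (a k) v) \<and>
      1 \<le> M * norm \<alpha> \<and> norm \<beta> \<le> M \<and> norm \<gamma> \<le> M \<and> norm \<alpha> \<le> M \<and> 1 \<le> M * norm \<gamma>"
    using general_forms_relations[OF a] by blast
  \<comment> \<open>With this \<eta> the term \<open>\<beta> * g j\<close> is at most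
    \<open>norm (g i z) / (2 * M)\<close>, half of the lower bound \<open>norm (g i z) / M\<close>
    for \<open>\<alpha> * g i\<close>.\<close>
  define \<eta> where "\<eta> = 1 / (2 * M\<^sup>2)"
  have \<eta>: "\<eta> > 0" "M * \<eta> = 1 / (2 * M)" "\<eta> \<le> 1"
  proof -
    show "\<eta> > 0" "M * \<eta> = 1 / (2 * M)" using M by (auto simp: \<eta>_def power2_eq_square)
    have "1 * 1 \<le> M * M" using M by (intro mult_mono) auto
    then show "\<eta> \<le> 1" by (simp add: \<eta>_def power2_eq_square divide_le_eq)
  qed
  have "\<exists>N0\<ge>1. \<forall>i\<in>{..4}. \<forall>g. five_units (\<kappa> * \<kappa>) (ball 0 1) g \<longrightarrow> (\<forall>l\<le>4. norm (g l 0) \<le> norm (g i 0)) \<longrightarrow>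
    N0 \<le> spread g 0 \<longrightarrow> (\<exists>j\<le>4. \<forall>z\<in>cball 0 (1/8). norm (g j z) \<le> \<eta> * norm (g i z))"
    by (rule finite_common_bound) (use spread_large[OF \<kappa>2 \<eta>(1)] in auto)
  then obtain N0 where N0: "N0 \<ge> 1" and large:
    "\<And>i g. i \<le> 4 \<Longrightarrow> five_units (\<kappa> * \<kappa>) (ball 0 1) g \<Longrightarrow> (\<And>l. l \<le> 4 \<Longrightarrow> norm (g l 0) \<le> norm (g i 0)) \<Longrightarrow>
    N0 \<le> spread g 0 \<Longrightarrow> \<exists>j\<le>4. \<forall>z\<in>cball 0 (1/8). norm (g j z) \<le> \<eta> * norm (g i z)"
    by (auto simp: atMost_iff)
  obtain C where C: "C > 0" "\<And>g z. five_units (\<kappa> * \<kappa>) (ball 0 1) g \<Longrightarrow> z \<in> cball 0 (1/4) \<Longrightarrow>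
    1 + spread g z \<le> C * (1 + spread g 0)"
    using spread_growth[OF \<kappa>2] by blast
  define S where "S = exp (pi * exp (pi * (14 + 2 * (2 * M\<^sup>2))))"
  define K1 where "K1 = \<kappa> * exp (C * (1 + N0))"
  define K2 where "K2 = \<kappa> * (1 + 2 * M\<^sup>2 * S)"
  have K1: "K1 > 0" using \<kappa>(1) by (simp add: K1_def)
  show thesis
  proof (rule that[of "max K1 K2"])
    show "max K1 K2 > 0" using K1 by simp
    fix F :: "complex \<Rightarrow> complex^3"
    assume F: "\<And>k. (\<lambda>z. F z $ k) holomorphic_on ball 0 1"
      and nz: "\<And>z i. z \<in> ball 0 1 \<Longrightarrow> i \<le> 4 \<Longrightarrow> lin (a i) (F z) \<noteq> 0"
    define g where "g = (\<lambda>i z. lin (a i) (F z))"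
    have g: "five_units (\<kappa> * \<kappa>) (ball 0 1) g"
      unfolding g_def by (rule five_units_lin[OF \<kappa> F nz])
    have Fg: "\<exists>i\<in>T. norm (F z) \<le> \<kappa> * norm (g i z)" if "T \<subseteq> {..4}" "card T = 3" for T z
      using \<kappa>(3)[OF that] by (simp add: g_def)
    have gnz: "g i z \<noteq> 0" if "i \<le> 4" "z \<in> ball 0 1" for i z using nz that by (simp add: g_def)
    show "\<exists>i\<le>4. \<forall>z\<in>ball 0 (1/16). norm (F z) \<le> max K1 K2 * norm (lin (a i) (F z))"
    proof (cases "spread g 0 < N0")
      case True
      \<comment> \<open>If the spread at \<open>0\<close> is bounded, \<open>spread_growth\<close>
        keeps all five moduli comparable, so any fixed index works.\<close>
      have "norm (F z) \<le> K1 * norm (g 0 z)" if z: "z \<in> ball 0 (1/16)" for z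
      proof -
        have z1: "z \<in> ball 0 1" using z by auto
        have "{0,1,2} \<subseteq> {..4::nat}" "card {0,1,2::nat} = 3" by auto
        from Fg[OF this] obtain i where i: "i \<in> {0,1,2::nat}" "norm (F z) \<le> \<kappa> * norm (g i z)" by blast
        have i4: "i \<le> 4" using i by auto
        have "1 + spread g z \<le> C * (1 + spread g 0)" by (rule C(2)[OF g]) (use z in auto)
        also have "\<dots> \<le> C * (1 + N0)" using True C(1) by (intro mult_left_mono) auto
        finally have "spread g z \<le> C * (1 + N0)" by simp
        then have "ln (norm (g i z)) \<le> ln (norm (g 0 z)) + C * (1 + N0)"
          using spread_ge[OF i4, of 0 g z] by simp
        then have "exp (ln (norm (g i z))) \<le> exp (ln (norm (g 0 z)) + C * (1 + N0))" by simp
        then have "norm (g i z) \<le> norm (g 0 z) * exp (C * (1 + N0))"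
          using gnz[OF i4 z1] gnz[of 0 z] z1 by (simp add: exp_add)
        then have "\<kappa> * norm (g i z) \<le> \<kappa> * (norm (g 0 z) * exp (C * (1 + N0)))"
          using \<kappa>(1) by (intro mult_left_mono) auto
        with i(2) show ?thesis by (simp add: K1_def mult_ac)
      qed
      moreover have "K1 * norm (g 0 z) \<le> max K1 K2 * norm (g 0 z)" for z by (intro mult_right_mono) auto
      ultimately show ?thesis unfolding g_def by (meson order_trans zero_le)
    next
      case False
      have "Max ((\<lambda>i. norm (g i 0)) ` {..4}) \<in> (\<lambda>i. norm (g i 0)) ` {..4}" by (intro Max_in) auto
      then obtain i where i: "i \<le> 4" "Max ((\<lambda>i. norm (g i 0)) ` {..4}) = norm (g i 0)" by (metis (no_types, lifting) atMost_iff imageE)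
      have imax: "norm (g l 0) \<le> norm (g i 0)" if "l \<le> 4" for l
        unfolding i(2)[symmetric] using that by (intro Max_ge) auto
      obtain j where j: "j \<le> 4" "\<And>z. z \<in> cball 0 (1/8) \<Longrightarrow> norm (g j z) \<le> \<eta> * norm (g i z)"
        using large[OF i(1) g imax] False by auto
      have sub: "cball 0 (1/8) \<subseteq> ball (0::complex) 1" by auto
      have "i \<noteq> j"
      proof
        assume "i = j"
        then have "norm (g i 0) \<le> \<eta> * norm (g i 0)" using j(2)[of 0] by simp
        moreover have "\<eta> \<le> 1/2"
          using mult_mono[of 1 M 1 M] M by (simp add: \<eta>_def power2_eq_square divide_simps)
        moreover from this have "\<eta> * norm (g i 0) \<le> 1/2 * norm (g i 0)"
          by (intro mult_right_mono) auto
        moreover have "norm (g i 0) > 0" using gnz[OF i(1), of 0] by simp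
        ultimately show False by linarith
      qed
      with rel[OF i(1) j(1)] obtain k l \<alpha> \<beta> \<gamma> where kl: "k \<le> 4" "l \<le> 4" "k \<noteq> i" "k \<noteq> j"
        and re: "\<And>v. lin (a l) v = \<alpha> * lin (a i) v + \<beta> * lin (a j) v + \<gamma> * lin (a k) v"
        and b: "1 \<le> M * norm \<alpha>" "norm \<beta> \<le> M" "norm \<gamma> \<le> M" "norm \<alpha> \<le> M" "1 \<le> M * norm \<gamma>" by blast
      have gre: "g l z = \<alpha> * g i z + \<beta> * g j z + \<gamma> * g k z" for z by (simp add: g_def re)
      define q where "q = (\<lambda>z. \<alpha> * g i z + \<beta> * g j z)"
      have q1: "norm (g i z) \<le> 2 * M * norm (q z)" and q2: "norm (q z) \<le> 2 * M * norm (g i z)"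
        if z: "z \<in> cball 0 (1/8)" for z
      proof -
        have "norm (\<beta> * g j z) \<le> M * (\<eta> * norm (g i z))"
          unfolding norm_mult using b(2) j(2)[OF z] M by (intro mult_mono) auto
        then have small: "norm (\<beta> * g j z) \<le> norm (g i z) / (2 * M)" using \<eta>(2) by (simp add: mult.assoc[symmetric])
        have "1 * norm (g i z) \<le> (M * norm \<alpha>) * norm (g i z)" using b(1) by (intro mult_right_mono) auto
        then have ai: "norm (g i z) / M \<le> norm (\<alpha> * g i z)"
          using M by (simp add: norm_mult divide_le_eq mult_ac)
        have "norm (\<alpha> * g i z) - norm (\<beta> * g j z) \<le> norm (q z)"
          unfolding q_def by (rule norm_diff_ineq)
        then have "norm (g i z) / M - norm (g i z) / (2 * M) \<le> norm (q z)" using small ai by linarith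
        then have "norm (g i z) / (2 * M) \<le> norm (q z)" using M by (simp add: field_simps)
        then show "norm (g i z) \<le> 2 * M * norm (q z)" using M by (simp add: divide_le_eq mult_ac)
        have "norm (q z) \<le> norm (\<alpha> * g i z) + norm (\<beta> * g j z)" unfolding q_def by (rule norm_triangle_ineq)
        also have "\<dots> \<le> M * norm (g i z) + M * norm (g i z)"
        proof (intro add_mono)
          show "norm (\<alpha> * g i z) \<le> M * norm (g i z)" unfolding norm_mult using b(4) by (intro mult_right_mono) auto
          have "1 \<le> M * M * 2" using mult_mono[of 1 M 1 M] M by simp
          then have "1 * norm (g i z) \<le> (M * M * 2) * norm (g i z)" by (intro mult_right_mono) auto
          then have "norm (g i z) / (2 * M) \<le> norm (g i z) * M"
            using M by (simp add: divide_le_eq mult_ac)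
          with small show "norm (\<beta> * g j z) \<le> M * norm (g i z)" by (simp add: mult.commute)
        qed
        finally show "norm (q z) \<le> 2 * M * norm (g i z)" by simp
      qed
      have qnz: "q z \<noteq> 0" if "z \<in> cball 0 (1/8)" for z
        using q1[OF that] gnz[OF i(1), of z] that sub by auto
      have \<gamma>0: "\<gamma> \<noteq> 0" using b(5) by auto
      define G where "G = (\<lambda>z. - \<gamma> * g k z / q z)"
      have holg: "g x holomorphic_on cball 0 (1/8)" if "x \<le> 4" for x
        using g that holomorphic_on_subset[OF _ sub] by (auto simp: five_units_def)
      have holG: "G holomorphic_on cball 0 (1/8)"
        unfolding G_def using qnz by (auto simp: q_def intro!: holomorphic_intros holg i j kl)
      \<comment> \<open>Schottky's theorem needs a bound at the centre. It comes from the choice of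
        \<open>i\<close> as an index of largest modulus at \<open>0\<close>.\<close>
      have G0: "norm (G 0) \<le> 2 * M\<^sup>2"
      proof -
        have "norm \<gamma> * norm (g k 0) \<le> M * (2 * M * norm (q 0))"
          using b(3) M q1[of 0] imax[OF kl(1)] by (intro mult_mono) auto
        then show ?thesis using qnz[of 0]
          by (simp add: G_def norm_divide norm_mult divide_le_eq power2_eq_square mult_ac)
      qed
      have Gnz: "G z \<noteq> 0" if z: "z \<in> cball 0 (1/8)" for z
        using gnz[OF kl(1), of z] qnz[OF z] z sub \<gamma>0 by (auto simp: G_def)
      have Gn1: "G z \<noteq> 1" if z: "z \<in> cball 0 (1/8)" for z
      proof
        assume "G z = 1"
        then have "- \<gamma> * g k z = 1 * q z"
          using qnz[OF z] unfolding G_def by (metis nonzero_divide_eq_eq)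
        moreover have "g l z = q z + \<gamma> * g k z" by (simp add: gre q_def)
        ultimately have "g l z = 0" by (metis add.left_inverse mult_1 mult_minus_left)
        then show False using gnz[OF kl(2), of z] z sub by auto
      qed
      have gk: "norm (g k z) \<le> 2 * M\<^sup>2 * S * norm (g i z)" if z: "z \<in> ball 0 (1/16)" for z
      proof -
        have z8: "z \<in> cball 0 (1/8)" using z by auto
        have "norm (G z) \<le> S"
          unfolding S_def by (rule Schottky_ball[OF holG _ G0 Gnz Gn1]) (use z in auto)
        then have "norm \<gamma> * norm (g k z) \<le> S * norm (q z)"
          using qnz[OF z8] by (simp add: G_def norm_divide norm_mult divide_le_eq)
        also have "\<dots> \<le> S * (2 * M * norm (g i z))" using q2[OF z8] by (intro mult_left_mono) (auto simp: S_def)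
        finally have "M * (norm \<gamma> * norm (g k z)) \<le> M * (S * (2 * M * norm (g i z)))"
          using M by (intro mult_left_mono) auto
        moreover have "1 * norm (g k z) \<le> (M * norm \<gamma>) * norm (g k z)" using b(5) by (intro mult_right_mono) auto
        ultimately show ?thesis by (simp add: power2_eq_square mult_ac)
      qed
      have "norm (F z) \<le> K2 * norm (g i z)" if z: "z \<in> ball 0 (1/16)" for z
      proof -
        have z8: "z \<in> cball 0 (1/8)" using z by auto
        \<comment> \<open>The forms \<open>j\<close> and \<open>k\<close> are now both bounded by
          \<open>i\<close>, and three forms control the whole vector.\<close>
        have T: "{i,j,k} \<subseteq> {..4}" "card {i,j,k} = 3" using i j kl \<open>i \<noteq> j\<close> by auto
        then obtain x where x: "x \<in> {i,j,k}" "norm (F z) \<le> \<kappa> * norm (g x z)" using Fg by blast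
        define y where "y = norm (g i z)"
        have y: "y \<ge> 0" by (simp add: y_def)
        have S0: "2 * M\<^sup>2 * S * y \<ge> 0" using y by (simp add: S_def)
        have "\<eta> * y \<le> 1 * y" using \<eta>(3) y by (intro mult_right_mono) auto
        moreover have "norm (g j z) \<le> \<eta> * y" "norm (g k z) \<le> 2 * M\<^sup>2 * S * y"
          using j(2)[OF z8] gk[OF z] by (simp_all only: y_def)
        moreover have "norm (g x z) = y \<or> norm (g x z) = norm (g j z) \<or> norm (g x z) = norm (g k z)"
          using x(1) by (auto simp: y_def)
        ultimately have "norm (g x z) \<le> y + 2 * M\<^sup>2 * S * y" using S0 y by argo
        then have "\<kappa> * norm (g x z) \<le> \<kappa> * (y + 2 * M\<^sup>2 * S * y)" using \<kappa>(1) by (intro mult_left_mono) auto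
        with x(2) show ?thesis by (simp add: K2_def y_def algebra_simps)
      qed
      moreover have "K2 * norm (g i z) \<le> max K1 K2 * norm (g i z)" for z by (intro mult_right_mono) auto
      ultimately show ?thesis unfolding g_def using i(1) by (meson order_trans)
    qed
  qed
qed

section \<open>The topology of the projective plane\<close>

lemma proj_rel_refl: "v \<noteq> 0 \<Longrightarrow> proj_rel v v"
  by (auto simp: proj_rel_def intro!: exI[of _ 1])

lemma abs_cp2_eq_iff:
  assumes "v \<noteq> 0" "w \<noteq> 0"
  shows "abs_cp2 v = abs_cp2 w \<longleftrightarrow> (\<exists>c. c \<noteq> 0 \<and> w = c *s v)"
  using Quotient_rel[OF Quotient_cp2, of v w] assms proj_rel_refl[of v] proj_rel_refl[of w]
  by (auto simp: proj_rel_def)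

lemma abs_cp2_scale: "v \<noteq> 0 \<Longrightarrow> c \<noteq> 0 \<Longrightarrow> abs_cp2 (c *s v) = abs_cp2 v"
  using abs_cp2_eq_iff[of v "c *s v"] by auto

lemma cp2_cases:
  obtains v where "v \<noteq> 0" "p = abs_cp2 v"
proof -
  have "proj_rel (rep_cp2 p) (rep_cp2 p)" by (rule Quotient_rep_reflp[OF Quotient_cp2])
  then have "rep_cp2 p \<noteq> 0" by (simp add: proj_rel_def)
  moreover have "p = abs_cp2 (rep_cp2 p)" by (simp add: Quotient_abs_rep[OF Quotient_cp2])
  ultimately show thesis by (rule that)
qed

lemma rep_cp2_nonzero: "rep_cp2 p \<noteq> 0"
  using Quotient_rep_reflp[OF Quotient_cp2, of p] by (simp add: proj_rel_def)

lemma abs_rep_cp2: "abs_cp2 (rep_cp2 p) = p"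
  by (rule Quotient_abs_rep[OF Quotient_cp2])

lemma in_chart_abs: "v \<noteq> 0 \<Longrightarrow> in_chart k (abs_cp2 v) \<longleftrightarrow> v $ k \<noteq> 0"
  by (rule in_chart.abs_eq) (rule proj_rel_refl)

lemma affine_coord_abs: "v \<noteq> 0 \<Longrightarrow> affine_coord k j (abs_cp2 v) = v $ j / v $ k"
  by (rule affine_coord.abs_eq) (rule proj_rel_refl)

lemma continuous_on_cscale [continuous_intros]:
  fixes f :: "'a::topological_space \<Rightarrow> complex" and g :: "'a \<Rightarrow> complex^3"
  shows "continuous_on S f \<Longrightarrow> continuous_on S g \<Longrightarrow> continuous_on S (\<lambda>x. f x *s g x)"
  unfolding vector_scalar_mult_def by (intro continuous_intros)

lemma continuous_on_abs_cp2: "continuous_on (- {0}) abs_cp2"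
proof -
  have "abs_cp2 -` B \<inter> - {0} = {v. v \<noteq> 0 \<and> abs_cp2 v \<in> B}" for B by auto
  then show ?thesis
    by (subst continuous_on_open_vimage) (auto simp: open_cp2_def open_Compl)
qed

text \<open>The set of all representatives of the image is the union of the preimages of
  \<open>V\<close> under nonzero scalings.\<close>

lemma open_abs_cp2_image:
  assumes "open V" "0 \<notin> V"
  shows "open (abs_cp2 ` V)"
proof -
  have "{v. v \<noteq> 0 \<and> abs_cp2 v \<in> abs_cp2 ` V} = (\<Union>c\<in>-{0}. (\<lambda>v. c *s v) -` V)" (is "?L = ?R")
  proof (intro equalityI subsetI)
    fix v assume "v \<in> ?L"
    then obtain w where w: "v \<noteq> 0" "w \<in> V" "abs_cp2 v = abs_cp2 w" by auto
    then have "w \<noteq> 0" using assms by auto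
    with w obtain c where "c \<noteq> 0" "w = c *s v" using abs_cp2_eq_iff by blast
    with w show "v \<in> ?R" by auto
  next
    fix v assume "v \<in> ?R"
    then obtain c where c: "c \<noteq> 0" "c *s v \<in> V" by auto
    then have "v \<noteq> 0" using assms(2) by auto
    moreover have "abs_cp2 v = abs_cp2 (c *s v)" using abs_cp2_scale[OF \<open>v \<noteq> 0\<close> c(1)] by simp
    ultimately show "v \<in> ?L" using c by auto
  qed
  moreover have "open ((\<lambda>v. c *s v) -` V)" for c
    by (rule open_vimage[OF assms(1)]) (intro continuous_intros)
  ultimately show ?thesis unfolding open_cp2_def by auto
qed

lemma open_chart_domain: "open (chart_domain k)"
proof -
  have "{v. v \<noteq> 0 \<and> abs_cp2 v \<in> chart_domain k} = {v :: complex^3. v $ k \<noteq> 0}"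
    by (rule Collect_cong) (metis chart_domain_def in_chart_abs mem_Collect_eq zero_index)
  moreover have "open {v :: complex^3. v $ k \<noteq> 0}"
    by (intro open_Collect_neq continuous_intros)
  ultimately show ?thesis by (simp add: open_cp2_def)
qed

lemma holomorphic_disc_abs:
  assumes F: "\<And>k. (\<lambda>z. F z $ k) holomorphic_on ball 0 1" and nz: "\<And>z. z \<in> ball 0 1 \<Longrightarrow> F z \<noteq> 0"
    and X: "\<And>z. z \<in> ball 0 1 \<Longrightarrow> abs_cp2 (F z) \<in> X"
  shows "holomorphic_disc X (\<lambda>z. abs_cp2 (F z))"
  unfolding holomorphic_disc_def
proof (intro conjI allI)
  show "(\<lambda>z. abs_cp2 (F z)) ` ball 0 1 \<subseteq> X" using X by auto
  have "continuous_on (ball 0 1) (\<lambda>z. \<chi> k. F z $ k)"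
    by (intro continuous_intros holomorphic_on_imp_continuous_on F)
  then have "continuous_on (ball 0 1) F" by simp
  then show "continuous_on (ball 0 1) (\<lambda>z. abs_cp2 (F z))"
    using continuous_on_compose2[OF continuous_on_abs_cp2] nz by (metis ComplI image_subsetI singletonD)
  fix k j
  let ?U = "{z \<in> ball 0 1. abs_cp2 (F z) \<in> chart_domain k}"
  have "(\<lambda>z. F z $ j / F z $ k) holomorphic_on ?U"
    by (intro holomorphic_intros holomorphic_on_subset[OF F])
       (auto simp: chart_domain_def in_chart_abs nz)
  then show "(\<lambda>z. affine_coord k j (abs_cp2 (F z))) holomorphic_on ?U"
    by (rule holomorphic_transform) (auto simp: affine_coord_abs nz)
qed

section \<open>Lines as kernels of forms, and global lifts of discs\<close>

definition form_line :: "complex^3 \<Rightarrow> cp2 set" where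
  "form_line a = {abs_cp2 v | v. v \<noteq> 0 \<and> lin a v = 0}"

lemma in_form_line_iff: "v \<noteq> 0 \<Longrightarrow> abs_cp2 v \<in> form_line a \<longleftrightarrow> lin a v = 0"
proof
  assume v: "v \<noteq> 0" and "abs_cp2 v \<in> form_line a"
  then obtain w where w: "w \<noteq> 0" "lin a w = 0" "abs_cp2 w = abs_cp2 v" by (auto simp: form_line_def)
  then obtain c where "v = c *s w" using v abs_cp2_eq_iff by blast
  then show "lin a v = 0" using w by (simp add: lin_scale)
qed (auto simp: form_line_def)

lemma general_position_forms:
  assumes lines: "\<And>i. i \<le> 4 \<Longrightarrow> projective_line (l i)" and gp: "general_position {..4::nat} l"
  obtains a where "general_forms a" "\<And>i. i \<le> 4 \<Longrightarrow> l i = form_line (a i)"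
proof -
  have "\<exists>a. i \<le> 4 \<longrightarrow> l i = form_line a" for i
    using lines[of i] unfolding projective_line_def form_line_def lin_def by blast
  then obtain a where a: "\<And>i. i \<le> 4 \<Longrightarrow> l i = form_line (a i)" by metis
  have "general_forms a"
    unfolding general_forms_def
  proof (intro allI impI)
    fix T v assume T: "T \<subseteq> {..4::nat}" "card T = 3" and v: "\<forall>i\<in>T. lin (a i) v = 0"
    obtain i j k where ijk: "T = {i,j,k}" "i \<noteq> j" "j \<noteq> k" "i \<noteq> k"
      using T(2) by (auto simp: card_3_iff)
    have "\<not> concurrent (l i) (l j) (l k)"
      using gp T ijk unfolding general_position_def by blast
    then show "v = 0"
      using v T ijk a in_form_line_iff[of v] unfolding concurrent_def by (metis atMost_iff insert_subset insertI1 insert_commute)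
  qed
  with a show thesis by (rule that[rotated])
qed

text \<open>Off the line of \<open>b\<close> every point has exactly one representative with
  \<open>lin b\<close> equal to \<open>1\<close>. The local lifts from the charts therefore agree
  after this normalisation, and there is nothing to glue.\<close>

lemma holomorphic_disc_lift:
  assumes f: "holomorphic_disc X f" and X: "X \<inter> form_line b = {}"
  obtains F where "\<And>k. (\<lambda>z. F z $ k) holomorphic_on ball 0 1"
    "\<And>z. z \<in> ball 0 1 \<Longrightarrow> F z \<noteq> 0 \<and> abs_cp2 (F z) = f z"
proof -
  define F where "F z = (1 / lin b (rep_cp2 (f z))) *s rep_cp2 (f z)" for z
  have lb: "lin b (rep_cp2 (f z)) \<noteq> 0" if "z \<in> ball 0 1" for z
  proof -
    have "f z \<in> X" using f that by (auto simp: holomorphic_disc_def)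
    then have "f z \<notin> form_line b" using X by blast
    then show ?thesis
      using in_form_line_iff[OF rep_cp2_nonzero, of "f z" b] by (simp add: abs_rep_cp2)
  qed
  have ac: "affine_coord m k (f z) = rep_cp2 (f z) $ k / rep_cp2 (f z) $ m" for m k z
    using affine_coord_abs[OF rep_cp2_nonzero, of m k "f z"] by (simp add: abs_rep_cp2)
  have ch: "f z \<in> chart_domain m \<longleftrightarrow> rep_cp2 (f z) $ m \<noteq> 0" for m z
    using in_chart_abs[OF rep_cp2_nonzero, of m "f z"] by (simp add: abs_rep_cp2 chart_domain_def)
  define U where "U m = {z \<in> ball 0 1. f z \<in> chart_domain m}" for m
  have cont: "continuous_on (ball 0 1) f" using f by (simp add: holomorphic_disc_def)
  have opU: "open (U m)" for m
  proof -
    have "open (f -` chart_domain m \<inter> ball 0 1)"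
      using continuous_on_open_vimage[of "ball 0 1" f] cont open_chart_domain by blast
    then show ?thesis by (simp add: U_def vimage_def Int_def conj_commute)
  qed
  have UU: "(\<Union>m. U m) = ball 0 1"
  proof -
    have "\<exists>m. rep_cp2 (f z) $ m \<noteq> 0" for z
      using rep_cp2_nonzero[of "f z"] by (metis vec_eq_iff zero_index)
    then show ?thesis by (auto simp: U_def ch)
  qed
  show thesis
  proof (rule that[of F])
    fix k
    have "(\<lambda>z. F z $ k) holomorphic_on (\<Union>m\<in>UNIV. U m)"
    proof (rule holomorphic_on_UN_open[OF _ opU])
      fix m
      have hol: "(\<lambda>z. affine_coord m j (f z)) holomorphic_on U m" for j
        using f by (auto simp: holomorphic_disc_def U_def)
      have linac: "lin b (\<chi> i. rep_cp2 (f z) $ i / rep_cp2 (f z) $ m) = lin b (rep_cp2 (f z)) / rep_cp2 (f z) $ m" for z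
        by (simp add: lin_def sum_divide_distrib)
      have "(\<lambda>z. affine_coord m k (f z) / lin b (\<chi> i. affine_coord m i (f z))) holomorphic_on U m"
        by (intro holomorphic_intros hol holomorphic_on_lin)
           (use lb hol in \<open>auto simp: ac linac U_def ch\<close>)
      then show "(\<lambda>z. F z $ k) holomorphic_on U m"
        by (rule holomorphic_transform) (auto simp: linac ac F_def U_def ch)
    qed
    then show "(\<lambda>z. F z $ k) holomorphic_on ball 0 1" by (simp add: UU)
  next
    fix z :: complex assume "z \<in> ball 0 1"
    then have c: "1 / lin b (rep_cp2 (f z)) \<noteq> 0" using lb by simp
    have "abs_cp2 (F z) = f z"
      unfolding F_def using abs_cp2_scale[OF rep_cp2_nonzero c] by (simp add: abs_rep_cp2)
    moreover have "F z \<noteq> 0"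
      using c rep_cp2_nonzero[of "f z"] unfolding F_def by (metis norm_cscale norm_eq_zero mult_eq_0_iff)
    ultimately show "F z \<noteq> 0 \<and> abs_cp2 (F z) = f z" by simp
  qed
qed

section \<open>The Poincare distance in terms of Moebius maps\<close>

lemma poincare_dist_Moebius:
  assumes "a \<in> unit_disc" "b \<in> unit_disc"
  obtains t where "norm t < 1" "t = Moebius_function 0 a b" "poincare_dist a b = 2 * artanh (norm t)"
proof -
  define t where "t = Moebius_function 0 a b"
  have "norm t < 1" unfolding t_def using assms by (intro Moebius_function_norm_lt_1) auto
  moreover have "poincare_dist a b = 2 * artanh (norm t)"
    by (simp add: poincare_dist_def t_def Moebius_function_simple norm_divide norm_minus_commute)
  ultimately show thesis using that t_def by blast
qed

lemma artanh_ge_half: "0 \<le> x \<Longrightarrow> x < 1 \<Longrightarrow> x \<le> 2 * artanh x" for x :: real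
proof -
  assume x: "0 \<le> x" "x < 1"
  have "x \<le> - ln (1 - x)" using ln_le_minus_one[of "1 - x"] x by simp
  also have "\<dots> \<le> ln (1 + x) - ln (1 - x)" using x by simp
  also have "\<dots> = 2 * artanh x" using x by (simp add: artanh_def ln_div)
  finally show ?thesis .
qed

lemma artanh_le: "0 \<le> x \<Longrightarrow> x \<le> 1/2 \<Longrightarrow> 2 * artanh x \<le> 4 * x" for x :: real
proof -
  assume x: "0 \<le> x" "x \<le> 1/2"
  have "2 * artanh x = ln ((1 + x) / (1 - x))" using x by (simp add: artanh_def)
  also have "\<dots> \<le> (1 + x) / (1 - x) - 1" using x by (intro ln_le_minus_one) auto
  also have "\<dots> = 2 * x / (1 - x)" using x by (simp add: field_simps)
  also have "\<dots> \<le> 2 * x / (1/2)" using x by (intro divide_left_mono) auto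
  finally show ?thesis by simp
qed

lemma poincare_dist_nonneg:
  assumes "a \<in> unit_disc" "b \<in> unit_disc"
  shows "0 \<le> poincare_dist a b"
proof -
  obtain t :: complex where "norm t < 1" "poincare_dist a b = 2 * artanh (norm t)"
    by (rule poincare_dist_Moebius[OF assms])
  then show ?thesis using artanh_ge_half[of "norm t"] norm_ge_zero[of t] by linarith
qed

lemma poincare_dist_commute: "poincare_dist a b = poincare_dist b a"
proof -
  have "norm (1 - cnj a * b) = norm (1 - cnj b * a)"
    by (metis complex_cnj_cnj complex_cnj_diff complex_cnj_mult complex_cnj_one complex_mod_cnj mult.commute)
  then show ?thesis by (simp add: poincare_dist_def norm_divide norm_minus_commute)
qed

section \<open>Chains of discs\<close>

lemma chain_lengthsI:
  assumes "0 < n" "x 0 = p" "x n = q"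
    "\<And>i. i < n \<Longrightarrow> holomorphic_disc X (f i) \<and> a i \<in> unit_disc \<and> b i \<in> unit_disc \<and>
        f i (a i) = x i \<and> f i (b i) = x (Suc i)"
  shows "(\<Sum>i<n. poincare_dist (a i) (b i)) \<in> kobayashi_chain_lengths X p q"
  using assms unfolding kobayashi_chain_lengths_def by blast

lemma chain_lengthsE:
  assumes "s \<in> kobayashi_chain_lengths X p q"
  obtains n x f a b where "s = (\<Sum>i<n. poincare_dist (a i) (b i))" "0 < n" "x 0 = p" "x n = q"
    "\<And>i. i < n \<Longrightarrow> holomorphic_disc X (f i)" "\<And>i. i < n \<Longrightarrow> a i \<in> unit_disc"
    "\<And>i. i < n \<Longrightarrow> b i \<in> unit_disc" "\<And>i. i < n \<Longrightarrow> f i (a i) = x i" "\<And>i. i < n \<Longrightarrow> f i (b i) = x (Suc i)"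
  using assms unfolding kobayashi_chain_lengths_def by blast

lemma chain_single:
  assumes "holomorphic_disc X f" "a \<in> unit_disc" "b \<in> unit_disc"
  shows "poincare_dist a b \<in> kobayashi_chain_lengths X (f a) (f b)"
  using chain_lengthsI[of 1 "\<lambda>i. if i = 0 then f a else f b" "f a" "f b" X "\<lambda>_. f" "\<lambda>_. a" "\<lambda>_. b"] assms
  by simp

lemma sum_lessThan_add:
  fixes g :: "nat \<Rightarrow> real"
  shows "(\<Sum>i<n+m. g i) = (\<Sum>i<n. g i) + (\<Sum>i<m. g (n + i))"
  by (induction m) auto

lemma chain_append:
  assumes "s \<in> kobayashi_chain_lengths X p q" "s' \<in> kobayashi_chain_lengths X q r"
  shows "s + s' \<in> kobayashi_chain_lengths X p r"
proof -
  obtain n x f a b where 1: "s = (\<Sum>i<n. poincare_dist (a i) (b i))" "0 < n" "x 0 = p" "x n = q"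
    "\<And>i. i < n \<Longrightarrow> holomorphic_disc X (f i)" "\<And>i. i < n \<Longrightarrow> a i \<in> unit_disc"
    "\<And>i. i < n \<Longrightarrow> b i \<in> unit_disc" "\<And>i. i < n \<Longrightarrow> f i (a i) = x i" "\<And>i. i < n \<Longrightarrow> f i (b i) = x (Suc i)"
    using assms(1) by (rule chain_lengthsE) blast
  obtain n' x' f' a' b' where 2: "s' = (\<Sum>i<n'. poincare_dist (a' i) (b' i))" "0 < n'" "x' 0 = q" "x' n' = r"
    "\<And>i. i < n' \<Longrightarrow> holomorphic_disc X (f' i)" "\<And>i. i < n' \<Longrightarrow> a' i \<in> unit_disc"
    "\<And>i. i < n' \<Longrightarrow> b' i \<in> unit_disc" "\<And>i. i < n' \<Longrightarrow> f' i (a' i) = x' i" "\<And>i. i < n' \<Longrightarrow> f' i (b' i) = x' (Suc i)"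
    using assms(2) by (rule chain_lengthsE) blast
  define A where "A i = (if i < n then a i else a' (i - n))" for i
  define B where "B i = (if i < n then b i else b' (i - n))" for i
  define G where "G i = (if i < n then f i else f' (i - n))" for i
  define Y where "Y i = (if i < n then x i else x' (i - n))" for i
  have "(\<Sum>i<n+n'. poincare_dist (A i) (B i)) \<in> kobayashi_chain_lengths X p r"
  proof (rule chain_lengthsI)
    show "0 < n + n'" "Y 0 = p" "Y (n + n') = r" using 1 2 by (auto simp: Y_def)
    fix i assume i: "i < n + n'"
    show "holomorphic_disc X (G i) \<and> A i \<in> unit_disc \<and> B i \<in> unit_disc \<and> G i (A i) = Y i \<and> G i (B i) = Y (Suc i)"
    proof (cases "i < n")
      case True
      \<comment> \<open>At the junction \<open>Suc i = n\<close> the point is already taken from the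
        second chain; both chains have \<open>q\<close> there.\<close>
      then have "Y (Suc i) = x (Suc i)"
        using 1(4) 2(3) by (cases "Suc i < n") (auto simp: Y_def less_Suc_eq not_less_iff_gr_or_eq)
      then show ?thesis using 1(5-)[OF True] True by (auto simp: A_def B_def G_def Y_def)
    next
      case False
      then have "i - n < n'" "Suc i - n = Suc (i - n)" using i by auto
      then show ?thesis using 2(5-)[of "i - n"] False by (auto simp: A_def B_def G_def Y_def)
    qed
  qed
  moreover have "(\<Sum>i<n+n'. poincare_dist (A i) (B i)) = s + s'"
    unfolding sum_lessThan_add 1(1) 2(1) by (simp add: A_def B_def)
  ultimately show ?thesis by simp
qed

lemma chain_reverse:
  assumes "s \<in> kobayashi_chain_lengths X p q"
  shows "s \<in> kobayashi_chain_lengths X q p"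
proof -
  obtain n x f a b where 1: "s = (\<Sum>i<n. poincare_dist (a i) (b i))" "0 < n" "x 0 = p" "x n = q"
    "\<And>i. i < n \<Longrightarrow> holomorphic_disc X (f i)" "\<And>i. i < n \<Longrightarrow> a i \<in> unit_disc"
    "\<And>i. i < n \<Longrightarrow> b i \<in> unit_disc" "\<And>i. i < n \<Longrightarrow> f i (a i) = x i" "\<And>i. i < n \<Longrightarrow> f i (b i) = x (Suc i)"
    using assms by (rule chain_lengthsE) blast
  have "(\<Sum>i<n. poincare_dist (b (n - Suc i)) (a (n - Suc i))) \<in> kobayashi_chain_lengths X q p"
  proof (rule chain_lengthsI[where x = "\<lambda>i. x (n - i)" and f = "\<lambda>i. f (n - Suc i)"])
    fix i assume i: "i < n"
    then have "n - Suc i < n" "Suc (n - Suc i) = n - i" by auto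
    then show "holomorphic_disc X (f (n - Suc i)) \<and> b (n - Suc i) \<in> unit_disc \<and> a (n - Suc i) \<in> unit_disc \<and>
        f (n - Suc i) (b (n - Suc i)) = x (n - i) \<and> f (n - Suc i) (a (n - Suc i)) = x (n - Suc i)"
      using 1(5-)[of "n - Suc i"] by simp
  qed (use 1 in auto)
  also have "(\<Sum>i<n. poincare_dist (b (n - Suc i)) (a (n - Suc i))) = (\<Sum>i<n. poincare_dist (b i) (a i))"
    by (rule sum.nat_diff_reindex)
  also have "\<dots> = s" by (simp add: 1(1) poincare_dist_commute)
  finally show ?thesis .
qed

lemma chain_length_nonneg: "s \<in> kobayashi_chain_lengths X p q \<Longrightarrow> 0 \<le> s"
  by (erule chain_lengthsE) (auto intro!: sum_nonneg poincare_dist_nonneg)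

text \<open>Each disc in a chain of total length below \<epsilon> contributes less than \<epsilon>,
  so a Lipschitz bound for nearby points of one disc is enough.\<close>

lemma chain_lipschitz:
  fixes \<psi> :: "cp2 \<Rightarrow> 'a::real_normed_vector"
  assumes lip: "\<And>f \<alpha> \<beta>. holomorphic_disc X f \<Longrightarrow> \<alpha> \<in> unit_disc \<Longrightarrow> \<beta> \<in> unit_disc \<Longrightarrow> poincare_dist \<alpha> \<beta> < \<epsilon> \<Longrightarrow>
      norm (\<psi> (f \<beta>) - \<psi> (f \<alpha>)) \<le> K * poincare_dist \<alpha> \<beta>"
    and s: "s \<in> kobayashi_chain_lengths X p q" "s < \<epsilon>"
  shows "norm (\<psi> q - \<psi> p) \<le> K * s"
proof -
  obtain n x f a b where 1: "s = (\<Sum>i<n. poincare_dist (a i) (b i))" "0 < n" "x 0 = p" "x n = q"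
    "\<And>i. i < n \<Longrightarrow> holomorphic_disc X (f i)" "\<And>i. i < n \<Longrightarrow> a i \<in> unit_disc"
    "\<And>i. i < n \<Longrightarrow> b i \<in> unit_disc" "\<And>i. i < n \<Longrightarrow> f i (a i) = x i" "\<And>i. i < n \<Longrightarrow> f i (b i) = x (Suc i)"
    using s(1) by (rule chain_lengthsE) blast
  have step: "norm (\<psi> (x (Suc i)) - \<psi> (x i)) \<le> K * poincare_dist (a i) (b i)" if i: "i < n" for i
  proof -
    have "poincare_dist (a i) (b i) \<le> (\<Sum>i<n. poincare_dist (a i) (b i))"
      using i 1(6,7) by (intro member_le_sum) (auto intro!: poincare_dist_nonneg)
    then have "poincare_dist (a i) (b i) < \<epsilon>" using s(2) 1(1) by simp
    from lip[OF 1(5,6,7)[OF i] this] show ?thesis using 1(8,9)[OF i] by simp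
  qed
  have "norm (\<psi> (x m) - \<psi> (x 0)) \<le> K * (\<Sum>i<m. poincare_dist (a i) (b i))" if "m \<le> n" for m
    using that
  proof (induction m)
    case (Suc m)
    have "norm (\<psi> (x (Suc m)) - \<psi> (x 0)) \<le> norm (\<psi> (x (Suc m)) - \<psi> (x m)) + norm (\<psi> (x m) - \<psi> (x 0))"
      using norm_triangle_ineq[of "\<psi> (x (Suc m)) - \<psi> (x m)" "\<psi> (x m) - \<psi> (x 0)"] by simp
    then show ?case using Suc step[of m] by (simp add: algebra_simps)
  qed simp
  from this[of n] show ?thesis using 1 by simp
qed

lemma disc_through_nearby:
  fixes v w :: "complex^3"
  assumes ball: "\<And>u. u \<in> ball v \<epsilon> \<Longrightarrow> u \<noteq> 0 \<and> abs_cp2 u \<in> X" and w: "w \<in> ball v \<epsilon>"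
  shows "2 * artanh (norm (w - v) / \<epsilon>) \<in> kobayashi_chain_lengths X (abs_cp2 v) (abs_cp2 w)"
proof -
  have \<epsilon>: "\<epsilon> > 0" using w by (meson dist_not_less_zero mem_ball order_le_less_trans not_le)
  define s where "s = norm (w - v) / \<epsilon>"
  \<comment> \<open>\<open>w - v\<close> stretched to length \<epsilon>, so that the affine disc
    \<open>v + z *s d\<close> stays in the ball and meets \<open>w\<close> at \<open>s\<close>. For
    \<open>w = v\<close> division by zero makes \<open>d\<close> equal to \<open>0\<close>, which
    also serves.\<close>
  define d where "d = of_real (\<epsilon> / norm (w - v)) *s (w - v)"
  have "norm d = \<bar>\<epsilon> / norm (w - v)\<bar> * norm (w - v)" unfolding d_def norm_cscale norm_of_real ..
  then have nd: "norm d \<le> \<epsilon>" using \<epsilon> by (cases "w = v") auto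
  have s: "0 \<le> s" "s < 1" using w \<epsilon> by (auto simp: s_def dist_norm norm_minus_commute)
  have sd: "of_real s *s d = w - v"
  proof (cases "w = v")
    case False
    then have "complex_of_real s * of_real (\<epsilon> / norm (w - v)) = 1"
      using \<epsilon> by (simp add: s_def flip: of_real_mult)
    then show ?thesis by (simp add: d_def vector_smult_assoc)
  qed (simp add: d_def)
  define F where "F z = v + z *s d" for z
  have inb: "F z \<in> ball v \<epsilon>" if "z \<in> ball 0 1" for z
  proof -
    have "norm (z *s d) \<le> norm z * \<epsilon>" using nd by (simp add: norm_cscale mult_left_mono)
    also have "\<dots> < 1 * \<epsilon>" using that \<epsilon> by (intro mult_strict_right_mono) auto
    finally show ?thesis by (simp add: F_def dist_norm)
  qed
  have "holomorphic_disc X (\<lambda>z. abs_cp2 (F z))"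
  proof (rule holomorphic_disc_abs)
    show "(\<lambda>z. F z $ k) holomorphic_on ball 0 1" for k
      by (simp add: F_def) (intro holomorphic_intros)
  qed (use ball[OF inb] in auto)
  from chain_single[OF this, of 0 "of_real s"] s
  have "poincare_dist 0 (of_real s) \<in> kobayashi_chain_lengths X (abs_cp2 (F 0)) (abs_cp2 (F (of_real s)))" by simp
  moreover have "F 0 = v" "F (of_real s) = w" using sd by (simp_all add: F_def)
  moreover have "poincare_dist 0 (of_real s) = 2 * artanh s" using s by (simp add: poincare_dist_def)
  ultimately show ?thesis by (simp add: s_def)
qed

lemma open_cp2_ball:
  assumes "open X" "v \<noteq> 0" "abs_cp2 v \<in> X"
  obtains \<epsilon> where "\<epsilon> > 0" "\<And>u. u \<in> ball v \<epsilon> \<Longrightarrow> u \<noteq> 0 \<and> abs_cp2 u \<in> X"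
proof -
  have "open {v. v \<noteq> 0 \<and> abs_cp2 v \<in> X}" using assms(1) by (simp add: open_cp2_def)
  moreover have "v \<in> {v. v \<noteq> 0 \<and> abs_cp2 v \<in> X}" using assms by simp
  ultimately obtain \<epsilon> where "\<epsilon> > 0" "ball v \<epsilon> \<subseteq> {v. v \<noteq> 0 \<and> abs_cp2 v \<in> X}"
    by (meson open_contains_ball)
  then show thesis by (intro that[of \<epsilon>]) blast+
qed

text \<open>Being joined by a chain is an equivalence relation with open classes. This gives meaning
  to the \<open>Inf\<close> in \<open>kobayashi_dist\<close>.\<close>

lemma chain_lengths_nonempty:
  assumes X: "open X" "connected X" and pq: "p \<in> X" "q \<in> X"
  shows "kobayashi_chain_lengths X p q \<noteq> {}"
proof (rule connected_equivalence_relation[OF X(2) pq, of "\<lambda>p q. kobayashi_chain_lengths X p q \<noteq> {}"])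
  show "kobayashi_chain_lengths X y x \<noteq> {}" if "kobayashi_chain_lengths X x y \<noteq> {}" for x y
    using that chain_reverse by blast
  show "kobayashi_chain_lengths X x z \<noteq> {}"
    if "kobayashi_chain_lengths X x y \<noteq> {}" "kobayashi_chain_lengths X y z \<noteq> {}" for x y z
    using that chain_append by blast
  fix a assume a: "a \<in> X"
  obtain v where v: "v \<noteq> 0" "a = abs_cp2 v" by (rule cp2_cases)
  then obtain \<epsilon> where \<epsilon>: "\<epsilon> > 0" "\<And>u. u \<in> ball v \<epsilon> \<Longrightarrow> u \<noteq> 0 \<and> abs_cp2 u \<in> X"
    using open_cp2_ball[OF X(1), of v] a by metis
  show "\<exists>T. openin (top_of_set X) T \<and> a \<in> T \<and> (\<forall>x\<in>T. kobayashi_chain_lengths X a x \<noteq> {})"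
  proof (intro exI[of _ "abs_cp2 ` ball v \<epsilon>"] conjI ballI)
    have "open (abs_cp2 ` ball v \<epsilon>)" by (rule open_abs_cp2_image[OF open_ball]) (use \<epsilon>(2) in blast)
    then show "openin (top_of_set X) (abs_cp2 ` ball v \<epsilon>)"
      using \<epsilon>(2) by (subst openin_open_eq[OF X(1)]) auto
    show "a \<in> abs_cp2 ` ball v \<epsilon>" using v \<epsilon> by auto
    show "kobayashi_chain_lengths X a x \<noteq> {}" if "x \<in> abs_cp2 ` ball v \<epsilon>" for x
      using that disc_through_nearby[OF \<epsilon>(2)] v by blast
  qed
qed

section \<open>The infimum over chains as a metric\<close>

lemma kobayashi_dist_le:
  assumes "s \<in> kobayashi_chain_lengths X p q" "p \<in> X" "q \<in> X"
  shows "kobayashi_dist X p q \<le> s"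
proof -
  have "bdd_below (kobayashi_chain_lengths X p q)" using chain_length_nonneg by (meson bdd_belowI)
  then show ?thesis using assms by (simp add: kobayashi_dist_def cInf_lower)
qed

lemma kobayashi_dist_greatest:
  assumes "open X" "connected X" "p \<in> X" "q \<in> X"
    "\<And>s. s \<in> kobayashi_chain_lengths X p q \<Longrightarrow> c \<le> s"
  shows "c \<le> kobayashi_dist X p q"
  using assms chain_lengths_nonempty[OF assms(1-4)] by (simp add: kobayashi_dist_def cInf_greatest)

lemma kobayashi_dist_lessE:
  assumes "open X" "connected X" "p \<in> X" "q \<in> X" "kobayashi_dist X p q < c"
  obtains s where "s \<in> kobayashi_chain_lengths X p q" "s < c"
  using assms chain_lengths_nonempty[OF assms(1-4)] cInf_lessD[of "kobayashi_chain_lengths X p q" c]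
  by (auto simp: kobayashi_dist_def)

lemma kobayashi_Metric_space:
  assumes X: "open X" "connected X"
    and sep: "\<And>p q. p \<in> X \<Longrightarrow> q \<in> X \<Longrightarrow> kobayashi_dist X p q = 0 \<Longrightarrow> p = q"
  shows "Metric_space X (kobayashi_dist X)"
proof
  show nn: "0 \<le> kobayashi_dist X x y" for x y
    using kobayashi_dist_greatest[OF X, of x y 0] chain_length_nonneg
    by (cases "x \<in> X \<and> y \<in> X") (auto simp: kobayashi_dist_def)
  have "kobayashi_chain_lengths X x y = kobayashi_chain_lengths X y x" for x y
    using chain_reverse by blast
  then show "kobayashi_dist X x y = kobayashi_dist X y x" for x y
    by (simp add: kobayashi_dist_def)
  show "kobayashi_dist X x y = 0 \<longleftrightarrow> x = y" if xy: "x \<in> X" "y \<in> X" for x y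
  proof
    assume "x = y"
    obtain v where v: "v \<noteq> 0" "x = abs_cp2 v" by (rule cp2_cases)
    have "holomorphic_disc X (\<lambda>z. abs_cp2 v)"
      by (rule holomorphic_disc_abs) (use v xy in auto)
    from chain_single[OF this, of 0 0] have "0 \<in> kobayashi_chain_lengths X x y"
      using v \<open>x = y\<close> by (simp add: poincare_dist_def)
    from kobayashi_dist_le[OF this xy] nn[of x y] show "kobayashi_dist X x y = 0" by simp
  qed (use sep xy in auto)
  show "kobayashi_dist X x z \<le> kobayashi_dist X x y + kobayashi_dist X y z"
    if xyz: "x \<in> X" "y \<in> X" "z \<in> X" for x y z
  proof (rule field_le_epsilon)
    fix e :: real assume "e > 0"
    then have "kobayashi_dist X x y < kobayashi_dist X x y + e / 2"
      "kobayashi_dist X y z < kobayashi_dist X y z + e / 2" by auto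
    then obtain s t where "s \<in> kobayashi_chain_lengths X x y" "s < kobayashi_dist X x y + e / 2"
      "t \<in> kobayashi_chain_lengths X y z" "t < kobayashi_dist X y z + e / 2"
      using kobayashi_dist_lessE[OF X] xyz by metis
    then show "kobayashi_dist X x z \<le> kobayashi_dist X x y + kobayashi_dist X y z + e"
      using kobayashi_dist_le[OF chain_append xyz(1,3), of s y t] by simp
  qed
qed

lemma kobayashi_dist_tendsto:
  assumes X: "open X" and v: "v \<noteq> 0" "abs_cp2 v \<in> X" and u: "u \<longlonglongrightarrow> v" "\<And>n. abs_cp2 (u n) \<in> X"
    and nonneg: "\<And>p q. 0 \<le> kobayashi_dist X p q"
  shows "(\<lambda>n. kobayashi_dist X (abs_cp2 v) (abs_cp2 (u n))) \<longlonglongrightarrow> 0"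
proof -
  obtain \<epsilon> where \<epsilon>: "\<epsilon> > 0" "\<And>u. u \<in> ball v \<epsilon> \<Longrightarrow> u \<noteq> 0 \<and> abs_cp2 u \<in> X"
    by (rule open_cp2_ball[OF X v]) blast
  have "(\<lambda>n. 4 * (norm (u n - v) / \<epsilon>)) \<longlonglongrightarrow> 4 * (0 / \<epsilon>)"
    by (intro tendsto_intros tendsto_norm_zero) (use u(1) \<epsilon>(1) in \<open>auto simp: LIM_zero_iff\<close>)
  then have lim: "(\<lambda>n. 4 * (norm (u n - v) / \<epsilon>)) \<longlonglongrightarrow> 0" by simp
  \<comment> \<open>Half the radius keeps the argument of \<open>artanh\<close> at most
    \<open>1/2\<close>, the range of the linear bound \<open>artanh_le\<close>.\<close>
  have "\<forall>\<^sub>F n in sequentially. dist (u n) v < \<epsilon> / 2"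
    using u(1) \<epsilon>(1) by (intro tendstoD) auto
  then have "\<forall>\<^sub>F n in sequentially. kobayashi_dist X (abs_cp2 v) (abs_cp2 (u n)) \<le> 4 * (norm (u n - v) / \<epsilon>)"
  proof eventually_elim
    case (elim n)
    then have "u n \<in> ball v \<epsilon>" using \<epsilon>(1) by (simp add: dist_commute)
    from kobayashi_dist_le[OF disc_through_nearby[OF \<epsilon>(2) this] v(2) u(2)]
    have "kobayashi_dist X (abs_cp2 v) (abs_cp2 (u n)) \<le> 2 * artanh (norm (u n - v) / \<epsilon>)" .
    also have "\<dots> \<le> 4 * (norm (u n - v) / \<epsilon>)"
      using elim \<epsilon>(1) by (intro artanh_le) (auto simp: dist_norm field_simps)
    finally show ?case .
  qed
  then show ?thesis
    by (intro tendsto_sandwich[OF _ _ tendsto_const lim]) (auto simp: nonneg)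
qed

section \<open>Functions on the plane that detect points and lines\<close>

lemma continuous_on_cp2I:
  assumes "continuous_on (- {0}) (\<lambda>v. f (abs_cp2 v))"
  shows "continuous_on UNIV f"
proof -
  have "open (f -` B)" if "open B" for B
  proof -
    have "open ((\<lambda>v. f (abs_cp2 v)) -` B \<inter> - {0})"
      using assms that continuous_on_open_vimage[of "- {0}" "\<lambda>v. f (abs_cp2 v)"] by (simp add: open_Compl)
    moreover have "(\<lambda>v. f (abs_cp2 v)) -` B \<inter> - {0} = {v. v \<noteq> 0 \<and> abs_cp2 v \<in> f -` B}" by auto
    ultimately show ?thesis by (simp add: open_cp2_def)
  qed
  then show ?thesis by (simp add: continuous_on_open_vimage)
qed

text \<open>The entries of the orthogonal projection onto the complex line of representatives; they
  separate points, which makes a metric on \<open>cp2\<close> unnecessary.\<close>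

lift_definition segre :: "3 \<Rightarrow> 3 \<Rightarrow> cp2 \<Rightarrow> complex" is
  "\<lambda>k l v. v $ k * cnj (v $ l) / of_real ((norm v)\<^sup>2)"
proof -
  fix k l :: 3 and v w assume "proj_rel v w"
  then obtain c where c: "c \<noteq> 0" "w = c *s v" by (auto simp: proj_rel_def)
  have "w $ k * cnj (w $ l) = c * cnj c * (v $ k * cnj (v $ l))"
    by (simp add: c(2) mult_ac)
  then have "w $ k * cnj (w $ l) = of_real ((norm c)\<^sup>2) * (v $ k * cnj (v $ l))"
    by (simp only: complex_norm_square)
  moreover have "of_real ((norm w)\<^sup>2) = (of_real ((norm c)\<^sup>2) * of_real ((norm v)\<^sup>2) :: complex)"
    by (simp add: c(2) norm_cscale power_mult_distrib)
  ultimately show "v $ k * cnj (v $ l) / of_real ((norm v)\<^sup>2) = w $ k * cnj (w $ l) / of_real ((norm w)\<^sup>2)"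
    using c(1) by simp
qed

lemma segre_abs: "v \<noteq> 0 \<Longrightarrow> segre k l (abs_cp2 v) = v $ k * cnj (v $ l) / of_real ((norm v)\<^sup>2)"
  by (rule segre.abs_eq) (rule proj_rel_refl)

text \<open>Up to the factor \<open>norm a\<close>, for nonzero \<open>a\<close> this is the sine of
  the Fubini-Study distance from the point to the line of \<open>a\<close>.\<close>

lift_definition line_dist :: "complex^3 \<Rightarrow> cp2 \<Rightarrow> real" is "\<lambda>a v. norm (lin a v) / norm v"
  by (auto simp: proj_rel_def lin_scale norm_cscale norm_mult)

lemma line_dist_abs: "v \<noteq> 0 \<Longrightarrow> line_dist a (abs_cp2 v) = norm (lin a v) / norm v"
  by (rule line_dist.abs_eq) (rule proj_rel_refl)

lemma continuous_on_segre: "continuous_on UNIV (segre k l)"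
proof (rule continuous_on_cp2I)
  have "continuous_on (- {0}) (\<lambda>v :: complex^3. v $ k * cnj (v $ l) / of_real ((norm v)\<^sup>2))"
    by (intro continuous_intros) auto
  then show "continuous_on (- {0}) (\<lambda>v. segre k l (abs_cp2 v))"
    by (rule continuous_on_eq) (auto simp: segre_abs)
qed

text \<open>Each column of the projection matrix is a multiple of the representative, and a column
  \<open>l\<close> with \<open>w $ l\<close> nonzero recovers it up to scaling.\<close>

lemma segre_separates:
  assumes eq: "\<And>k l. segre k l p = segre k l q"
  shows "p = q"
proof -
  obtain v where v: "v \<noteq> 0" "p = abs_cp2 v" by (rule cp2_cases)
  obtain w where w: "w \<noteq> 0" "q = abs_cp2 w" by (rule cp2_cases)
  obtain l where l: "w $ l \<noteq> 0" using w(1) by (metis vec_eq_iff zero_index)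
  define c where "c = cnj (v $ l) * of_real ((norm w)\<^sup>2) / (of_real ((norm v)\<^sup>2) * cnj (w $ l))"
  have "w $ k = c * v $ k" for k
  proof -
    have "v $ k * cnj (v $ l) / of_real ((norm v)\<^sup>2) = w $ k * cnj (w $ l) / of_real ((norm w)\<^sup>2)"
      using eq[of k l] v w by (simp add: segre_abs)
    then show ?thesis using l v w by (simp add: c_def field_simps)
  qed
  then have wc: "w = c *s v" by (simp add: vec_eq_iff)
  then have "c \<noteq> 0" using w by auto
  with wc show ?thesis using abs_cp2_eq_iff[of v w] v w by blast
qed

lemma norm_segre_le: "norm (segre k l p) \<le> 1"
proof -
  obtain v where v: "v \<noteq> 0" "p = abs_cp2 v" by (rule cp2_cases)
  have "norm (v $ k) * norm (v $ l) \<le> norm v * norm v"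
    by (intro mult_mono Finite_Cartesian_Product.norm_nth_le) auto
  then show ?thesis using v by (simp add: segre_abs norm_divide norm_mult divide_le_eq power2_eq_square)
qed

text \<open>Passing to unit vectors costs a factor \<open>2\<close>, and the product of two
  components of unit vectors costs another \<open>2\<close>.\<close>

lemma segre_lipschitz:
  assumes "v \<noteq> 0" "w \<noteq> 0"
  shows "norm (segre k l (abs_cp2 w) - segre k l (abs_cp2 v)) \<le> 4 * norm (w - v) / norm v"
proof -
  define x where "x = of_real (inverse (norm w)) *s w"
  define y where "y = of_real (inverse (norm v)) *s v"
  have nx: "norm x = 1" and ny: "norm y = 1" using assms by (simp_all add: x_def y_def norm_cscale norm_inverse)
  have sx: "segre k l (abs_cp2 w) = x $ k * cnj (x $ l)" and sy: "segre k l (abs_cp2 v) = y $ k * cnj (y $ l)"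
    using assms by (simp_all add: segre_abs x_def y_def field_simps power2_eq_square)
  have comp: "norm (u $ i) \<le> norm u" for u :: "complex^3" and i by (rule Finite_Cartesian_Product.norm_nth_le)
  have "norm (x - y) \<le> 2 * norm (w - v) / norm v"
  proof -
    have "x - y = of_real (inverse (norm w) - inverse (norm v)) *s w + of_real (inverse (norm v)) *s (w - v)"
      by (simp add: x_def y_def vec_eq_iff algebra_simps)
    then have "norm (x - y) \<le> \<bar>inverse (norm w) - inverse (norm v)\<bar> * norm w + \<bar>inverse (norm v)\<bar> * norm (w - v)"
      by (metis norm_triangle_ineq norm_cscale norm_of_real)
    also have "\<bar>inverse (norm w) - inverse (norm v)\<bar> * norm w = \<bar>norm v - norm w\<bar> / norm v"
    proof -
      have "inverse (norm w) - inverse (norm v) = (norm v - norm w) / (norm w * norm v)"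
        using assms by (simp add: field_simps)
      then show ?thesis using assms by (simp add: abs_mult)
    qed
    also have "\<bar>norm v - norm w\<bar> / norm v \<le> norm (w - v) / norm v"
      by (intro divide_right_mono) (metis norm_minus_commute norm_triangle_ineq3, simp)
    finally show ?thesis using assms by (simp add: field_simps)
  qed
  moreover have "norm (x $ k * cnj (x $ l) - y $ k * cnj (y $ l)) \<le> 2 * norm (x - y)"
  proof -
    have "x $ k * cnj (x $ l) - y $ k * cnj (y $ l) = (x - y) $ k * cnj (x $ l) + y $ k * cnj ((x - y) $ l)"
      by (simp add: algebra_simps)
    then have "norm (x $ k * cnj (x $ l) - y $ k * cnj (y $ l))
        \<le> norm ((x - y) $ k) * norm (x $ l) + norm (y $ k) * norm ((x - y) $ l)"
      by (metis norm_triangle_ineq norm_mult complex_mod_cnj)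
    also have "\<dots> \<le> norm (x - y) * 1 + 1 * norm (x - y)"
      using comp[of x l] comp[of y k] nx ny
      by (intro add_mono mult_mono comp) auto
    finally show ?thesis by simp
  qed
  ultimately show ?thesis by (simp add: sx sy)
qed

section \<open>Normal forms of discs and their Lipschitz estimates\<close>

lemma holomorphic_lipschitz_at_0:
  assumes hol: "h holomorphic_on ball 0 R" and B: "\<And>z. z \<in> ball 0 R \<Longrightarrow> norm (h z) \<le> B" "B > 0"
    and z: "z \<in> ball 0 R"
  shows "norm (h z - h 0) \<le> 3 * B / R * norm z"
proof -
  have R: "R > 0" using z by (metis mem_ball_0 norm_ge_zero order_le_less_trans)
  \<comment> \<open>The difference is bounded by \<open>2 * B\<close>; dividing by
    \<open>3 * B\<close> produces the strict inequality in the Schwarz lemma.\<close>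
  define f where "f = (\<lambda>\<zeta>. (h (of_real R * \<zeta>) - h 0) / of_real (3 * B))"
  have inb: "of_real R * \<zeta> \<in> ball 0 R" if "norm \<zeta> < 1" for \<zeta> :: complex
    using that R by (simp add: norm_mult)
  have "(h \<circ> (\<lambda>\<zeta>. of_real R * \<zeta>)) holomorphic_on ball 0 1"
    by (rule holomorphic_on_compose_gen[OF _ hol]) (use inb in \<open>auto intro!: holomorphic_intros\<close>)
  then have holf: "f holomorphic_on ball 0 1"
    unfolding f_def o_def using B(2) by (intro holomorphic_intros) auto
  have "norm (f (z / of_real R)) \<le> norm (z / of_real R)"
  proof (rule Schwarz_Lemma(1)[OF holf])
    show "norm (f \<zeta>) < 1" if "norm \<zeta> < 1" for \<zeta>
    proof -
      have "norm (h (of_real R * \<zeta>) - h 0) \<le> B + B"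
        by (rule order_trans[OF norm_triangle_ineq4]) (use B(1)[OF inb[OF that]] B(1)[of 0] R in auto)
      then show ?thesis using B(2) by (simp add: f_def norm_divide)
    qed
    show "norm (z / of_real R) < 1" using z R by (simp add: norm_divide)
  qed (simp add: f_def)
  then show ?thesis using R B(2) by (simp add: f_def norm_divide field_simps)
qed

lemma norm_le_sum_components: "norm v \<le> (\<Sum>k\<in>UNIV. norm (v $ k))" for v :: "complex^3"
  unfolding norm_vec_def by (rule L2_set_le_sum) simp

text \<open>The bounds that a lift acquires when divided by the form that dominates it in
  \<open>Green_normality\<close>. The norm stays between \<open>1 / C\<close> and \<open>C\<close>,
  so estimates for the lift carry over to homogeneous functions of degree \<open>0\<close>.\<close>

definition normal_lift :: "(nat \<Rightarrow> complex^3) \<Rightarrow> real \<Rightarrow> (complex \<Rightarrow> complex^3) \<Rightarrow> bool" where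
  "normal_lift a C W \<longleftrightarrow> (\<forall>k. (\<lambda>z. W z $ k) holomorphic_on ball 0 (1/16)) \<and>
      (\<forall>z\<in>ball 0 (1/16). W z \<noteq> 0 \<and> norm (W z) \<le> C \<and> 1 \<le> C * norm (W z) \<and>
        norm (W z - W 0) \<le> C * norm z \<and> (\<forall>i\<le>4. lin (a i) (W z) \<noteq> 0))"

text \<open>A Moebius map recentres the disc at \<alpha> and moves \<beta> to \<open>t\<close>; then
  \<open>Green_normality\<close> applies. The claim about \<open>f \<beta>\<close> is limited to
  small \<open>t\<close> because the lift is controlled on the smaller disc only. The constant is
  chosen before \<open>X\<close> and the disc.\<close>

lemma disc_normal_form:
  assumes a: "general_forms a"
  obtains C where "C \<ge> 1" "\<And>X f \<alpha> \<beta>. holomorphic_disc X f \<Longrightarrow> (\<forall>i\<le>4. X \<inter> form_line (a i) = {}) \<Longrightarrow>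
    \<alpha> \<in> unit_disc \<Longrightarrow> \<beta> \<in> unit_disc \<Longrightarrow>
    \<exists>W t. norm t < 1 \<and> poincare_dist \<alpha> \<beta> = 2 * artanh (norm t) \<and>
      normal_lift a C W \<and>
      abs_cp2 (W 0) = f \<alpha> \<and> (norm t < 1/16 \<longrightarrow> abs_cp2 (W t) = f \<beta>)"
proof -
  obtain C where C: "C > 0" and green:
    "\<And>F. (\<And>k. (\<lambda>z. F z $ k) holomorphic_on ball 0 1) \<Longrightarrow>
      (\<And>z i. z \<in> ball 0 1 \<Longrightarrow> i \<le> 4 \<Longrightarrow> lin (a i) (F z) \<noteq> 0) \<Longrightarrow>
      \<exists>i\<le>4. \<forall>z\<in>ball 0 (1/16). norm (F z) \<le> C * norm (lin (a i) (F z))"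
    by (rule Green_normality[OF a]) blast
  obtain \<kappa> where \<kappa>: "\<kappa> \<ge> 1" "\<And>i v. i \<le> 4 \<Longrightarrow> norm (lin (a i) v) \<le> \<kappa> * norm v"
    by (rule general_forms_coercive[OF a]) blast
  \<comment> \<open>Each of three coordinates has Lipschitz constant
    \<open>3 * C / (1/16) = 48 * C\<close>, which adds up to \<open>144 * C\<close>. The summand
    \<kappa> serves the lower bound on the norm.\<close>
  define K where "K = 144 * C + \<kappa>"
  have K: "C \<le> K" "\<kappa> \<le> K" "1 \<le> K" "144 * C \<le> K" using C \<kappa>(1) by (auto simp: K_def)
  show thesis
  proof (rule that[OF K(3)])
    fix X f \<alpha> \<beta>
    assume f: "holomorphic_disc X f" and X: "\<forall>i\<le>4. X \<inter> form_line (a i) = {}"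
      and \<alpha>: "\<alpha> \<in> unit_disc" and \<beta>: "\<beta> \<in> unit_disc"
    obtain F where F: "\<And>k. (\<lambda>z. F z $ k) holomorphic_on ball 0 1"
      and absF: "\<And>z. z \<in> ball 0 1 \<Longrightarrow> F z \<noteq> 0 \<and> abs_cp2 (F z) = f z"
      using holomorphic_disc_lift[OF f, of "a 0"] X by auto
    obtain t where t: "norm t < 1" "t = Moebius_function 0 \<alpha> \<beta>" "poincare_dist \<alpha> \<beta> = 2 * artanh (norm t)"
      by (rule poincare_dist_Moebius[OF \<alpha> \<beta>])
    define \<phi> where "\<phi> = Moebius_function 0 (- \<alpha>)"
    have \<phi>b: "\<phi> z \<in> ball 0 1" if "z \<in> ball 0 1" for z
      using Moebius_function_norm_lt_1[of "- \<alpha>" z 0] that \<alpha> by (simp add: \<phi>_def)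
    have hol\<phi>: "\<phi> holomorphic_on ball 0 1"
      unfolding \<phi>_def by (rule Moebius_function_holomorphic) (use \<alpha> in simp)
    have \<phi>0: "\<phi> 0 = \<alpha>" by (simp add: \<phi>_def Moebius_function_simple)
    have \<phi>t: "\<phi> t = \<beta>"
      unfolding \<phi>_def t(2) by (rule Moebius_function_compose) (use \<alpha> \<beta> in auto)
    define G where "G z = F (\<phi> z)" for z
    have G: "(\<lambda>z. G z $ k) holomorphic_on ball 0 1" for k
    proof -
      have "((\<lambda>z. F z $ k) \<circ> \<phi>) holomorphic_on ball 0 1"
        by (rule holomorphic_on_compose_gen[OF hol\<phi> F]) (use \<phi>b in auto)
      then show ?thesis by (simp add: G_def o_def)
    qed
    have absG: "G z \<noteq> 0" "abs_cp2 (G z) = f (\<phi> z)" if "z \<in> ball 0 1" for z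
      using absF[OF \<phi>b[OF that]] by (auto simp: G_def)
    have linG: "lin (a i) (G z) \<noteq> 0" if "z \<in> ball 0 1" "i \<le> 4" for z i
    proof -
      have "f (\<phi> z) \<in> X" using f \<phi>b[OF that(1)] by (auto simp: holomorphic_disc_def)
      then have "abs_cp2 (G z) \<notin> form_line (a i)" using X that(2) absG(2)[OF that(1)] by auto
      then show ?thesis using in_form_line_iff[OF absG(1)[OF that(1)]] by blast
    qed
    obtain i where i: "i \<le> 4" "\<And>z. z \<in> ball 0 (1/16) \<Longrightarrow> norm (G z) \<le> C * norm (lin (a i) (G z))"
      using green[of G, OF G linG] by auto
    \<comment> \<open>Division by the dominating form bounds \<open>W\<close> above by
      \<open>C\<close>. It also makes \<open>lin (a i) (W z)\<close> equal to \<open>1\<close>,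
      which bounds \<open>W\<close> away from \<open>0\<close>.\<close>
    define W where "W z = (1 / lin (a i) (G z)) *s G z" for z
    have sub: "ball 0 (1/16) \<subseteq> ball (0::complex) 1" by auto
    have WC: "norm (W z) \<le> C" if "z \<in> ball 0 (1/16)" for z
      using i(2)[OF that] linG[OF _ i(1), of z] that sub
      by (auto simp: W_def norm_cscale norm_divide divide_le_eq)
    have holW: "(\<lambda>z. W z $ k) holomorphic_on ball 0 (1/16)" for k
    proof -
      have "(\<lambda>z. 1 / lin (a i) (G z) * G z $ k) holomorphic_on ball 0 (1/16)"
        by (intro holomorphic_intros holomorphic_on_lin holomorphic_on_subset[OF G sub])
           (use linG i(1) sub in blast)
      then show ?thesis by (simp add: W_def)
    qed
    have W: "W z \<noteq> 0 \<and> norm (W z) \<le> K \<and> 1 \<le> K * norm (W z) \<and>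
        norm (W z - W 0) \<le> K * norm z \<and> (\<forall>j\<le>4. lin (a j) (W z) \<noteq> 0)" if z: "z \<in> ball 0 (1/16)" for z
    proof (intro conjI allI impI)
      have z1: "z \<in> ball 0 1" using z sub by blast
      have l: "lin (a i) (G z) \<noteq> 0" by (rule linG[OF z1 i(1)])
      show "W z \<noteq> 0" using l absG(1)[OF z1] by (metis W_def divide_eq_0_iff norm_cscale norm_eq_zero mult_eq_0_iff one_neq_zero)
      show "norm (W z) \<le> K" using WC[OF z] K by linarith
      have "lin (a i) (W z) = 1" using l by (simp add: W_def lin_scale)
      then have "1 \<le> \<kappa> * norm (W z)" using \<kappa>(2)[OF i(1), of "W z"] by simp
      also have "\<dots> \<le> K * norm (W z)" using K by (intro mult_right_mono) auto
      finally show "1 \<le> K * norm (W z)" .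
      show "lin (a j) (W z) \<noteq> 0" if "j \<le> 4" for j
        using l linG[OF z1 that] by (simp add: W_def lin_scale)
      have "norm (W z $ k - W 0 $ k) \<le> 48 * C * norm z" for k
      proof -
        have "norm (W z $ k - W 0 $ k) \<le> 3 * C / (1/16) * norm z"
          by (rule holomorphic_lipschitz_at_0[OF holW _ C z])
             (use WC Finite_Cartesian_Product.norm_nth_le order_trans in blast)
        then show ?thesis by simp
      qed
      then have "(\<Sum>k\<in>UNIV. norm ((W z - W 0) $ k)) \<le> (\<Sum>k\<in>(UNIV::3 set). 48 * C * norm z)"
        by (intro sum_mono) simp
      also have "\<dots> = 144 * C * norm z" by simp
      also have "\<dots> \<le> K * norm z" using K by (intro mult_right_mono) auto
      finally show "norm (W z - W 0) \<le> K * norm z" using norm_le_sum_components[of "W z - W 0"] by linarith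
    qed
    have absW: "abs_cp2 (W z) = f (\<phi> z)" if "z \<in> ball 0 (1/16)" for z
    proof -
      have z1: "z \<in> ball 0 1" using that sub by blast
      then show ?thesis using abs_cp2_scale[OF absG(1)[OF z1], of "1 / lin (a i) (G z)"] linG[OF z1 i(1)] absG(2)[OF z1]
        by (simp add: W_def)
    qed
    show "\<exists>W t. norm t < 1 \<and> poincare_dist \<alpha> \<beta> = 2 * artanh (norm t) \<and>
      normal_lift a K W \<and>
      abs_cp2 (W 0) = f \<alpha> \<and> (norm t < 1/16 \<longrightarrow> abs_cp2 (W t) = f \<beta>)"
    proof (intro exI[of _ W] exI[of _ t] conjI allI ballI impI)
      show "abs_cp2 (W 0) = f \<alpha>" using absW[of 0] \<phi>0 by simp
      show "abs_cp2 (W t) = f \<beta>" if "norm t < 1/16" using absW[of t] \<phi>t that by simp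
      show "normal_lift a K W" unfolding normal_lift_def using holW W by blast
    qed (use t in auto)
  qed
qed

lemma segre_disc_lipschitz:
  assumes a: "general_forms a"
  obtains K where "K > 0" "\<And>X f \<alpha> \<beta> k l. holomorphic_disc X f \<Longrightarrow> (\<forall>i\<le>4. X \<inter> form_line (a i) = {}) \<Longrightarrow>
    \<alpha> \<in> unit_disc \<Longrightarrow> \<beta> \<in> unit_disc \<Longrightarrow>
    norm (segre k l (f \<beta>) - segre k l (f \<alpha>)) \<le> K * poincare_dist \<alpha> \<beta>"
proof -
  obtain C where C: "C \<ge> 1" and nf: "\<And>X f \<alpha> \<beta>. holomorphic_disc X f \<Longrightarrow> (\<forall>i\<le>4. X \<inter> form_line (a i) = {}) \<Longrightarrow>
    \<alpha> \<in> unit_disc \<Longrightarrow> \<beta> \<in> unit_disc \<Longrightarrow>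
    \<exists>W t. norm t < 1 \<and> poincare_dist \<alpha> \<beta> = 2 * artanh (norm t) \<and> normal_lift a C W \<and>
      abs_cp2 (W 0) = f \<alpha> \<and> (norm t < 1/16 \<longrightarrow> abs_cp2 (W t) = f \<beta>)"
    by (rule disc_normal_form[OF a]) blast
  \<comment> \<open>The first summand covers parameters below \<open>1/16\<close>. Beyond that the
    difference of two values bounded by \<open>1\<close> is at most \<open>2\<close>, that is
    \<open>32\<close> times \<open>1/16\<close>.\<close>
  define K where "K = 4 * C\<^sup>2 + 32"
  have K: "K > 0" by (simp add: K_def add_nonneg_pos)
  show thesis
  proof (rule that[OF K])
    fix X f \<alpha> \<beta> and k l :: 3
    assume hyp: "holomorphic_disc X f" "\<forall>i\<le>4. X \<inter> form_line (a i) = {}" "\<alpha> \<in> unit_disc" "\<beta> \<in> unit_disc"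
    obtain W t where t: "norm t < 1" "poincare_dist \<alpha> \<beta> = 2 * artanh (norm t)"
      and nl: "normal_lift a C W"
      and W0: "abs_cp2 (W 0) = f \<alpha>" and Wt: "norm t < 1/16 \<Longrightarrow> abs_cp2 (W t) = f \<beta>"
      using nf[OF hyp] by blast
    have holW: "\<forall>k. (\<lambda>z. W z $ k) holomorphic_on ball 0 (1/16)"
      and W: "\<forall>z\<in>ball 0 (1/16). W z \<noteq> 0 \<and> norm (W z) \<le> C \<and> 1 \<le> C * norm (W z) \<and>
        norm (W z - W 0) \<le> C * norm z \<and> (\<forall>i\<le>4. lin (a i) (W z) \<noteq> 0)"
      using nl by (simp_all add: normal_lift_def)
    have "norm (segre k l (f \<beta>) - segre k l (f \<alpha>)) \<le> K * norm t"
    proof (cases "norm t < 1/16")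
      case True
      have Wz: "W 0 \<noteq> 0" "W t \<noteq> 0" "1 \<le> C * norm (W 0)" "norm (W t - W 0) \<le> C * norm t"
        using W True by auto
      have "norm (segre k l (f \<beta>) - segre k l (f \<alpha>)) \<le> 4 * norm (W t - W 0) / norm (W 0)"
        using segre_lipschitz[OF Wz(1,2), of k l] W0 Wt[OF True] by simp
      also have "\<dots> \<le> 4 * norm (W t - W 0) * C"
      proof -
        have "norm (W t - W 0) * 1 \<le> norm (W t - W 0) * (C * norm (W 0))"
          using Wz(3) by (intro mult_left_mono) auto
        then show ?thesis using Wz(1) by (simp add: divide_le_eq mult_ac)
      qed
      also have "\<dots> \<le> 4 * (C * norm t) * C" using Wz(4) C by (intro mult_right_mono) auto
      also have "\<dots> \<le> K * norm t" by (simp add: K_def power2_eq_square algebra_simps)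
      finally show ?thesis .
    next
      case False
      have "norm (segre k l (f \<beta>) - segre k l (f \<alpha>)) \<le> 1 + 1"
        by (rule order_trans[OF norm_triangle_ineq4]) (intro add_mono norm_segre_le)
      also have "\<dots> \<le> 32 * norm t" using False by simp
      also have "\<dots> \<le> K * norm t" by (intro mult_right_mono) (auto simp: K_def)
      finally show ?thesis .
    qed
    also have "\<dots> \<le> K * poincare_dist \<alpha> \<beta>"
      unfolding t(2) using K artanh_ge_half[of "norm t"] t(1) by (intro mult_left_mono) auto
    finally show "norm (segre k l (f \<beta>) - segre k l (f \<alpha>)) \<le> K * poincare_dist \<alpha> \<beta>" .
  qed
qed

lemma ln_diff_le_ratio:
  fixes x y k :: real
  assumes "0 < x" "0 < y" "x - y \<le> k * y"
  shows "ln x - ln y \<le> k"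
proof -
  have "ln x - ln y = ln (x / y)" using assms by (simp add: ln_div)
  also have "\<dots> \<le> x / y - 1" using assms by (intro ln_le_minus_one) auto
  also have "\<dots> = (x - y) / y" using assms by (simp add: diff_divide_distrib)
  also have "\<dots> \<le> k" using assms by (simp add: divide_le_eq)
  finally show ?thesis .
qed

text \<open>Near a line the Kobayashi metric dominates that of the punctured disc, whose potential is
  \<open>ln (- ln \<bar>z\<bar>)\<close>; the constant \<open>c\<close> keeps the inner argument at least \<open>1\<close>.\<close>

lemma line_dist_disc_lipschitz:
  assumes a: "general_forms a"
  obtains K c where "K > 0" "\<And>X f \<alpha> \<beta>. holomorphic_disc X f \<Longrightarrow> (\<forall>i\<le>4. X \<inter> form_line (a i) = {}) \<Longrightarrow>
    \<alpha> \<in> unit_disc \<Longrightarrow> \<beta> \<in> unit_disc \<Longrightarrow> poincare_dist \<alpha> \<beta> < 1/32 \<Longrightarrow>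
    norm (ln (c - ln (line_dist (a 0) (f \<beta>))) - ln (c - ln (line_dist (a 0) (f \<alpha>)))) \<le> K * poincare_dist \<alpha> \<beta>"
proof -
  obtain C where C: "C \<ge> 1" and nf: "\<And>X f \<alpha> \<beta>. holomorphic_disc X f \<Longrightarrow> (\<forall>i\<le>4. X \<inter> form_line (a i) = {}) \<Longrightarrow>
    \<alpha> \<in> unit_disc \<Longrightarrow> \<beta> \<in> unit_disc \<Longrightarrow>
    \<exists>W t. norm t < 1 \<and> poincare_dist \<alpha> \<beta> = 2 * artanh (norm t) \<and> normal_lift a C W \<and>
      abs_cp2 (W 0) = f \<alpha> \<and> (norm t < 1/16 \<longrightarrow> abs_cp2 (W t) = f \<beta>)"
    by (rule disc_normal_form[OF a]) blast
  obtain \<kappa> where \<kappa>: "\<kappa> \<ge> 1" "\<And>i v. i \<le> 4 \<Longrightarrow> norm (lin (a i) v) \<le> \<kappa> * norm v"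
    by (rule general_forms_coercive[OF a]) blast
  \<comment> \<open>An upper bound for \<open>lin (a 0)\<close> on the normalised lift, so that the
    quotient \<open>Q\<close> has modulus at most \<open>1\<close> and Harnack's inequality
    applies.\<close>
  define M where "M = \<kappa> * C"
  have M: "M > 0" using \<kappa>(1) C by (simp add: M_def)
  define c where "c = ln M + ln C + 1"
  \<comment> \<open>For \<open>norm t < 1/32\<close> the factor \<open>1/16 - norm t\<close> in
    Harnack's inequality exceeds \<open>1/32\<close>, so the relative change is at most
    \<open>2 * 32 * norm t\<close>. The summand \<open>C\<^sup>2\<close> accounts for the change of
    \<open>ln (norm (W z))\<close>.\<close>
  define K where "K = 64 + C\<^sup>2"
  have K: "K > 0" by (simp add: K_def add_pos_nonneg)
  show thesis
  proof (rule that[OF K, of c])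
    fix X f \<alpha> \<beta>
    assume hyp: "holomorphic_disc X f" "\<forall>i\<le>4. X \<inter> form_line (a i) = {}" "\<alpha> \<in> unit_disc" "\<beta> \<in> unit_disc"
      and small: "poincare_dist \<alpha> \<beta> < 1/32"
    obtain W t where t: "norm t < 1" "poincare_dist \<alpha> \<beta> = 2 * artanh (norm t)"
      and nl: "normal_lift a C W"
      and W0: "abs_cp2 (W 0) = f \<alpha>" and Wt: "norm t < 1/16 \<Longrightarrow> abs_cp2 (W t) = f \<beta>"
      using nf[OF hyp] by blast
    have holW: "\<forall>k. (\<lambda>z. W z $ k) holomorphic_on ball 0 (1/16)"
      and W: "\<forall>z\<in>ball 0 (1/16). W z \<noteq> 0 \<and> norm (W z) \<le> C \<and> 1 \<le> C * norm (W z) \<and>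
        norm (W z - W 0) \<le> C * norm z \<and> (\<forall>i\<le>4. lin (a i) (W z) \<noteq> 0)"
      using nl by (simp_all add: normal_lift_def)
    have t_le: "norm t \<le> poincare_dist \<alpha> \<beta>"
      unfolding t(2) using t(1) by (intro artanh_ge_half) auto
    then have t32: "norm t < 1/32" using small by linarith
    then have t16: "t \<in> ball 0 (1/16)" by simp
    define Q where "Q z = lin (a 0) (W z) / of_real M" for z
    have holQ: "Q holomorphic_on ball 0 (1/16)"
      unfolding Q_def using holW M by (intro holomorphic_intros holomorphic_on_lin) auto
    have Qnz: "Q z \<noteq> 0" if "z \<in> ball 0 (1/16)" for z
      using W that M by (auto simp: Q_def)
    have Q1: "norm (Q z) \<le> 1" if z: "z \<in> ball 0 (1/16)" for z
    proof -
      have "norm (lin (a 0) (W z)) \<le> \<kappa> * norm (W z)" by (rule \<kappa>(2)) simp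
      also have "\<dots> \<le> M" unfolding M_def using W z \<kappa>(1) by (intro mult_left_mono) auto
      finally show ?thesis using M by (simp add: Q_def norm_divide divide_le_eq)
    qed
    define H where "H z = - ln (norm (Q z))" for z
    have Hpos: "0 \<le> H z" if "z \<in> ball 0 (1/16)" for z
      using Q1[OF that] Qnz[OF that] by (simp add: H_def ln_le_zero_iff)
    have har: "(1/16 - norm t) * H t \<le> (1/16 + norm t) * H 0" "(1/16 - norm t) * H 0 \<le> (1/16 + norm t) * H t"
      using Harnack_ln[OF holQ Qnz Q1, of t] t16 by (auto simp: H_def)
    have step: "y - x \<le> 64 * norm t * x" if "(1/16 - norm t) * y \<le> (1/16 + norm t) * x" "0 \<le> x" for x y
    proof (cases "y \<le> x")
      case True
      have "0 \<le> 64 * norm t * x" using that(2) by simp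
      then show ?thesis using True by linarith
    next
      case False
      then have "1/32 * (y - x) \<le> (1/16 - norm t) * (y - x)" using t32 by (intro mult_right_mono) auto
      also have "\<dots> \<le> 2 * norm t * x" using that(1) by (simp add: algebra_simps)
      finally show ?thesis by simp
    qed
    define S where "S z = c - ln (norm (lin (a 0) (W z)) / norm (W z))" for z
    have Seq: "S z = H z + (ln (norm (W z)) + ln C) + 1" if z: "z \<in> ball 0 (1/16)" for z
    proof -
      have nz: "lin (a 0) (W z) \<noteq> 0" "W z \<noteq> 0" using W z by auto
      then show ?thesis using M by (simp add: S_def H_def Q_def c_def norm_divide ln_div)
    qed
    have Wln: "0 \<le> ln (norm (W z)) + ln C" if z: "z \<in> ball 0 (1/16)" for z
    proof -
      have "1 \<le> C * norm (W z)" "W z \<noteq> 0" using W z by auto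
      then have "0 \<le> ln (C * norm (W z))" using ln_ge_zero by blast
      then show ?thesis using C \<open>W z \<noteq> 0\<close> by (simp add: ln_mult)
    qed
    have SH: "H z + 1 \<le> S z" if z: "z \<in> ball 0 (1/16)" for z using Seq[OF z] Wln[OF z] by linarith
    have lnW: "\<bar>ln (norm (W t)) - ln (norm (W 0))\<bar> \<le> C\<^sup>2 * norm t"
    proof -
      have *: "1 \<le> C * norm (W t)" "1 \<le> C * norm (W 0)" "norm (W t - W 0) \<le> C * norm t" using W t16 by auto
      have "\<bar>ln (norm (W t)) - ln (norm (W 0))\<bar> \<le> \<bar>norm (W t) - norm (W 0)\<bar> / (1 / C)"
        using * C by (intro abs_ln_diff_le) (auto simp: divide_le_eq mult_ac)
      also have "\<dots> = \<bar>norm (W t) - norm (W 0)\<bar> * C" by simp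
      also have "\<dots> \<le> (C * norm t) * C"
        using C *(3) norm_triangle_ineq3[of "W t" "W 0"] by (intro mult_right_mono) auto
      finally show ?thesis by (simp add: power2_eq_square mult_ac)
    qed
    have z0: "(0::complex) \<in> ball 0 (1/16)" by simp
    \<comment> \<open>The change of \<open>H\<close> is relative to its size, that of
      \<open>ln (norm (W z))\<close> is absolute. Since \<open>S\<close> is at least
      \<open>H + 1\<close>, both are relative to \<open>S\<close>, and the outer logarithm makes
      this a Lipschitz bound.\<close>
    have diff: "S y - S x \<le> (K * norm t) * S x"
      if "H y - H x \<le> 64 * norm t * H x" "ln (norm (W y)) - ln (norm (W x)) \<le> C\<^sup>2 * norm t"
        "x \<in> ball 0 (1/16)" "y \<in> ball 0 (1/16)" for x y
    proof -
      have "S y - S x = (H y - H x) + (ln (norm (W y)) - ln (norm (W x)))" using Seq that(3,4) by simp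
      also have "\<dots> \<le> 64 * norm t * H x + C\<^sup>2 * norm t" using that(1,2) by linarith
      also have "\<dots> \<le> (K * norm t) * (H x + 1)"
        using Hpos[OF that(3)] by (simp add: K_def algebra_simps)
      also have "\<dots> \<le> (K * norm t) * S x" using SH[OF that(3)] K by (intro mult_left_mono) auto
      finally show ?thesis .
    qed
    have Spos: "0 < S z" if "z \<in> ball 0 (1/16)" for z using SH[OF that] Hpos[OF that] by linarith
    have "ln (S t) - ln (S 0) \<le> K * norm t"
      by (rule ln_diff_le_ratio[OF Spos[OF t16] Spos[OF z0] diff[OF step[OF har(1) Hpos[OF z0]] _ z0 t16]])
         (use lnW in linarith)
    moreover have "ln (S 0) - ln (S t) \<le> K * norm t"
      by (rule ln_diff_le_ratio[OF Spos[OF z0] Spos[OF t16] diff[OF step[OF har(2) Hpos[OF t16]] _ t16 z0]])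
         (use lnW in linarith)
    ultimately have "\<bar>ln (S t) - ln (S 0)\<bar> \<le> K * norm t" by linarith
    also have "\<dots> \<le> K * poincare_dist \<alpha> \<beta>" using t_le K by (intro mult_left_mono) auto
    finally have "\<bar>ln (S t) - ln (S 0)\<bar> \<le> K * poincare_dist \<alpha> \<beta>" .
    moreover have "S t = c - ln (line_dist (a 0) (f \<beta>))" "S 0 = c - ln (line_dist (a 0) (f \<alpha>))"
      using W t16 Wt W0 line_dist_abs[of "W t" "a 0"] line_dist_abs[of "W 0" "a 0"] by (auto simp: S_def)
    ultimately show "norm (ln (c - ln (line_dist (a 0) (f \<beta>))) - ln (c - ln (line_dist (a 0) (f \<alpha>))))
        \<le> K * poincare_dist \<alpha> \<beta>"
      by simp
  qed
qed

section \<open>Hyperbolicity and completeness\<close>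

lemma kobayashi_dist_ge_segre:
  assumes X: "open X" "connected X" and a: "general_forms a" "\<forall>i\<le>4. X \<inter> form_line (a i) = {}"
  obtains K where "K > 0" "\<And>p q k l. p \<in> X \<Longrightarrow> q \<in> X \<Longrightarrow>
    norm (segre k l q - segre k l p) \<le> K * kobayashi_dist X p q"
proof -
  obtain K where K: "K > 0" and lip: "\<And>X f \<alpha> \<beta> k l. holomorphic_disc X f \<Longrightarrow>
    (\<forall>i\<le>4. X \<inter> form_line (a i) = {}) \<Longrightarrow> \<alpha> \<in> unit_disc \<Longrightarrow> \<beta> \<in> unit_disc \<Longrightarrow>
    norm (segre k l (f \<beta>) - segre k l (f \<alpha>)) \<le> K * poincare_dist \<alpha> \<beta>"
    by (rule segre_disc_lipschitz[OF a(1)]) blast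
  show thesis
  proof (rule that[OF K])
    fix p q k l assume pq: "p \<in> X" "q \<in> X"
    have "norm (segre k l q - segre k l p) / K \<le> kobayashi_dist X p q"
    proof (rule kobayashi_dist_greatest[OF X pq])
      fix s assume s: "s \<in> kobayashi_chain_lengths X p q"
      have "norm (segre k l q - segre k l p) \<le> K * s"
        \<comment> \<open>The estimate for a single disc holds at every distance, so any bound above
          \<open>s\<close> may be inserted.\<close>
        by (rule chain_lipschitz[where \<epsilon> = "s + 1", OF _ s]) (use lip a(2) in auto)
      then show "norm (segre k l q - segre k l p) / K \<le> s" using K by (simp add: divide_le_eq mult.commute)
    qed
    then show "norm (segre k l q - segre k l p) \<le> K * kobayashi_dist X p q"
      using K by (simp add: divide_le_eq mult.commute)
  qed
qed

lemma hyperbolic_of_five_lines: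
  assumes X: "open X" "connected X" and a: "general_forms a" "\<forall>i\<le>4. X \<inter> form_line (a i) = {}"
  shows "Metric_space X (kobayashi_dist X)" and "kobayashi_hyperbolically_embedded X"
proof -
  obtain K where K: "K > 0" and low: "\<And>p q k l. p \<in> X \<Longrightarrow> q \<in> X \<Longrightarrow>
    norm (segre k l q - segre k l p) \<le> K * kobayashi_dist X p q"
    by (rule kobayashi_dist_ge_segre[OF X a]) blast
  show "Metric_space X (kobayashi_dist X)"
  proof (rule kobayashi_Metric_space[OF X])
    fix p q assume "p \<in> X" "q \<in> X" "kobayashi_dist X p q = 0"
    then have "segre k l p = segre k l q" for k l using low[of p q k l] by simp
    then show "p = q" by (rule segre_separates)
  qed
  show "kobayashi_hyperbolically_embedded X"
    unfolding kobayashi_hyperbolically_embedded_def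
  proof (intro ballI impI)
    fix p q assume "p \<in> closure X" "q \<in> closure X" "p \<noteq> q"
    then obtain k l where kl: "segre k l p \<noteq> segre k l q" using segre_separates by blast
    \<comment> \<open>With a third of the distance as radius, values from the two balls are at least
      \<delta> apart.\<close>
    define \<delta> where "\<delta> = dist (segre k l p) (segre k l q) / 3"
    have \<delta>: "\<delta> > 0" using kl by (simp add: \<delta>_def)
    have op: "open (segre k l -` ball c \<delta>)" for c
      using continuous_on_segre[of k l] by (simp add: continuous_on_open_vimage)
    define U where "U = segre k l -` ball (segre k l p) \<delta>"
    define V where "V = segre k l -` ball (segre k l q) \<delta>"
    have "open U" "p \<in> U" "open V" "q \<in> V" "0 < \<delta> / K"
      using op \<delta> K by (auto simp: U_def V_def)
    moreover have "\<forall>x\<in>U \<inter> X. \<forall>y\<in>V \<inter> X. \<delta> / K \<le> kobayashi_dist X x y"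
    proof (intro ballI)
      fix x y assume "x \<in> U \<inter> X" "y \<in> V \<inter> X"
      then have xy: "dist (segre k l p) (segre k l x) < \<delta>" "dist (segre k l q) (segre k l y) < \<delta>" "x \<in> X" "y \<in> X"
        by (auto simp: U_def V_def)
      have "3 * \<delta> \<le> dist (segre k l p) (segre k l x) + dist (segre k l x) (segre k l y) + dist (segre k l q) (segre k l y)"
        using dist_triangle[of "segre k l p" "segre k l q" "segre k l x"]
          dist_triangle[of "segre k l x" "segre k l q" "segre k l y"]
        by (simp add: \<delta>_def dist_commute)
      then have "\<delta> \<le> dist (segre k l y) (segre k l x)" using xy by (simp add: dist_commute)
      also have "\<dots> \<le> K * kobayashi_dist X x y" using low[OF xy(3,4)] by (simp add: dist_norm)
      finally show "\<delta> / K \<le> kobayashi_dist X x y" using K by (simp add: divide_le_eq mult.commute)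
    qed
    ultimately show "\<exists>U V \<epsilon>. open U \<and> p \<in> U \<and> open V \<and> q \<in> V \<and> 0 < \<epsilon> \<and>
        (\<forall>x\<in>U \<inter> X. \<forall>y\<in>V \<inter> X. \<epsilon> \<le> kobayashi_dist X x y)"
      by blast
  qed
qed

lemma cp2_unit_representative:
  obtains v where "norm v = 1" "p = abs_cp2 v"
proof -
  obtain v where v: "v \<noteq> 0" "p = abs_cp2 v" by (rule cp2_cases)
  have c: "complex_of_real (inverse (norm v)) \<noteq> 0" using v by simp
  show thesis
  proof (rule that)
    show "norm (of_real (inverse (norm v)) *s v) = 1" using v by (simp add: norm_cscale norm_inverse)
    show "p = abs_cp2 (of_real (inverse (norm v)) *s v)" using abs_cp2_scale[OF v(1) c] v(2) by simp
  qed
qed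

text \<open>Compactness of the unit sphere provides a limit point in the projective plane. If it
  lies in \<open>X\<close>, small affine discs give convergence of the subsequence in the Kobayashi
  distance, and the Cauchy property extends this to the whole sequence. The boundary alternative is
  excluded by the function \<psi>, which is unbounded near the line through that point.\<close>

lemma complete_of_boundary_lines:
  assumes X: "open X" "connected X" and M: "Metric_space X (kobayashi_dist X)"
    and bdry: "\<And>p. p \<in> closure X - X \<Longrightarrow>
      \<exists>a. general_forms a \<and> (\<forall>i\<le>4. X \<inter> form_line (a i) = {}) \<and> p \<in> form_line (a 0)"
  shows "Metric_space.mcomplete X (kobayashi_dist X)"
proof -
  interpret Metric_space X "kobayashi_dist X" by (rule M)
  show ?thesis
    unfolding mcomplete_def
  proof (intro allI impI)
    fix \<sigma> assume cauchy: "MCauchy \<sigma>"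
    have \<sigma>X: "\<sigma> n \<in> X" for n using cauchy by (auto simp: MCauchy_def)
    have "\<exists>v. norm v = 1 \<and> \<sigma> n = abs_cp2 v" for n by (rule cp2_unit_representative) blast
    then obtain u where u: "\<And>n. norm (u n) = 1" "\<And>n. \<sigma> n = abs_cp2 (u n)" by metis
    have "seq_compact (sphere (0::complex^3) 1)" by (simp add: compact_imp_seq_compact)
    moreover have "\<forall>n. u n \<in> sphere 0 1" using u(1) by simp
    ultimately obtain v r where v: "v \<in> sphere 0 1" and r: "strict_mono (r :: nat \<Rightarrow> nat)" and lim: "(u \<circ> r) \<longlonglongrightarrow> v"
      unfolding seq_compact_def by blast
    have v0: "v \<noteq> 0" using v by auto
    have absX: "abs_cp2 ((u \<circ> r) n) \<in> X" for n using \<sigma>X u(2) by (metis comp_apply)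
    have "abs_cp2 v \<in> X"
    proof (rule ccontr)
      assume "abs_cp2 v \<notin> X"
      moreover have "abs_cp2 v \<in> closure X"
        unfolding closure_iff_nhds_not_empty
      proof (intro allI impI)
        fix A V assume AV: "V \<subseteq> A" "open V" "abs_cp2 v \<in> V"
        then have "open {v. v \<noteq> 0 \<and> abs_cp2 v \<in> V}" "v \<in> {v. v \<noteq> 0 \<and> abs_cp2 v \<in> V}"
          using v0 by (auto simp: open_cp2_def)
        from topological_tendstoD[OF lim this] obtain n where "abs_cp2 ((u \<circ> r) n) \<in> V"
          by (auto simp: eventually_sequentially)
        then show "X \<inter> A \<noteq> {}" using absX AV(1) by blast
      qed
      ultimately obtain a where a: "general_forms a" "\<forall>i\<le>4. X \<inter> form_line (a i) = {}" "abs_cp2 v \<in> form_line (a 0)"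
        using bdry by blast
      obtain K c where K: "K > 0" and lip: "\<And>X f \<alpha> \<beta>. holomorphic_disc X f \<Longrightarrow>
        (\<forall>i\<le>4. X \<inter> form_line (a i) = {}) \<Longrightarrow> \<alpha> \<in> unit_disc \<Longrightarrow> \<beta> \<in> unit_disc \<Longrightarrow> poincare_dist \<alpha> \<beta> < 1/32 \<Longrightarrow>
        norm (ln (c - ln (line_dist (a 0) (f \<beta>))) - ln (c - ln (line_dist (a 0) (f \<alpha>)))) \<le> K * poincare_dist \<alpha> \<beta>"
        by (rule line_dist_disc_lipschitz[OF a(1)]) blast
      define \<psi> where "\<psi> p = ln (c - ln (line_dist (a 0) p))" for p
      obtain N where N: "\<And>m n. N \<le> m \<Longrightarrow> N \<le> n \<Longrightarrow> kobayashi_dist X (\<sigma> m) (\<sigma> n) < 1/32"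
        using cauchy unfolding MCauchy_def by (meson zero_less_divide_1_iff zero_less_numeral)
      \<comment> \<open>All later terms are compared with the single term \<open>\<sigma> N\<close>,
        each by a chain shorter than \<open>1/32\<close>; this gives one bound for the whole
        tail.\<close>
      have bound: "\<psi> (\<sigma> n) \<le> \<psi> (\<sigma> N) + K / 32" if n: "N \<le> n" for n
      proof -
        obtain s where s: "s \<in> kobayashi_chain_lengths X (\<sigma> N) (\<sigma> n)" "s < 1/32"
          by (rule kobayashi_dist_lessE[OF X \<sigma>X \<sigma>X N[OF order_refl n]])
        have "norm (\<psi> (\<sigma> n) - \<psi> (\<sigma> N)) \<le> K * s"
          by (rule chain_lipschitz[where \<epsilon> = "1/32", OF _ s]) (use lip a(2) in \<open>auto simp: \<psi>_def\<close>)
        also have "\<dots> \<le> K * (1/32)" using s(2) K by (intro mult_left_mono) auto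
        finally show ?thesis unfolding real_norm_def by linarith
      qed
      have ld: "line_dist (a 0) (\<sigma> n) = norm (lin (a 0) (u n))" for n
        using line_dist_abs[of "u n" "a 0"] u[of n] by (metis div_by_1 norm_zero zero_neq_one)
      have pos: "norm (lin (a 0) (u n)) > 0" for n
      proof -
        have "\<sigma> n \<notin> form_line (a 0)" using a(2) \<sigma>X[of n] by blast
        moreover have "u n \<noteq> 0" using u(1)[of n] by auto
        ultimately have "lin (a 0) (u n) \<noteq> 0" using in_form_line_iff[of "u n" "a 0"] u(2)[of n] by auto
        then show ?thesis by simp
      qed
      have "continuous_on UNIV (lin (a 0))" using continuous_on_lin[OF continuous_on_id, of UNIV "a 0"] by simp
      then have "(\<lambda>n. lin (a 0) ((u \<circ> r) n)) \<longlonglongrightarrow> lin (a 0) v"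
        using continuous_on_tendsto_compose[OF _ lim, of UNIV "lin (a 0)"] by simp
      moreover have "lin (a 0) v = 0" using a(3) in_form_line_iff[OF v0] by blast
      ultimately have "(\<lambda>n. norm (lin (a 0) (u (r n)))) \<longlonglongrightarrow> 0" using tendsto_norm_zero by fastforce
      then have "filterlim (\<lambda>n. norm (lin (a 0) (u (r n)))) (at_right 0) sequentially"
        using pos by (auto simp: filterlim_at intro!: always_eventually)
      then have "filterlim (\<lambda>n. ln (norm (lin (a 0) (u (r n))))) at_bot sequentially"
        by (rule filterlim_compose[OF ln_at_0])
      then have "filterlim (\<lambda>n. c + - ln (norm (lin (a 0) (u (r n))))) at_top sequentially"
        by (intro filterlim_tendsto_add_at_top[OF tendsto_const]) (simp add: filterlim_uminus_at_top)
      then have "filterlim (\<lambda>n. ln (c + - ln (norm (lin (a 0) (u (r n)))))) at_top sequentially"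
        by (rule filterlim_compose[OF ln_at_top])
      then have "\<forall>\<^sub>F n in sequentially. \<psi> (\<sigma> N) + K / 32 < ln (c + - ln (norm (lin (a 0) (u (r n)))))"
        by (simp add: filterlim_at_top_dense)
      then have "\<forall>\<^sub>F n in sequentially. \<psi> (\<sigma> N) + K / 32 < \<psi> (\<sigma> (r n))" by (simp add: \<psi>_def ld)
      then obtain m where "\<And>n. m \<le> n \<Longrightarrow> \<psi> (\<sigma> N) + K / 32 < \<psi> (\<sigma> (r n))"
        by (auto simp: eventually_sequentially)
      \<comment> \<open>A strictly increasing \<open>r\<close> satisfies \<open>k \<le> r k\<close>,
        so this index is late enough for both estimates.\<close>
      from this[of "max m N"] bound[of "r (max m N)"] seq_suble[OF r, of "max m N"] show False by simp
    qed
    from kobayashi_dist_tendsto[OF X(1) v0 this lim absX nonneg]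
    have tends: "(\<lambda>n. kobayashi_dist X (abs_cp2 v) (\<sigma> (r n))) \<longlonglongrightarrow> 0" by (simp add: u(2))
    have "limitin mtopology (\<sigma> \<circ> r) (abs_cp2 v) sequentially"
      unfolding limitin_metric
    proof (intro conjI allI impI)
      fix e :: real assume "e > 0"
      with tends have "\<forall>\<^sub>F n in sequentially. kobayashi_dist X (abs_cp2 v) (\<sigma> (r n)) < e"
        by (rule order_tendstoD(2))
      then show "\<forall>\<^sub>F n in sequentially. (\<sigma> \<circ> r) n \<in> X \<and> kobayashi_dist X ((\<sigma> \<circ> r) n) (abs_cp2 v) < e"
        by eventually_elim (simp add: \<sigma>X commute)
    qed fact
    then show "\<exists>x. limitin mtopology \<sigma> x sequentially"
      using MCauchy_convergent_subsequence[OF cauchy r] by blast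
  qed
qed

section \<open>Components of the complement and the conclusion\<close>

lemma connected_nbhd_cp2:
  fixes S :: "cp2 set"
  assumes "open S" "p \<in> S"
  obtains B where "open B" "connected B" "p \<in> B" "B \<subseteq> S"
proof -
  obtain v where v: "v \<noteq> 0" "p = abs_cp2 v" by (rule cp2_cases)
  obtain \<epsilon> where \<epsilon>: "\<epsilon> > 0" "\<And>u. u \<in> ball v \<epsilon> \<Longrightarrow> u \<noteq> 0 \<and> abs_cp2 u \<in> S"
    by (rule open_cp2_ball[OF assms(1) v(1)]) (use assms v in auto)
  show thesis
  proof (rule that[of "abs_cp2 ` ball v \<epsilon>"])
    show "open (abs_cp2 ` ball v \<epsilon>)"
      by (rule open_abs_cp2_image[OF open_ball]) (use \<epsilon>(2) in blast)
    show "connected (abs_cp2 ` ball v \<epsilon>)"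
      by (intro connected_continuous_image continuous_on_subset[OF continuous_on_abs_cp2] connected_ball)
         (use \<epsilon>(2) in blast)
    show "p \<in> abs_cp2 ` ball v \<epsilon>" "abs_cp2 ` ball v \<epsilon> \<subseteq> S" using v \<epsilon> by auto
  qed
qed

text \<open>Both claims rest on local connectedness: a point of \<open>S\<close> in the closure of
  \<open>C\<close> has a connected neighbourhood in \<open>S\<close> that meets \<open>C\<close>,
  and maximality of the component puts this neighbourhood inside \<open>C\<close>.\<close>

lemma component_open_cp2:
  fixes S :: "cp2 set"
  assumes S: "open S" and C: "C \<in> components S"
  shows "open C" and "closure C - C \<subseteq> frontier S"
proof -
  have grow: "B \<subseteq> C" if "connected B" "B \<subseteq> S" "C \<inter> B \<noteq> {}" for B
    using components_maximal[OF C that] .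
  show "open C"
  proof (subst open_subopen, intro ballI)
    fix p assume p: "p \<in> C"
    then have "p \<in> S" using in_components_subset[OF C] by blast
    then obtain B where "open B" "connected B" "p \<in> B" "B \<subseteq> S" by (rule connected_nbhd_cp2[OF S])
    then show "\<exists>T. open T \<and> p \<in> T \<and> T \<subseteq> C" using grow[of B] p by blast
  qed
  show "closure C - C \<subseteq> frontier S"
  proof
    fix p assume p: "p \<in> closure C - C"
    have "p \<notin> S"
    proof
      assume "p \<in> S"
      then obtain B where B: "open B" "connected B" "p \<in> B" "B \<subseteq> S" by (rule connected_nbhd_cp2[OF S])
      then have "C \<inter> B \<noteq> {}" using p open_Int_closure_eq_empty[of B C] by blast
      with grow[of B] B p show False by blast
    qed
    moreover have "p \<in> closure S" using p closure_mono[OF in_components_subset[OF C]] by blast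
    ultimately show "p \<in> frontier S" using S by (simp add: frontier_def interior_open)
  qed
qed

theorem theorem4p1:
  fixes \<C> :: "cp2 set set" and \<Omega> :: "cp2 set"
  assumes lines: "\<And>L. L \<in> \<C> \<Longrightarrow> projective_line L"
    and closed_union: "closed (\<Union>\<C>)"
    and \<Omega>_def: "\<Omega> = UNIV - \<Union>\<C>"
    and five_lines: "\<exists>l :: nat \<Rightarrow> cp2 set. (\<forall>i\<le>4. l i \<in> \<C>) \<and> general_position {..4} l"
    and boundary: "\<And>p. p \<in> frontier \<Omega> \<Longrightarrow>
      \<exists>l :: nat \<Rightarrow> cp2 set. (\<forall>i\<le>4. l i \<in> \<C>) \<and> general_position {..4} l \<and> p \<in> l 0"
  shows "\<forall>\<Omega>\<^sub>0 \<in> components \<Omega>.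
    complete_kobayashi_hyperbolic \<Omega>\<^sub>0 \<and> kobayashi_hyperbolically_embedded \<Omega>\<^sub>0"
proof
  fix X assume X: "X \<in> components \<Omega>"
  have "open \<Omega>" using closed_union by (simp add: \<Omega>_def open_Diff)
  note comp = component_open_cp2[OF this X]
  have conn: "connected X" using X by (rule in_components_connected)
  have forms: "\<exists>a. general_forms a \<and> (\<forall>i\<le>4. X \<inter> form_line (a i) = {}) \<and> (\<forall>i\<le>4. l i = form_line (a i))"
    if l: "\<forall>i\<le>4. l i \<in> \<C>" "general_position {..4} l" for l :: "nat \<Rightarrow> cp2 set"
  proof -
    obtain a where a: "general_forms a" "\<And>i. i \<le> 4 \<Longrightarrow> l i = form_line (a i)"
      using general_position_forms[of l] lines l by blast
    have "X \<inter> form_line (a i) = {}" if "i \<le> 4" for i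
      using a(2)[OF that] l(1) that in_components_subset[OF X] by (auto simp: \<Omega>_def)
    with a show ?thesis by blast
  qed
  obtain a where a: "general_forms a" "\<forall>i\<le>4. X \<inter> form_line (a i) = {}"
    using five_lines forms by blast
  note hyp = hyperbolic_of_five_lines[OF comp(1) conn a]
  have "Metric_space.mcomplete X (kobayashi_dist X)"
  proof (rule complete_of_boundary_lines[OF comp(1) conn hyp(1)])
    fix p assume "p \<in> closure X - X"
    then have "p \<in> frontier \<Omega>" using comp(2) by blast
    then obtain l :: "nat \<Rightarrow> cp2 set" where l: "\<forall>i\<le>4. l i \<in> \<C>" "general_position {..4} l" "p \<in> l 0"
      using boundary by blast
    with forms[OF l(1,2)] show "\<exists>a. general_forms a \<and> (\<forall>i\<le>4. X \<inter> form_line (a i) = {}) \<and> p \<in> form_line (a 0)"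
      by auto
  qed
  with hyp show "complete_kobayashi_hyperbolic X \<and> kobayashi_hyperbolically_embedded X"
    by (simp add: complete_kobayashi_hyperbolic_def)
qed

end
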